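(* Let $p$ be a real number, let $X$ be a real-valued random variable, and let $f$ denote the characteristic function of $X$. Also, let $J$ be a finite set. Suppose that (i) $h(x)=\overline{x^r}\,e^{iux}$ for some real $r$ and $u$ and all real $x$; (ii) $g(t)=\sum_{j\in J} a_j\,\overline{t^{q_j}}\,e^{iv_jt}$ for some functions $J\ni j\mapsto a_j\in\mathbb{C}\setminus\{0\}$, $J\ni j\mapsto q_j\in[0,\infty)$, and $J\ni j\mapsto v_j\in\mathbb{R}$, and for all real $t$; (iii) for each $j\in J$, one has $p>q_j-1$ if $v_j\ne0$, and $p>q_j$ if $v_j=0$; (iv) $|g(t)|=O(|t|^q)$ for some real $q>\max(0,p)$ and over all $t$ in a neighborhood of $0$; (v) $\mathsf{E}|X|^{r+p}+\mathsf{E}|X|^{r+q_j}<\infty$ for all $j\in J$. Then $$\frac1{i^r}\int_0^{\infty-} \sum_{j\in J} a_j\,(-it)^{q_j}\,f^{(r+q_j)}(u+v_j t)\,\frac{dt}{t^{p+1}}=c^+_p(g)\,\mathsf{E}X_+^{r+p} e^{iuX}+e^{-i\pi r}\,c^-_p(g)\,\mathsf{E}X_-^{r+p} e^{iuX}.$$ The limit $\int_0^{\infty-}$ in the left-hand side can be replaced by the Lebesgue integral $\int_0^\infty$ in the case when condition (iii) is satisfied in the strong sense that $p>q_j$ for all $j\in J$.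
   Context: $\int_0^{\infty-}:=\lim_{T\uparrow\infty}\int_0^T$. Any claim about an integral $\int_a^b$ with $0\le a<b\le\infty$ includes by default the statement that the integral exists in the Lebesgue sense and is finite. $c^+_p(g):=\lim_{\varepsilon\downarrow0,\,T\uparrow\infty}\int_\varepsilon^T \frac{g(t)}{t^{p+1}}\,dt$ and $c^-_p(g):=\lim_{\varepsilon\downarrow0,\,T\uparrow\infty}\int_\varepsilon^T \frac{g(-t)}{t^{p+1}}\,dt$ (these limits exist and are finite under conditions (ii)–(iv)). For real $x$ and $s$: $x_+^s:=x^s$ if $x>0$ and $x_+^s:=0$ otherwise; $x_-^s:=(-x)_+^s$. Conventions: $0^0=0$; $0^s=\infty$ if $s<0$; $0\cdot\infty=\infty\cdot0=0$. For nonzero complex $z$, $\arg z\in(-\pi,\pi]$ and $z^s:=|z|^s e^{is\arg z}$; the bar denotes complex conjugation. The function $h$ in (i) serves only to introduce $r$ and $u$. Fractional derivatives: for $\psi\colon\mathbb{R}\to\mathbb{C}$ and real $s$, $\psi^{(s)}(t)$ is defined as follows (whenever the operations make sense). If $s\in\{0,1,2,\dots\}$, it is the usual derivative, $\psi^{(0)}=\psi$. If $s>0$ is not an integer, $k=\lfloor s\rfloor$, $\lambda=s-k$, then $\psi^{(s)}(t):=\frac1{\Gamma(-\lambda)}\int_0^\infty\frac{\psi^{(k)}(t-v)-\psi^{(k)}(t)}{v^{1+\lambda}}\,dv$. If $s\in(-1,0)$, then $\psi^{(s)}(t):=\frac1{\Gamma(-s)}\lim_{T\to\infty}\int_0^{T}\frac{\psi(t-v)}{v^{1+s}}\,dv$.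 If $s$ is a negative integer, $\psi^{(s)}(t):=\lim_{q\downarrow s}\psi^{(q)}(t)$. If $s<-1$ is not an integer, $\psi^{(s)}(t):=(\psi^{(\lceil s\rceil)})^{(s-\lceil s\rceil)}(t)$. If $f$ is the characteristic function of a random variable $X$ with $\mathsf{E}|X|^s<\infty$, then $f^{(s)}(t)$ exists for all real $t$.
   Formalization: When the largest q_j equals p, the integral from 0 to T need not exist in the Lebesgue sense under (i)-(v); in that case the left-hand integral is taken as the limit of the integral from ε to T as ε↓0, T↑∞, with the same identity. *)

theory Defs
  imports
    "HOL-Probability.Probability"
    "HOL-Library.Landau_Symbols"
begin

text \<open>
  Complex powers are the library's \<^term>\<open>z powr s\<close>: the principal branch with argument in
  \<open>(-pi, pi]\<close>, and \<^prop>\<open>(0::complex) powr s = 0\<close>, which agrees with the convention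
  \<open>0^0 = 0\<close>. The convention \<open>0^s = \<infinity>\<close> for \<open>s < 0\<close> matters only for absolute moments,
  where it is made explicit.
\<close>

definition abs_pow :: "real \<Rightarrow> real \<Rightarrow> ennreal" where
  "abs_pow x s = (if x = 0 then (if s < 0 then \<infinity> else 0) else ennreal (\<bar>x\<bar> powr s))"

definition abs_moment :: "'a measure \<Rightarrow> ('a \<Rightarrow> real) \<Rightarrow> real \<Rightarrow> ennreal" where
  "abs_moment M X s = (\<integral>\<^sup>+\<omega>. abs_pow (X \<omega>) s \<partial>M)"

definition pos_pow :: "real \<Rightarrow> real \<Rightarrow> real" where
  "pos_pow x s = (if x > 0 then x powr s else 0)"

definition neg_pow :: "real \<Rightarrow> real \<Rightarrow> real" where
  "neg_pow x s = pos_pow (- x) s"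


subsection \<open>Fractional derivatives\<close>

definition int_deriv :: "nat \<Rightarrow> (real \<Rightarrow> complex) \<Rightarrow> real \<Rightarrow> complex" where
  "int_deriv k = (\<lambda>\<phi> t. vector_derivative \<phi> (at t)) ^^ k"

text \<open>The derivative of order \<open>s\<close> for \<open>-1 < s < 0\<close>.\<close>

definition unit_integral :: "real \<Rightarrow> (real \<Rightarrow> complex) \<Rightarrow> real \<Rightarrow> complex" where
  "unit_integral s \<psi> t =
     1 / of_real (Gamma (- s)) *
       Lim at_top (\<lambda>T. LBINT v:{0<..<T}. \<psi> (t - v) / of_real (v powr (1 + s)))"

text \<open>
  The derivative of order \<open>-n\<close>. The derivative of order \<open>q\<close> with \<open>-(n + 1) < q < -n\<close> is the one of
  order \<open>q - \<lceil>q\<rceil> = q + n\<close> of the derivative of order \<open>\<lceil>q\<rceil> = -n\<close>, so the limit from the right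
  at \<open>-(n + 1)\<close> is a recursion on \<open>n\<close>; see \<open>frac_deriv_neg_Ints\<close> and \<open>frac_deriv_neg_frac\<close> below.
\<close>

primrec neg_int_deriv :: "nat \<Rightarrow> (real \<Rightarrow> complex) \<Rightarrow> real \<Rightarrow> complex" where
  "neg_int_deriv 0 \<psi> = \<psi>"
| "neg_int_deriv (Suc n) \<psi> =
     (\<lambda>t. Lim (at_right (- real (Suc n))) (\<lambda>q. unit_integral (q + real n) (neg_int_deriv n \<psi>) t))"

definition frac_deriv :: "real \<Rightarrow> (real \<Rightarrow> complex) \<Rightarrow> real \<Rightarrow> complex" where
  "frac_deriv s \<psi> t =
     (if s \<in> \<int> then
        (if s \<ge> 0 then int_deriv (nat \<lfloor>s\<rfloor>) \<psi> t else neg_int_deriv (nat (- \<lfloor>s\<rfloor>)) \<psi> t)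
      else if s > 0 then
        (let k = nat \<lfloor>s\<rfloor>; l = s - real k in
           1 / of_real (Gamma (- l)) *
             (LBINT v:{0<..}. (int_deriv k \<psi> (t - v) - int_deriv k \<psi> t) / of_real (v powr (1 + l))))
      else unit_integral (s - of_int \<lceil>s\<rceil>) (neg_int_deriv (nat (- \<lceil>s\<rceil>)) \<psi>) t)"

lemma frac_deriv_unit:
  assumes "-1 < s" "s < 0"
  shows "frac_deriv s \<psi> t = unit_integral s \<psi> t"
proof -
  have "s \<notin> \<int>"
    using assms by (auto elim!: Ints_cases)
  moreover have "\<lceil>s\<rceil> = 0"
    using assms by (simp add: ceiling_eq_iff)
  ultimately show ?thesis
    using assms by (simp add: frac_deriv_def)
qed

lemma frac_deriv_neg_frac:
  assumes "s < -1" "s \<notin> \<int>"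
  shows "frac_deriv s \<psi> t = frac_deriv (s - of_int \<lceil>s\<rceil>) (frac_deriv (of_int \<lceil>s\<rceil>) \<psi>) t"
proof -
  have c: "\<lceil>s\<rceil> < 0"
    using assms by (simp add: ceiling_less_iff)
  have "frac_deriv (of_int \<lceil>s\<rceil>) \<psi> = neg_int_deriv (nat (- \<lceil>s\<rceil>)) \<psi>"
    using c by (auto simp: frac_deriv_def fun_eq_iff)
  moreover have "s \<noteq> of_int \<lceil>s\<rceil>"
    using assms(2) by (metis Ints_of_int)
  then have "s - of_int \<lceil>s\<rceil> < 0" "-1 < s - of_int \<lceil>s\<rceil>"
    using ceiling_correct[of s] by linarith+
  ultimately show ?thesis
    using assms by (simp add: frac_deriv_unit) (simp add: frac_deriv_def)
qed

lemma frac_deriv_neg_Ints: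
  assumes "s \<in> \<int>" "s < 0"
  shows "frac_deriv s \<psi> t = Lim (at_right s) (\<lambda>q. frac_deriv q \<psi> t)"
proof -
  obtain n where n: "s = - real (Suc n)"
  proof -
    obtain m where m: "s = of_int m" using assms by (auto elim: Ints_cases)
    then have "s = - real (Suc (nat (- m - 1)))" using assms by auto
    then show ?thesis using that by blast
  qed
  have e: "\<forall>\<^sub>F q in at_right s.
      unit_integral (q + real n) (neg_int_deriv n \<psi>) t = frac_deriv q \<psi> t"
  proof -
    have "\<forall>\<^sub>F q in at_right s. q \<in> {s<..<s + 1}"
      by (rule eventually_at_right_real) simp
    then show ?thesis
    proof eventually_elim
      case (elim q)
      then have c: "\<lceil>q\<rceil> = - int n" using n by (simp add: ceiling_eq_iff)
      have "q \<notin> \<int>"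
      proof
        assume "q \<in> \<int>"
        then have "q = of_int \<lceil>q\<rceil>" by (auto elim: Ints_cases)
        then show False using c elim n by simp
      qed
      then show ?case using elim n c by (simp add: frac_deriv_def)
    qed
  qed
  have "nat (- \<lfloor>s\<rfloor>) = Suc n"
    using n by (metis add.inverse_inverse floor_of_int nat_int of_int_minus of_int_of_nat_eq)
  then have "frac_deriv s \<psi> t
      = Lim (at_right s) (\<lambda>q. unit_integral (q + real n) (neg_int_deriv n \<psi>) t)"
    using assms n by (simp add: frac_deriv_def)
  also have "\<dots> = Lim (at_right s) (\<lambda>q. frac_deriv q \<psi> t)"
    unfolding Topological_Spaces.Lim_def by (simp only: tendsto_cong[OF e])
  finally show ?thesis .
qed


subsection \<open>Integrals over the half-line\<close>

text \<open>
  The integral from 0 to \<open>\<infinity>-\<close> of the theorem is the limit of the Lebesgue integrals over \<open>(0, T)\<close>,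
  \<open>has_integral_inf_minus\<close>. When the largest exponent \<open>q j\<close> equals \<open>p\<close>, the integrand can fail to be
  Lebesgue integrable at 0: take \<open>p = 1\<close>, \<open>r = u = 0\<close>, \<open>g t = t (exp (i t) - exp (2 i t))\<close>, and \<open>X\<close>
  with very sparse atoms \<open>x_n = 2^(4^n)\<close> of mass \<open>2^(-n) / x_n\<close> and the rest of its mass at 0.
  The integral then converges only conditionally at 0, and is taken improper at both ends, as in
  the definition of \<open>c_plus\<close>:
  \<open>has_improper_integral\<close>. Both notions agree whenever the first one applies.
\<close>

abbreviation zero_inf :: "(real \<times> real) filter" where
  "zero_inf \<equiv> at_right 0 \<times>\<^sub>F at_top"

definition has_improper_integral :: "(real \<Rightarrow> complex) \<Rightarrow> complex \<Rightarrow> bool" where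
  "has_improper_integral F L \<longleftrightarrow>
     (\<forall>\<epsilon> T. 0 < \<epsilon> \<and> \<epsilon> < T \<longrightarrow> set_integrable lborel {\<epsilon>..T} F) \<and>
     ((\<lambda>(\<epsilon>, T). LBINT t:{\<epsilon>..T}. F t) \<longlongrightarrow> L) zero_inf"

text \<open>Improper at infinity only: Lebesgue integrable on every \<open>(0, T)\<close>.\<close>

definition has_integral_inf_minus :: "(real \<Rightarrow> complex) \<Rightarrow> complex \<Rightarrow> bool" where
  "has_integral_inf_minus F L \<longleftrightarrow>
     (\<forall>T>0. set_integrable lborel {0<..<T} F) \<and>
     ((\<lambda>T. LBINT t:{0<..<T}. F t) \<longlongrightarrow> L) at_top"

definition c_plus :: "real \<Rightarrow> (real \<Rightarrow> complex) \<Rightarrow> complex" where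
  "c_plus p g = Lim zero_inf (\<lambda>(\<epsilon>, T). LBINT t:{\<epsilon>..T}. g t / of_real (t powr (p + 1)))"

definition c_minus :: "real \<Rightarrow> (real \<Rightarrow> complex) \<Rightarrow> complex" where
  "c_minus p g = Lim zero_inf (\<lambda>(\<epsilon>, T). LBINT t:{\<epsilon>..T}. g (- t) / of_real (t powr (p + 1)))"


definition lhs_integrand ::
  "'j set \<Rightarrow> ('j \<Rightarrow> complex) \<Rightarrow> ('j \<Rightarrow> real) \<Rightarrow> ('j \<Rightarrow> real) \<Rightarrow> real \<Rightarrow> real \<Rightarrow> real \<Rightarrow>
     (real \<Rightarrow> complex) \<Rightarrow> real \<Rightarrow> complex" where
  "lhs_integrand J a q v p r u f t =
     (\<Sum>j\<in>J. a j * (- \<i> * of_real t) powr of_real (q j) * frac_deriv (r + q j) f (u + v j * t))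
       / of_real (t powr (p + 1))"

end

theory Submission
  imports Defs
begin

text \<open>
  Every fractional derivative of the characteristic function is a moment,
  \<open>f^(s)(t) = E (iX)^s exp(itX)\<close>. This rests on the value
  \<open>Gamma(a) (ix)^(-a)\<close> of the conditionally convergent integral of \<open>v^(a-1) exp(-ivx)\<close> over
  \<open>(0, \<infinity>)\<close>, \<open>0 < a < 1\<close>. For \<open>z = e + iy\<close> with \<open>e > 0\<close>, the function
  \<open>z^a\<close> times the integral of \<open>v^(a-1) exp(-zv)\<close> has zero derivative in \<open>y\<close>, hence equals
  \<open>Gamma(a)\<close>; the truncated integrals miss their limit by at most \<open>2 T^(a-1) / |z|\<close>
  uniformly in \<open>e\<close>, so \<open>e\<close> may tend to 0.

  Consequently the integrand of the theorem is \<open>t^(-p-1) E W(X) g(tX)\<close> with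
  \<open>|W(x)| = |x|^r\<close>. Substituting \<open>s = t|x|\<close>, its integral over \<open>[e, T]\<close> is \<open>R(T) - R(e)\<close>, where
  \<open>R(B)\<close> is the expectation of \<open>W(X) |X|^p K(B|X|)\<close> and \<open>K(B)\<close> is the integral of \<open>g(s) / s^(p+1)\<close>
  or \<open>g(-s) / s^(p+1)\<close> over \<open>(0, B)\<close>, according to the sign of \<open>X\<close>. The function \<open>K\<close> is bounded,
  vanishes at 0 and converges at infinity, so dominated convergence applies.

  For \<open>s = 0\<close> the convention \<open>0^0 = 0\<close> makes the moment formula miss the atom of \<open>X\<close> at 0. It
  contributes nothing: then \<open>-r\<close> is the smallest exponent \<open>q j\<close>, and the coefficients
  belonging to it add up to 0 because \<open>g(t) = o(t^(-r))\<close>.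
\<close>


subsection \<open>Oscillatory integrals and the Gamma function\<close>

text \<open>Fubini's theorem cannot be applied on the whole half-line. With a nonzero frequency,
  \<open>q j\<close> may lie in \<open>[p, p + 1)\<close>, so \<open>g(s) / s^(p+1)\<close> need not
  be absolutely integrable at infinity; at 0 its integrability rests on cancellation between the
  terms. The interchange with the expectation is therefore made only over compact
  \<open>[e, T]\<close>, where the powers of \<open>t\<close> are bounded and the moments of order
  \<open>r + q j\<close> suffice. Both limits are then taken under the expectation, with the single
  majorant \<open>D |x|^(r+p)\<close>. Lebesgue integrability on \<open>(0, T)\<close> is a separate
  matter: the integral of \<open>|g(s)| / s^(p+1)\<close> up to \<open>B\<close> grows at most like
  \<open>1 + B^(Q-p)\<close> when the largest exponent \<open>Q\<close> exceeds \<open>p\<close>,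
  and stays bounded when all exponents are below \<open>p\<close>. At \<open>Q = p\<close> a
  logarithm can appear, which the assumed moments do not control. Derivatives of negative order
  follow the same scheme, with a majorant \<open>|x|^(-a)\<close> for the truncated Gamma integrals
  that is uniform in \<open>T\<close>. Positive fractional orders converge absolutely, and one
  integration by parts reduces them to the same Gamma integrals.\<close>

lemma set_integral_powr_from_0:
  fixes b s :: real
  assumes "s > -1" "b > 0"
  shows "set_integrable lborel {0<..<b} (\<lambda>v. v powr s)"
    and "(LBINT v:{0<..<b}. v powr s) = b powr (s + 1) / (s + 1)"
proof -
  have e: "einterval 0 (ereal b) = {0<..<b}"
    using assms by (auto simp: einterval_def)
  have lim0: "((\<lambda>x. x powr (s+1) / (s+1)) \<longlongrightarrow> 0) (at_right 0)"
    using assms by real_asymp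
  have D: "DERIV (\<lambda>x. x powr (s+1) / (s+1)) x :> x powr s" if "x > 0" for x
    using that assms by (auto intro!: derivative_eq_intros simp: powr_diff)
  note R = interval_integral_FTC_nonneg[of 0 b "\<lambda>x. x powr (s+1) / (s+1)" "\<lambda>x. x powr s" 0 "b powr (s+1) / (s+1)"]
  have L: "((\<lambda>x. x powr (s+1) / (s+1)) \<longlongrightarrow> b powr (s+1) / (s+1)) (at_left b)"
    using assms by (intro tendsto_intros) auto
  have *: "set_integrable lborel (einterval 0 (ereal b)) (\<lambda>x. x powr s)"
    "(LBINT x=0..b. x powr s) = b powr (s+1) / (s+1) - 0"
    using assms D lim0 L
    by (intro R; (auto intro!: continuous_intros simp: ereal_tendsto_simps zero_ereal_def)?)+
  show "set_integrable lborel {0<..<b} (\<lambda>v. v powr s)" using * e by simp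
  show "(LBINT v:{0<..<b}. v powr s) = b powr (s + 1) / (s + 1)"
    using *(2) e assms by (simp add: interval_lebesgue_integral_def)
qed

lemma set_integrable_powr_to_infinity:
  fixes b s :: real
  assumes "s < -1" "b > 0"
  shows "set_integrable lborel {b<..} (\<lambda>v. v powr s)"
proof -
  have e: "einterval (ereal b) \<infinity> = {b<..}"
    by (auto simp: einterval_def)
  have lim0: "((\<lambda>x. x powr (s+1) / (s+1)) \<longlongrightarrow> 0) at_top"
    using assms by real_asymp
  have D: "DERIV (\<lambda>x. x powr (s+1) / (s+1)) x :> x powr s" if "x > 0" for x
    using that assms by (auto intro!: derivative_eq_intros simp: powr_diff)
  note R = interval_integral_FTC_nonneg(1)[of b \<infinity> "\<lambda>x. x powr (s+1) / (s+1)" "\<lambda>x. x powr s" "b powr (s+1) / (s+1)" 0]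
  have L: "((\<lambda>x. x powr (s+1) / (s+1)) \<longlongrightarrow> b powr (s+1) / (s+1)) (at_right b)"
    using assms by (intro tendsto_intros) auto
  have "set_integrable lborel (einterval (ereal b) \<infinity>) (\<lambda>x. x powr s)"
    using assms D lim0 L
    by (intro R) (auto intro!: continuous_intros simp: ereal_tendsto_simps)
  then show ?thesis using e by simp
qed

text \<open>The homogeneity of the power makes the substitution \<open>t\<close> to
  \<open>c * t\<close> produce only a scalar factor. The equation also covers the non-integrable
  case, where both integrals default to 0.\<close>

lemma set_integral_powr_scale:
  fixes f :: "real \<Rightarrow> 'a::{banach, second_countable_topology}"
  assumes "c > 0"
  shows "set_integrable lborel {0<..} (\<lambda>t. t powr s *\<^sub>R f (c * t)) \<longleftrightarrow>
           set_integrable lborel {0<..} (\<lambda>t. t powr s *\<^sub>R f t)"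
    and "(LBINT t:{0<..}. t powr s *\<^sub>R f (c * t)) =
           c powr (- s - 1) *\<^sub>R (LBINT t:{0<..}. t powr s *\<^sub>R f t)"
proof -
  define F where "F = (\<lambda>t. indicator {0<..} t *\<^sub>R t powr s *\<^sub>R f t)"
  \<comment> \<open>The summand \<open>0\<close> puts the argument into the affine form of the
    substitution rule for \<open>lborel\<close>.\<close>
  have F: "F (0 + c * t) = c powr s *\<^sub>R (indicator {0<..} t *\<^sub>R t powr s *\<^sub>R f (c * t))" for t
    using assms by (auto simp: F_def indicator_def powr_mult zero_less_mult_iff)
  have cs: "c powr s \<noteq> 0" using assms by simp
  have "integrable lborel F \<longleftrightarrow> integrable lborel (\<lambda>t. F (0 + c * t))"
    using assms by (intro lborel_integrable_real_affine_iff[symmetric]) simp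
  also have "\<dots> \<longleftrightarrow> integrable lborel (\<lambda>t. indicator {0<..} t *\<^sub>R t powr s *\<^sub>R f (c * t))"
  proof
    assume "integrable lborel (\<lambda>t. F (0 + c * t))"
    then have "integrable lborel (\<lambda>t. inverse (c powr s) *\<^sub>R F (0 + c * t))"
      by (rule integrable_scaleR_right)
    then show "integrable lborel (\<lambda>t. indicator {0<..} t *\<^sub>R t powr s *\<^sub>R f (c * t))"
      unfolding F using cs by (simp add: mult.assoc[symmetric])
  next
    assume "integrable lborel (\<lambda>t. indicator {0<..} t *\<^sub>R t powr s *\<^sub>R f (c * t))"
    then show "integrable lborel (\<lambda>t. F (0 + c * t))"
      unfolding F by (rule integrable_scaleR_right)
  qed
  finally show "set_integrable lborel {0<..} (\<lambda>t. t powr s *\<^sub>R f (c * t)) \<longleftrightarrow>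
           set_integrable lborel {0<..} (\<lambda>t. t powr s *\<^sub>R f t)"
    by (simp add: set_integrable_def F_def)
  have "integral\<^sup>L lborel F = \<bar>c\<bar> *\<^sub>R (\<integral>t. F (0 + c * t) \<partial>lborel)"
    using assms by (intro lborel_integral_real_affine) simp
  also have "\<dots> = (c * c powr s) *\<^sub>R (LBINT t:{0<..}. t powr s *\<^sub>R f (c * t))"
    unfolding F integral_scaleR_right using assms by (simp add: set_lebesgue_integral_def)
  finally have "integral\<^sup>L lborel F = \<dots>" .
  moreover have "c powr (- s - 1) * (c * c powr s) = 1"
    using assms by (simp add: powr_diff powr_minus field_simps)
  ultimately show "(LBINT t:{0<..}. t powr s *\<^sub>R f (c * t)) =
           c powr (- s - 1) *\<^sub>R (LBINT t:{0<..}. t powr s *\<^sub>R f t)"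
    by (simp add: set_lebesgue_integral_def F_def)
qed

section \<open>Oscillation estimates and differentiation of Fourier integrals\<close>

lemma has_vector_derivative_exp_linear:
  fixes z :: complex
  shows "((\<lambda>v. exp (z * of_real v)) has_vector_derivative z * exp (z * of_real v)) (at v within S)"
  by (rule has_vector_derivative_real_field) (auto intro!: derivative_eq_intros)

text \<open>Integration by parts gains the factor \<open>1 / z\<close>; what remains is controlled
  by the total variation of \<open>v powr s\<close>. Since only \<open>Re z \<ge> 0\<close> enters,
  the bound stays valid up to the imaginary axis, and it serves both the Gamma integrals and the
  tails of the kernel.\<close>

lemma norm_oscillatory_integral_le:
  fixes z :: complex and s S T :: real
  assumes "Re z \<ge> 0" "z \<noteq> 0" "s < 0" "0 < S" "S \<le> T"
  shows "norm (LBINT v:{S..T}. v powr s *\<^sub>R exp (- z * of_real v)) \<le> 2 * S powr s / norm z"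
proof -
  define P where "P = (\<lambda>v::real. v powr s *\<^sub>R exp (- z * of_real v))"
  define B where "B = (\<lambda>v::real. (s * v powr (s - 1)) *\<^sub>R exp (- z * of_real v))"
  have PD: "(P has_vector_derivative - z * P v + B v) (at v within {S..T})" if "S \<le> v" "v \<le> T" for v
  proof -
    have "((\<lambda>v. v powr s) has_real_derivative s * v powr (s - 1)) (at v within {S..T})"
      using that assms by (auto intro!: derivative_eq_intros simp: powr_diff)
    from has_vector_derivative_scaleR[OF this has_vector_derivative_exp_linear[of "- z"]]
    show ?thesis by (simp add: P_def B_def algebra_simps)
  qed
  have contP: "continuous_on {S..T} P" and contB: "continuous_on {S..T} B"
    unfolding P_def B_def using assms by (auto intro!: continuous_intros)
  have iP: "set_integrable lborel {S..T} P" and iB: "set_integrable lborel {S..T} B"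
    using contP contB by (auto intro: borel_integrable_atLeastAtMost')
  have "(LBINT v:{S..T}. - z * P v + B v) = P T - P S"
    unfolding set_lebesgue_integral_def using assms PD contP contB
    by (intro integral_FTC_atLeastAtMost) (auto intro!: continuous_intros)
  then have eq: "z * (LBINT v:{S..T}. P v) = (LBINT v:{S..T}. B v) - (P T - P S)"
    using iP iB by (simp add: set_integral_add) (simp add: algebra_simps)
  have nexp: "norm (exp (- z * of_real v)) \<le> 1" if "v \<ge> 0" for v :: real
    using that assms by simp
  have nP: "norm (P v) \<le> v powr s" if "v \<ge> 0" for v
    using mult_left_mono[OF nexp[OF that], of "v powr s"] by (simp add: P_def)
  have nB: "norm (B v) \<le> - s * v powr (s - 1)" if "v \<ge> 0" for v
    using mult_left_mono[OF nexp[OF that], of "- s * v powr (s - 1)"] assms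
    by (simp add: B_def abs_mult mult_nonpos_nonneg)
  have cont': "continuous_on {S..T} (\<lambda>v. - s * v powr (s - 1))"
    using assms by (auto intro!: continuous_intros)
  have "norm (LBINT v:{S..T}. B v) \<le> (LBINT v:{S..T}. norm (B v))"
    using iB by (rule set_integral_norm_bound)
  also have "\<dots> \<le> (LBINT v:{S..T}. - s * v powr (s - 1))"
    using nB assms iB borel_integrable_atLeastAtMost'[OF cont']
    by (intro set_integral_mono set_integrable_norm) auto
  also have "\<dots> = - (T powr s) - - (S powr s)"
    unfolding set_lebesgue_integral_def
  proof (intro integral_FTC_atLeastAtMost assms cont')
    fix v assume "S \<le> v" "v \<le> T"
    then show "((\<lambda>v. - (v powr s)) has_vector_derivative - s * v powr (s - 1)) (at v within {S..T})"
      using assms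
      by (auto simp: has_real_derivative_iff_has_vector_derivative[symmetric] powr_diff
          intro!: derivative_eq_intros)
  qed
  \<comment> \<open>The negative \<open>T powr s\<close> cancels against the boundary value at
    \<open>T\<close>, so the total is twice \<open>S powr s\<close>.\<close>
  finally have "norm (LBINT v:{S..T}. B v) \<le> S powr s - T powr s" by simp
  moreover have "norm (P T) \<le> T powr s" "norm (P S) \<le> S powr s"
    using nP assms by auto
  ultimately have "norm ((LBINT v:{S..T}. B v) - (P T - P S)) \<le> 2 * S powr s"
    using norm_triangle_ineq4[of "LBINT v:{S..T}. B v" "P T - P S"] norm_triangle_ineq4[of "P T" "P S"]
    by linarith
  then show ?thesis
    using assms unfolding eq[symmetric] by (simp add: norm_mult P_def field_simps)
qed

lemma norm_iexp_diff_le: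
  "norm (iexp x - 1) \<le> \<bar>x\<bar>" "norm (iexp x - 1) \<le> 2"
proof -
  show "norm (iexp x - 1) \<le> \<bar>x\<bar>"
    using iexp_approx1[of x 0] by simp
  show "norm (iexp x - 1) \<le> 2"
    using norm_triangle_ineq4[of "iexp x" 1] by simp
qed

lemma has_vector_derivative_at_iff:
  fixes f :: "real \<Rightarrow> 'a::real_normed_vector"
  shows "(f has_vector_derivative D) (at x) \<longleftrightarrow> ((\<lambda>h. (f (x + h) - f x) /\<^sub>R h) \<longlongrightarrow> D) (at 0)"
proof -
  have eq: "norm (f (x + h) - f x - h *\<^sub>R D) / norm h = norm ((f (x + h) - f x) /\<^sub>R h - D)"
    if "h \<noteq> 0" for h
  proof -
    have "f (x + h) - f x - h *\<^sub>R D = h *\<^sub>R ((f (x + h) - f x) /\<^sub>R h - D)"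
      using that by (simp add: scaleR_diff_right)
    then show ?thesis using that by (metis norm_scaleR nonzero_mult_div_cancel_left norm_eq_zero real_norm_def)
  qed
  have "(f has_vector_derivative D) (at x) \<longleftrightarrow>
      ((\<lambda>h. norm (f (x + h) - f x - h *\<^sub>R D) / norm h) \<longlongrightarrow> 0) (at 0)"
    by (simp add: has_vector_derivative_def has_derivative_at bounded_linear_scaleR_left)
  also have "\<dots> \<longleftrightarrow> ((\<lambda>h. norm ((f (x + h) - f x) /\<^sub>R h - D)) \<longlongrightarrow> 0) (at 0)"
    by (intro filterlim_cong refl) (intro eventually_at_filter[THEN iffD2] always_eventually, use eq in simp)
  finally show ?thesis
    by (simp add: tendsto_norm_zero_iff LIM_zero_iff)
qed

text \<open>The difference quotients of \<open>iexp (h * x)\<close> are bounded by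
  \<open>\<bar>x\<bar>\<close>, so \<open>of_real x * w x\<close> is an integrable majorant. This is
  used with Lebesgue measure for the Gamma integral and with the law of \<open>X\<close> for
  derivatives of integer order.\<close>

lemma has_vector_derivative_fourier:
  fixes w :: "real \<Rightarrow> complex" and N :: "real measure"
  assumes sets: "sets N = sets borel"
    and w: "integrable N w" and xw: "integrable N (\<lambda>x. of_real x * w x)"
  shows "((\<lambda>t. \<integral>x. w x * iexp (t * x) \<partial>N) has_vector_derivative
           (\<integral>x. \<i> * of_real x * w x * iexp (t * x) \<partial>N)) (at t)"
proof -
  note [measurable_cong] = sets
  have [measurable]: "w \<in> borel_measurable N" using w by auto
  have [measurable]: "w \<in> borel_measurable borel" using w sets by (metis borel_measurable_integrable measurable_cong_sets)
  have int: "integrable N (\<lambda>x. w x * iexp (t * x))" for t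
    by (rule Bochner_Integration.integrable_bound[OF w]) (auto simp: norm_mult)
  have "((\<lambda>h. \<integral>x. inverse h *\<^sub>R (w x * iexp (t * x) * (iexp (h * x) - 1)) \<partial>N) \<longlongrightarrow>
         (\<integral>x. \<i> * of_real x * w x * iexp (t * x) \<partial>N)) (at 0)"
    unfolding tendsto_at_iff_sequentially comp_def
  proof (intro allI impI)
    fix H :: "nat \<Rightarrow> real"
    assume H: "\<forall>i. H i \<in> UNIV - {0}" "H \<longlonglongrightarrow> 0"
    show "(\<lambda>i. \<integral>x. inverse (H i) *\<^sub>R (w x * iexp (t * x) * (iexp (H i * x) - 1)) \<partial>N) \<longlonglongrightarrow>
          (\<integral>x. \<i> * of_real x * w x * iexp (t * x) \<partial>N)"
    proof (rule integral_dominated_convergence[where w="\<lambda>x. norm (of_real x * w x)"])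
      show "AE x in N. (\<lambda>i. inverse (H i) *\<^sub>R (w x * iexp (t * x) * (iexp (H i * x) - 1)))
              \<longlonglongrightarrow> \<i> * of_real x * w x * iexp (t * x)"
      proof (intro AE_I2)
        fix x :: real
        have "((\<lambda>h. exp (\<i> * of_real x * of_real h)) has_vector_derivative \<i> * of_real x) (at 0)"
          using has_vector_derivative_exp_linear[of "\<i> * of_real x" 0 UNIV] by simp
        then have "((\<lambda>h. (exp (\<i> * of_real x * of_real h) - 1) /\<^sub>R h) \<longlongrightarrow> \<i> * of_real x) (at 0)"
          unfolding has_vector_derivative_at_iff by simp
        then have "(\<lambda>i. (exp (\<i> * of_real x * of_real (H i)) - 1) /\<^sub>R H i) \<longlonglongrightarrow> \<i> * of_real x"
          unfolding tendsto_at_iff_sequentially comp_def using H by auto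
        from tendsto_mult[OF tendsto_const[of "w x * iexp (t * x)"] this]
        show "(\<lambda>i. inverse (H i) *\<^sub>R (w x * iexp (t * x) * (iexp (H i * x) - 1)))
              \<longlonglongrightarrow> \<i> * of_real x * w x * iexp (t * x)"
          by (simp add: ac_simps)
      qed
      fix i
      have h: "H i \<noteq> 0" using H by auto
      show "AE x in N. norm (inverse (H i) *\<^sub>R (w x * iexp (t * x) * (iexp (H i * x) - 1)))
              \<le> norm (of_real x * w x)"
      proof (intro AE_I2)
        fix x :: real
        have "norm (iexp (H i * x) - 1) \<le> \<bar>H i\<bar> * \<bar>x\<bar>"
          using norm_iexp_diff_le(1)[of "H i * x"] by (simp add: abs_mult)
        then have "norm (iexp (H i * x) - 1) / \<bar>H i\<bar> \<le> \<bar>x\<bar>" using h by (simp add: field_simps)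
        from mult_left_mono[OF this, of "norm (w x)"]
        show "norm (inverse (H i) *\<^sub>R (w x * iexp (t * x) * (iexp (H i * x) - 1))) \<le> norm (of_real x * w x)"
          by (simp only: norm_scaleR norm_mult norm_exp_i_times norm_of_real abs_inverse) (simp add: field_simps)
      qed
    qed (use xw in auto)
  qed
  moreover have "(\<integral>x. inverse h *\<^sub>R (w x * iexp (t * x) * (iexp (h * x) - 1)) \<partial>N) =
      ((\<integral>x. w x * iexp ((t + h) * x) \<partial>N) - (\<integral>x. w x * iexp (t * x) \<partial>N)) /\<^sub>R h" for h
    unfolding Bochner_Integration.integral_diff[OF int int, symmetric] integral_scaleR_right[symmetric]
    by (intro Bochner_Integration.integral_cong) (auto simp: algebra_simps exp_add)
  ultimately show ?thesis
    by (simp only: has_vector_derivative_at_iff)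
qed

section \<open>The Gamma integral with a complex scale\<close>

lemma Gamma_integral_scaled:
  fixes a e :: real
  assumes "a > 0" "e > 0"
  shows "set_integrable lborel {0<..} (\<lambda>v. v powr (a - 1) *\<^sub>R exp (- (e * v)))"
    and "(LBINT v:{0<..}. v powr (a - 1) *\<^sub>R exp (- (e * v))) = Gamma a * e powr (- a)"
proof -
  have "has_bochner_integral lborel (\<lambda>v. indicator {0<..} v *\<^sub>R (v powr (a - 1) *\<^sub>R exp (- v))) (Gamma a)"
  proof (rule has_bochner_integral_nn_integral)
    have "(\<integral>\<^sup>+ v. ennreal (indicator {0<..} v *\<^sub>R (v powr (a - 1) *\<^sub>R exp (- v))) \<partial>lborel)
        = (\<integral>\<^sup>+ v. ennreal (indicator {0..} v * v powr (a - 1) / exp v) \<partial>lborel)"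
      by (intro nn_integral_cong) (auto simp: indicator_def exp_minus field_simps)
    then show "(\<integral>\<^sup>+ v. ennreal (indicator {0<..} v *\<^sub>R (v powr (a - 1) *\<^sub>R exp (- v))) \<partial>lborel) = Gamma a"
      using Gamma_conv_nn_integral_real[OF assms(1)] by simp
  qed (use assms in \<open>auto simp: less_imp_le\<close>)
  then have "set_integrable lborel {0<..} (\<lambda>v. v powr (a - 1) *\<^sub>R exp (- v))"
    "(LBINT v:{0<..}. v powr (a - 1) *\<^sub>R exp (- v)) = Gamma a"
    by (auto simp: has_bochner_integral_iff set_integrable_def set_lebesgue_integral_def)
  then show "set_integrable lborel {0<..} (\<lambda>v. v powr (a - 1) *\<^sub>R exp (- (e * v)))"
    "(LBINT v:{0<..}. v powr (a - 1) *\<^sub>R exp (- (e * v))) = Gamma a * e powr (- a)"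
    using set_integral_powr_scale[OF assms(2), of "a - 1" "\<lambda>v. exp (- v)"] by (simp_all add: mult.commute)
qed

lemma set_integrable_powr_exp:
  fixes z :: complex and a :: real
  assumes "a > 0" "Re z > 0"
  shows "set_integrable lborel {0<..} (\<lambda>v. v powr (a - 1) *\<^sub>R exp (- z * of_real v))"
proof -
  have "norm (v powr (a - 1) *\<^sub>R exp (- z * of_real v)) \<le> norm (v powr (a - 1) *\<^sub>R exp (- (Re z * v)))"
    for v :: real by (simp add: mult.commute)
  then show ?thesis
    by (intro set_integrable_bound[OF Gamma_integral_scaled(1)[OF assms]])
       (auto simp: set_borel_measurable_def)
qed

text \<open>The derivative of \<open>v powr a *\<^sub>R exp (- z * of_real v)\<close> integrates to
  0, because this function vanishes at both ends of the half-line.\<close>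

lemma complex_Gamma_integral_recurrence:
  fixes z :: complex and a :: real
  assumes "a > 0" "Re z > 0"
  shows "z * (LBINT v:{0<..}. v powr a *\<^sub>R exp (- z * of_real v)) =
         of_real a * (LBINT v:{0<..}. v powr (a - 1) *\<^sub>R exp (- z * of_real v))"
proof -
  have i0: "set_integrable lborel {0<..} (\<lambda>v. v powr (a - 1) *\<^sub>R exp (- z * of_real v))"
    and i1: "set_integrable lborel {0<..} (\<lambda>v. v powr a *\<^sub>R exp (- z * of_real v))"
    using set_integrable_powr_exp[of a z] set_integrable_powr_exp[of "a + 1" z] assms by auto
  define P where "P = (\<lambda>v::real. v powr a *\<^sub>R exp (- z * of_real v))"
  define p where "p = (\<lambda>v::real. of_real a * (v powr (a - 1) *\<^sub>R exp (- z * of_real v))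
                       - z * (v powr a *\<^sub>R exp (- z * of_real v)))"
  have e: "einterval 0 \<infinity> = {0<..}" by (auto simp: einterval_def)
  have PD: "(P has_vector_derivative p v) (at v)" if "v > 0" for v
  proof -
    have "((\<lambda>v. v powr a) has_real_derivative a * v powr (a - 1)) (at v)"
      using that assms by (auto intro!: derivative_eq_intros simp: powr_diff)
    from has_vector_derivative_scaleR[OF this has_vector_derivative_exp_linear[of "- z"]]
    show ?thesis by (simp add: P_def p_def algebra_simps scaleR_conv_of_real)
  qed
  have nP: "norm (P v) = v powr a * exp (- (Re z * v))" for v
    by (simp add: P_def)
  have "(LBINT v=0..\<infinity>. p v) = 0 - 0"
  proof (rule interval_integral_FTC_integrable[where F=P])
    show "set_integrable lborel (einterval 0 \<infinity>) p"
      unfolding e p_def using i0 i1 by (intro set_integral_diff set_integrable_mult_right)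
    show "isCont p x" if "0 < ereal x" "ereal x < \<infinity>" for x
      unfolding p_def using that by (auto intro!: continuous_intros)
    have "((\<lambda>v. v powr a * exp (- (Re z * v))) \<longlongrightarrow> 0) (at_right 0)"
      using assms by real_asymp
    then have "(P \<longlongrightarrow> 0) (at_right 0)"
      unfolding nP[symmetric] tendsto_norm_zero_iff .
    then show "((P \<circ> real_of_ereal) \<longlongrightarrow> 0) (at_right 0)"
      by (simp add: ereal_tendsto_simps zero_ereal_def)
    have "((\<lambda>v. v powr a * exp (- (Re z * v))) \<longlongrightarrow> 0) at_top"
      using assms by real_asymp
    then have "(P \<longlongrightarrow> 0) at_top"
      unfolding nP[symmetric] tendsto_norm_zero_iff .
    then show "((P \<circ> real_of_ereal) \<longlongrightarrow> 0) (at_left \<infinity>)"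
      by (simp add: ereal_tendsto_simps)
  qed (use PD in auto)
  then have "(LBINT v:{0<..}. p v) = 0"
    by (simp add: interval_lebesgue_integral_def e)
  moreover have "(LBINT v:{0<..}. p v) = of_real a * (LBINT v:{0<..}. v powr (a - 1) *\<^sub>R exp (- z * of_real v))
      - z * (LBINT v:{0<..}. v powr a *\<^sub>R exp (- z * of_real v))"
    unfolding p_def using i0 i1
    by (subst set_integral_diff(2))
       (intro set_integrable_mult_right impI, assumption, intro set_integrable_mult_right impI, assumption,
        simp only: set_integral_mult_right)
  ultimately show ?thesis by simp
qed

lemma complex_Gamma_integral_scaled:
  fixes z :: complex and a :: real
  assumes a: "a > 0" and z: "Re z > 0"
  shows "(LBINT v:{0<..}. v powr (a - 1) *\<^sub>R exp (- z * of_real v)) = of_real (Gamma a) * z powr (- of_real a)"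
proof -
  define e where "e = Re z"
  have e: "e > 0" using z by (simp add: e_def)
  \<comment> \<open>With the real part \<open>e\<close> absorbed into the weight, the integral
    becomes a Fourier transform in the imaginary part.\<close>
  define w where "w = (\<lambda>v::real. indicator {0<..} v *\<^sub>R (v powr (a - 1) *\<^sub>R exp (- of_real e * complex_of_real v)))"
  define F where "F = (\<lambda>y::real. \<integral>v. w v * iexp (y * v) \<partial>lborel)"
  \<comment> \<open>The minus sign comes from \<open>iexp (y * v)\<close> carrying the opposite sign
    to \<open>exp (- z * of_real v)\<close>; hence the given \<open>z\<close> is reached at
    \<open>y = - Im z\<close>.\<close>
  define Z where "Z = (\<lambda>y::real. of_real e - \<i> * of_real y)"
  have F: "F y = (LBINT v:{0<..}. v powr (a - 1) *\<^sub>R exp (- Z y * of_real v))" for y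
    unfolding F_def set_lebesgue_integral_def w_def Z_def
    by (intro Bochner_Integration.integral_cong) (auto simp: exp_add[symmetric] algebra_simps)
  have iw: "integrable lborel w"
    using set_integrable_powr_exp[OF a, of "of_real e"] e by (simp add: w_def set_integrable_def)
  have xw: "of_real v * w v =
      indicator {0<..} v *\<^sub>R (v powr ((a + 1) - 1) *\<^sub>R exp (- of_real e * complex_of_real v))" for v
    by (auto simp: w_def indicator_def powr_diff scaleR_conv_of_real)
  have ixw: "integrable lborel (\<lambda>v. of_real v * w v)"
    unfolding xw using set_integrable_powr_exp[of "a + 1" "of_real e"] e a by (simp add: set_integrable_def)
  have FD: "(F has_vector_derivative \<i> * (of_real a * F y / Z y)) (at y)" for y
  proof -
    have "(F has_vector_derivative (\<integral>v. \<i> * of_real v * w v * iexp (y * v) \<partial>lborel)) (at y)"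
      unfolding F_def by (rule has_vector_derivative_fourier[OF sets_lborel iw ixw])
    also have "(\<integral>v. \<i> * of_real v * w v * iexp (y * v) \<partial>lborel) =
        (\<integral>v. \<i> * (of_real v * w v * iexp (y * v)) \<partial>lborel)"
      by (simp add: mult.assoc)
    also have "\<dots> = \<i> * (\<integral>v. of_real v * w v * iexp (y * v) \<partial>lborel)"
      by simp
    also have "(\<integral>v. of_real v * w v * iexp (y * v) \<partial>lborel) =
       (LBINT v:{0<..}. v powr a *\<^sub>R exp (- Z y * of_real v))"
      unfolding xw set_lebesgue_integral_def Z_def
      by (intro Bochner_Integration.integral_cong) (auto simp: exp_add[symmetric] algebra_simps)
    also have "\<dots> = of_real a * F y / Z y"
    proof -
      have "Re (Z y) > 0" "Z y \<noteq> 0" using e by (auto simp: Z_def complex_eq_iff)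
      then show ?thesis
        using complex_Gamma_integral_recurrence[OF a, of "Z y"] unfolding F by (simp add: field_simps)
    qed
    finally show ?thesis .
  qed
  \<comment> \<open>\<open>Z y\<close> has real part \<open>e > 0\<close> and so avoids the branch
    cut. The logarithmic derivative of this power is \<open>- \<i> * of_real a / Z y\<close>,
    exactly opposite to that of \<open>F\<close>.\<close>
  have ZD: "((\<lambda>y. Z y powr of_real a) has_vector_derivative - \<i> * (of_real a * Z y powr (of_real a - 1))) (at y)" for y
    unfolding Z_def using e
    by (intro has_vector_derivative_real_field[of "\<lambda>y. (of_real e - \<i> * y) powr of_real a"])
       (auto intro!: derivative_eq_intros simp: complex_nonpos_Reals_iff)
  have "((\<lambda>y. Z y powr of_real a * F y) has_vector_derivative 0) (at y within UNIV)" for y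
  proof -
    have Z0: "Z y \<noteq> 0" using e by (auto simp: Z_def complex_eq_iff)
    from has_vector_derivative_mult[OF ZD FD, of y]
    show ?thesis using Z0 by (simp add: powr_diff field_simps)
  qed
  then obtain c where c: "\<And>y. Z y powr of_real a * F y = c"
    using has_vector_derivative_zero_constant[of UNIV "\<lambda>y. Z y powr of_real a * F y"] by auto
  have "F 0 = of_real (LBINT v:{0<..}. v powr (a - 1) *\<^sub>R exp (- (e * v)))"
    unfolding F set_lebesgue_integral_def integral_complex_of_real[symmetric]
    by (intro Bochner_Integration.integral_cong) (auto simp: Z_def scaleR_conv_of_real exp_of_real[symmetric])
  also have "\<dots> = of_real (Gamma a * e powr (- a))"
    using Gamma_integral_scaled[OF a e] by simp
  finally have "c = of_real (Gamma a)"
    using c[of 0] e by (auto simp: Z_def powr_of_real powr_minus field_simps)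
  moreover have "Z (- Im z) = z" by (auto simp: Z_def e_def complex_eq_iff)
  moreover have "z \<noteq> 0" using z by auto
  ultimately show ?thesis
    using c[of "- Im z"] F[of "- Im z"] by (simp add: powr_minus field_simps)
qed

section \<open>The passage to a purely imaginary scale\<close>

lemma norm_incomplete_Gamma_Fourier_le:
  fixes a x T :: real
  assumes a: "0 < a" "a < 1" and "x \<noteq> 0" "T > 0"
  shows "norm ((LBINT v:{0<..<T}. v powr (a - 1) *\<^sub>R iexp (- (v * x)))
            - of_real (Gamma a) * (\<i> * of_real x) powr (- of_real a)) \<le> 2 * T powr (a - 1) / \<bar>x\<bar>"
proof -
  define Z where "Z = (\<lambda>e::real. of_real e + \<i> * of_real x)"
  define A where "A = (\<lambda>e. LBINT v:{0<..<T}. v powr (a - 1) *\<^sub>R exp (- Z e * of_real v))"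
  have bnd: "norm (of_real (Gamma a) * Z e powr (- of_real a) - A e) \<le> 2 * T powr (a - 1) / \<bar>x\<bar>"
    if "e > 0" for e
  proof -
    let ?h = "\<lambda>v. v powr (a - 1) *\<^sub>R exp (- Z e * of_real v)"
    have Re: "Re (Z e) > 0" using that by (simp add: Z_def)
    have i: "set_integrable lborel {0<..} ?h" by (rule set_integrable_powr_exp[OF a(1) Re])
    have i1: "set_integrable lborel {0<..<T} ?h" and i2: "set_integrable lborel {T..} ?h"
      by (rule set_integrable_subset[OF i]; use \<open>T > 0\<close> in auto)+
    have "(LBINT v:{0<..<T} \<union> {T..}. ?h v) = A e + (LBINT v:{T..}. ?h v)"
      unfolding A_def by (rule set_integral_Un[OF _ i1 i2]) auto
    moreover have "{0<..<T} \<union> {T..} = {0<..}" using \<open>T > 0\<close> by auto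
    ultimately have eq: "of_real (Gamma a) * Z e powr (- of_real a) - A e = (LBINT v:{T..}. ?h v)"
      using complex_Gamma_integral_scaled[OF a(1) Re] by (simp add: algebra_simps)
    have xle: "\<bar>x\<bar> \<le> norm (Z e)" using abs_Im_le_cmod[of "Z e"] by (simp add: Z_def)
    \<comment> \<open>The oscillation estimate concerns compact intervals; its bound does not depend
      on the right end \<open>S\<close>, so it survives the limit to the full tail.\<close>
    have "((\<lambda>S. norm (LBINT v:{T..S}. ?h v)) \<longlongrightarrow> norm (LBINT v:{T..}. ?h v)) at_top"
      by (intro tendsto_norm tendsto_set_lebesgue_integral_at_top i2) auto
    moreover have "\<forall>\<^sub>F S in at_top. norm (LBINT v:{T..S}. ?h v) \<le> 2 * T powr (a - 1) / \<bar>x\<bar>"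
      using eventually_ge_at_top[of T]
    proof eventually_elim
      case (elim S)
      have "norm (LBINT v:{T..S}. ?h v) \<le> 2 * T powr (a - 1) / norm (Z e)"
        using assms elim Re by (intro norm_oscillatory_integral_le) auto
      also have "\<dots> \<le> 2 * T powr (a - 1) / \<bar>x\<bar>"
        using assms xle by (intro divide_left_mono mult_pos_pos) auto
      finally show ?case .
    qed
    ultimately show ?thesis
      unfolding eq by (rule tendsto_upperbound) simp
  qed
  \<comment> \<open>On the bounded interval the exponential has modulus at most 1, so
    \<open>v powr (a - 1)\<close> dominates for every \<open>e\<close>, also at
    \<open>e = 0\<close>.\<close>
  have A: "(A \<longlongrightarrow> A 0) (at_right 0)"
  proof (rule tendsto_at_right_sequentially[of _ 1])
    fix S :: "nat \<Rightarrow> real" assume S: "\<And>n. 0 < S n" "S \<longlonglongrightarrow> 0"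
    show "(\<lambda>n. A (S n)) \<longlonglongrightarrow> A 0"
      unfolding A_def set_lebesgue_integral_def
    proof (rule integral_dominated_convergence[where w="\<lambda>v. indicator {0<..<T} v *\<^sub>R v powr (a - 1)"])
      show "integrable lborel (\<lambda>v. indicat_real {0<..<T} v *\<^sub>R v powr (a - 1))"
        using set_integral_powr_from_0(1)[of "a - 1" T] assms by (simp add: set_integrable_def)
      show "AE v in lborel. (\<lambda>n. indicat_real {0<..<T} v *\<^sub>R v powr (a - 1) *\<^sub>R exp (- Z (S n) * of_real v))
          \<longlonglongrightarrow> indicat_real {0<..<T} v *\<^sub>R v powr (a - 1) *\<^sub>R exp (- Z 0 * of_real v)"
        unfolding Z_def by (intro AE_I2 tendsto_intros S)
      fix n
      show "AE v in lborel. norm (indicat_real {0<..<T} v *\<^sub>R v powr (a - 1) *\<^sub>R exp (- Z (S n) * of_real v))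
         \<le> indicat_real {0<..<T} v *\<^sub>R v powr (a - 1)"
        using S(1)[of n]
        by (intro AE_I2) (auto simp: indicator_def Z_def intro!: mult_left_le)
    qed auto
  qed simp
  \<comment> \<open>For \<open>x \<noteq> 0\<close> the limit point \<open>\<i> * of_real x\<close>
    lies off the branch cut, so the power is continuous there.\<close>
  have "((\<lambda>e. norm (of_real (Gamma a) * Z e powr (- of_real a) - A e)) \<longlongrightarrow>
          norm (of_real (Gamma a) * Z 0 powr (- of_real a) - A 0)) (at_right 0)"
    using \<open>x \<noteq> 0\<close> unfolding Z_def
    by (intro tendsto_norm tendsto_diff A tendsto_intros tendsto_powr_complex)
       (auto intro!: tendsto_eq_intros simp: complex_nonpos_Reals_iff)
  then have "norm (of_real (Gamma a) * Z 0 powr (- of_real a) - A 0) \<le> 2 * T powr (a - 1) / \<bar>x\<bar>"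
    by (rule tendsto_upperbound)
       (use bnd in \<open>auto simp: eventually_at_right_field intro!: exI[of _ 1]\<close>)
  moreover have "A 0 = (LBINT v:{0<..<T}. v powr (a - 1) *\<^sub>R iexp (- (v * x)))"
    by (simp add: A_def Z_def mult_ac)
  ultimately show ?thesis
    by (simp add: Z_def norm_minus_commute)
qed

lemma tendsto_incomplete_Gamma_Fourier:
  fixes a x :: real
  assumes "0 < a" "a < 1" "x \<noteq> 0"
  shows "((\<lambda>T. LBINT v:{0<..<T}. v powr (a - 1) *\<^sub>R iexp (- (v * x))) \<longlongrightarrow>
            of_real (Gamma a) * (\<i> * of_real x) powr (- of_real a)) at_top"
proof (rule Lim_null_comparison[THEN LIM_zero_cancel])
  show "\<forall>\<^sub>F T in at_top. norm ((LBINT v:{0<..<T}. v powr (a - 1) *\<^sub>R iexp (- (v * x)))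
            - of_real (Gamma a) * (\<i> * of_real x) powr (- of_real a)) \<le> 2 * T powr (a - 1) / \<bar>x\<bar>"
    using eventually_gt_at_top[of 0]
    by eventually_elim (rule norm_incomplete_Gamma_Fourier_le[OF assms])
  show "((\<lambda>T. 2 * T powr (a - 1) / \<bar>x\<bar>) \<longlongrightarrow> 0) at_top"
    using assms by real_asymp
qed

lemma norm_powr_ii_times:
  "norm ((\<i> * of_real x) powr of_real s) = \<bar>x\<bar> powr s"
  by (cases "x = 0") (auto simp: norm_powr_real_powr' norm_mult)

text \<open>The natural scale is \<open>T = 1 / \<bar>x\<bar>\<close>. Below it the integral of the
  modulus gives the summand \<open>1 / a\<close> of the constant; above it the limit contributes
  \<open>Gamma a\<close> and the error term \<open>2\<close>. Uniformity in \<open>T\<close> is what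
  dominated convergence requires for derivatives of negative order.\<close>

lemma incomplete_Gamma_Fourier_bounded:
  fixes a :: real
  assumes a: "0 < a" "a < 1"
  shows "\<exists>C\<ge>0. \<forall>x T. x \<noteq> 0 \<longrightarrow> T > 0 \<longrightarrow>
    norm (LBINT v:{0<..<T}. v powr (a - 1) *\<^sub>R iexp (- (v * x))) \<le> C * \<bar>x\<bar> powr (- a)"
proof (intro exI[of _ "1 / a + Gamma a + 2"] conjI allI impI)
  have G: "Gamma a > 0" using a by simp
  then show "1 / a + Gamma a + 2 \<ge> 0" using a by simp
  fix x T :: real
  assume x: "x \<noteq> 0" and T: "T > 0"
  let ?I = "LBINT v:{0<..<T}. v powr (a - 1) *\<^sub>R iexp (- (v * x))"
  show "norm ?I \<le> (1 / a + Gamma a + 2) * \<bar>x\<bar> powr (- a)"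
  proof (cases "T * \<bar>x\<bar> \<le> 1")
    case True
    have i: "set_integrable lborel {0<..<T} (\<lambda>v. v powr (a - 1))"
      and I: "(LBINT v:{0<..<T}. v powr (a - 1)) = T powr a / a"
      using set_integral_powr_from_0[of "a - 1" T] a T by auto
    have "norm ?I \<le> (LBINT v:{0<..<T}. v powr (a - 1))"
      unfolding set_lebesgue_integral_def
      by (rule Bochner_Integration.integral_norm_bound_integral[OF _ i[unfolded set_integrable_def]])
         (use i in \<open>auto simp: indicator_def set_integrable_def intro!: Bochner_Integration.integrable_bound[OF i[unfolded set_integrable_def]]\<close>)
    also have "\<dots> \<le> (1 / \<bar>x\<bar>) powr a / a"
      unfolding I using a T True x by (intro divide_right_mono powr_mono2) (auto simp: field_simps)
    also have "\<dots> = 1 / a * \<bar>x\<bar> powr (- a)"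
      by (simp add: powr_divide powr_minus field_simps)
    also have "\<dots> \<le> (1 / a + Gamma a + 2) * \<bar>x\<bar> powr (- a)"
      using G by (intro mult_right_mono) auto
    finally show ?thesis .
  next
    case False
    have "T powr (a - 1) \<le> (1 / \<bar>x\<bar>) powr (a - 1)"
      using a T False x by (intro powr_mono2') (auto simp: field_simps)
    also have "\<dots> = \<bar>x\<bar> powr (- a) * \<bar>x\<bar>"
      using x by (simp add: powr_divide powr_minus powr_diff field_simps)
    finally have "2 * T powr (a - 1) / \<bar>x\<bar> \<le> 2 * \<bar>x\<bar> powr (- a)"
      using x by (simp add: field_simps)
    moreover have "norm (of_real (Gamma a) * (\<i> * of_real x) powr (- of_real a)) = Gamma a * \<bar>x\<bar> powr (- a)"
      using norm_powr_ii_times[of x "- a"] G by (simp add: norm_mult)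
    ultimately have "norm ?I \<le> (Gamma a + 2) * \<bar>x\<bar> powr (- a)"
      using norm_incomplete_Gamma_Fourier_le[OF a x T]
        norm_triangle_ineq2[of ?I "of_real (Gamma a) * (\<i> * of_real x) powr (- of_real a)"]
      by (simp add: algebra_simps)
    also have "\<dots> \<le> (1 / a + Gamma a + 2) * \<bar>x\<bar> powr (- a)"
      using a by (intro mult_right_mono) auto
    finally show ?thesis .
  qed
qed

section \<open>The regularised integral for orders between 0 and 1\<close>

lemma tendsto_set_integral_Ioo_at_top:
  fixes f :: "real \<Rightarrow> 'a::{banach, second_countable_topology}"
  assumes f: "set_integrable lborel {0<..} f"
  shows "((\<lambda>T. LBINT v:{0<..<T}. f v) \<longlongrightarrow> (LBINT v:{0<..}. f v)) at_top"
  unfolding set_lebesgue_integral_def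
proof (rule integral_dominated_convergence_at_top[where w="\<lambda>v. norm (indicator {0<..} v *\<^sub>R f v)"])
  have m: "(\<lambda>v. indicator {0<..} v *\<^sub>R f v) \<in> borel_measurable lborel"
    using f by (simp add: set_integrable_def)
  then show "(\<lambda>v. indicator {0<..} v *\<^sub>R f v) \<in> borel_measurable lborel" .
  show "(\<lambda>v. indicator {0<..<T} v *\<^sub>R f v) \<in> borel_measurable lborel" for T
  proof -
    have "(\<lambda>v. indicator {0<..<T} v *\<^sub>R f v) = (\<lambda>v. indicator {..<T} v *\<^sub>R (indicator {0<..} v *\<^sub>R f v))"
      by (auto simp: indicator_def)
    also have "\<dots> \<in> borel_measurable lborel"
      by (intro borel_measurable_scaleR m) auto
    finally show ?thesis .
  qed
  show "integrable lborel (\<lambda>v. norm (indicat_real {0<..} v *\<^sub>R f v))"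
    using f by (auto simp only: set_integrable_def intro: integrable_norm)
  show "AE v in lborel. ((\<lambda>T. indicat_real {0<..<T} v *\<^sub>R f v) \<longlongrightarrow> indicat_real {0<..} v *\<^sub>R f v) at_top"
  proof (intro AE_I2)
    fix v :: real
    show "((\<lambda>T. indicat_real {0<..<T} v *\<^sub>R f v) \<longlongrightarrow> indicat_real {0<..} v *\<^sub>R f v) at_top"
      by (rule tendsto_eventually, use eventually_gt_at_top[of v] in eventually_elim) (auto simp: indicator_def)
  qed
  show "\<forall>\<^sub>F T in at_top. AE v in lborel. norm (indicat_real {0<..<T} v *\<^sub>R f v) \<le> norm (indicat_real {0<..} v *\<^sub>R f v)"
    by (intro always_eventually allI AE_I2) (auto simp: indicator_def)
qed

text \<open>\<open>min 2 v\<close> is the pointwise bound of \<open>iexp (- v) - 1\<close>: the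
  linear part tames the singularity at 0 because \<open>l < 1\<close>, the constant part gives decay
  because \<open>l > 0\<close>.\<close>

lemma set_integrable_powr_min:
  fixes l :: real
  assumes l: "0 < l" "l < 1"
  shows "set_integrable lborel {0<..} (\<lambda>v. v powr (- 1 - l) *\<^sub>R min 2 v)"
proof -
  have "set_integrable lborel {0<..<1} (\<lambda>v. v powr (- 1 - l) *\<^sub>R min 2 v)"
  proof (rule set_integrable_bound)
    show "set_integrable lborel {0<..<1} (\<lambda>v::real. v powr (- l))"
      using l by (intro set_integral_powr_from_0) auto
    show "AE v in lborel. v \<in> {0<..<1} \<longrightarrow> norm (v powr (- 1 - l) *\<^sub>R min 2 v) \<le> norm (v powr (- l))"
      by (intro AE_I2) (auto simp: powr_diff powr_minus field_simps)
  qed (auto simp: set_borel_measurable_def)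
  \<comment> \<open>The overlap with \<open>{0<..<1}\<close> lets two open intervals cover the
    half-line without leaving out the point 1.\<close>
  moreover have "set_integrable lborel {1/2<..} (\<lambda>v. v powr (- 1 - l) *\<^sub>R min 2 v)"
  proof (rule set_integrable_bound)
    show "set_integrable lborel {1/2<..} (\<lambda>v::real. 2 * v powr (- 1 - l))"
      using l by (intro set_integrable_mult_right set_integrable_powr_to_infinity) auto
    show "AE v in lborel. v \<in> {1/2<..} \<longrightarrow> norm (v powr (- 1 - l) *\<^sub>R min 2 v) \<le> norm (2 * v powr (- 1 - l))"
      by (intro AE_I2) (auto simp: min_def)
  qed (auto simp: set_borel_measurable_def)
  ultimately have "set_integrable lborel ({0<..<1} \<union> {1/2<..}) (\<lambda>v. v powr (- 1 - l) *\<^sub>R min 2 v)"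
    by (rule set_integrable_Un) auto
  moreover have "{0<..<1} \<union> {1/2<..} = {0::real<..}" by auto
  ultimately show ?thesis by simp
qed

text \<open>Scaling by \<open>\<bar>x\<bar>\<close> turns the universal majorant into the factor
  \<open>\<bar>x\<bar> powr l\<close>. Together with the weight \<open>\<bar>x\<bar> ^ k\<close> of
  a \<open>k\<close>-th derivative this is precisely the moment of order
  \<open>k + l\<close>.\<close>

lemma set_integrable_iexp_diff_powr:
  fixes l x :: real
  assumes l: "0 < l" "l < 1"
  shows "set_integrable lborel {0<..} (\<lambda>v. v powr (- 1 - l) *\<^sub>R (iexp (- (v * x)) - 1))"
    and "(LBINT v:{0<..}. norm (v powr (- 1 - l) *\<^sub>R (iexp (- (v * x)) - 1)))
           \<le> \<bar>x\<bar> powr l * (LBINT v:{0<..}. v powr (- 1 - l) *\<^sub>R min 2 v)"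
proof -
  let ?f = "\<lambda>v. v powr (- 1 - l) *\<^sub>R (iexp (- (v * x)) - 1)"
  let ?g = "\<lambda>v. v powr (- 1 - l) *\<^sub>R min 2 (\<bar>x\<bar> * v)"
  have g: "set_integrable lborel {0<..} ?g \<and>
      (LBINT v:{0<..}. ?g v) = \<bar>x\<bar> powr l * (LBINT v:{0<..}. v powr (- 1 - l) *\<^sub>R min 2 v)"
  proof (cases "x = 0")
    case False
    then show ?thesis
      using set_integral_powr_scale[of "\<bar>x\<bar>" "- 1 - l" "\<lambda>v. min 2 v"] set_integrable_powr_min[OF l]
      by simp
  qed (simp add: set_integrable_def)
  have le: "norm (?f v) \<le> ?g v" if "v > 0" for v
  proof -
    have "norm (iexp (- (v * x)) - 1) \<le> min 2 (\<bar>x\<bar> * v)"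
      using norm_iexp_diff_le[of "- (v * x)"] that by (auto simp: abs_mult mult.commute)
    then show ?thesis by (simp add: mult_left_mono)
  qed
  show i: "set_integrable lborel {0<..} ?f"
  proof (rule set_integrable_bound[OF g[THEN conjunct1]])
    show "AE v in lborel. v \<in> {0<..} \<longrightarrow> norm (?f v) \<le> norm (?g v)"
      using le by (intro AE_I2) (auto intro: order_trans)
  qed (auto simp: set_borel_measurable_def)
  have "(LBINT v:{0<..}. norm (?f v)) \<le> (LBINT v:{0<..}. ?g v)"
    using i g le by (intro set_integral_mono set_integrable_norm) auto
  then show "(LBINT v:{0<..}. norm (?f v)) \<le> \<bar>x\<bar> powr l * (LBINT v:{0<..}. v powr (- 1 - l) *\<^sub>R min 2 v)"
    using g by simp
qed

text \<open>One integration by parts raises the exponent from \<open>- 1 - l\<close> to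
  \<open>- l\<close> and removes the subtracted 1. This is the conditionally convergent integral
  with \<open>a = 1 - l\<close>, and \<open>Gamma (1 - l) = - l * Gamma (- l)\<close> cancels the
  factor \<open>- l\<close>.\<close>

lemma set_integral_iexp_diff_powr:
  fixes l x :: real
  assumes l: "0 < l" "l < 1"
  shows "(LBINT v:{0<..}. v powr (- 1 - l) *\<^sub>R (iexp (- (v * x)) - 1)) =
           of_real (Gamma (- l)) * (\<i> * of_real x) powr of_real l"
proof (cases "x = 0")
  case x: False
  define f where "f = (\<lambda>v. v powr (- 1 - l) *\<^sub>R (iexp (- (v * x)) - 1))"
  define h where "h = (\<lambda>v. v powr ((1 - l) - 1) *\<^sub>R iexp (- (v * x)))"
  define P where "P = (\<lambda>v. v powr (- l) *\<^sub>R (iexp (- (v * x)) - 1))"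
  have fi: "set_integrable lborel {0<..} f"
    unfolding f_def by (rule set_integrable_iexp_diff_powr[OF l])
  have FTC: "of_real (- l) * (LBINT v:{0<..<T}. f v) = P T + \<i> * of_real x * (LBINT v:{0<..<T}. h v)"
    if T: "T > 0" for T
  proof -
    have e: "einterval 0 (ereal T) = {0<..<T}" by (auto simp: einterval_def)
    have fi': "set_integrable lborel {0<..<T} f" by (rule set_integrable_subset[OF fi]) auto
    have hi: "set_integrable lborel {0<..<T} h"
    proof (rule set_integrable_bound)
      show "set_integrable lborel {0<..<T} (\<lambda>v. v powr (- l))"
        using l T by (intro set_integral_powr_from_0) auto
    qed (auto simp: h_def set_borel_measurable_def)
    define p where "p = (\<lambda>v. of_real (- l) * f v - \<i> * of_real x * h v)"
    have "(LBINT v=0..T. p v) = P T - 0"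
    proof (rule interval_integral_FTC_integrable[where F=P])
      fix v assume "0 < ereal v" "ereal v < ereal T"
      then have v: "v > 0" by simp
      have "((\<lambda>v. v powr (- l)) has_real_derivative - l * v powr (- l - 1)) (at v)"
        using v by (auto intro!: derivative_eq_intros simp: powr_diff)
      moreover have "((\<lambda>v. iexp (- (v * x)) - 1) has_vector_derivative - \<i> * of_real x * iexp (- (v * x))) (at v)"
        using has_vector_derivative_diff[OF has_vector_derivative_exp_linear[of "- \<i> * of_real x" v UNIV] has_vector_derivative_const[of 1]]
        by (simp add: mult_ac)
      ultimately have "(P has_vector_derivative v powr (- l) *\<^sub>R (- \<i> * of_real x * iexp (- (v * x))) +
          (- l * v powr (- l - 1)) *\<^sub>R (iexp (- (v * x)) - 1)) (at v)"
        unfolding P_def by (rule has_vector_derivative_scaleR)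
      also have "v powr (- l) *\<^sub>R (- \<i> * of_real x * iexp (- (v * x))) +
          (- l * v powr (- l - 1)) *\<^sub>R (iexp (- (v * x)) - 1) = p v"
        by (simp add: p_def f_def h_def scaleR_conv_of_real minus_diff_commute[of 1] algebra_simps)
      finally show "(P has_vector_derivative p v) (at v)" .
      show "isCont p v"
        unfolding p_def f_def h_def using v by (auto intro!: continuous_intros)
    next
      show "set_integrable lborel (einterval 0 (ereal T)) p"
        unfolding e p_def using fi' hi by (intro set_integral_diff set_integrable_mult_right)
      \<comment> \<open>At 0 the difference \<open>iexp (- (v * x)) - 1\<close> supplies one power
        of \<open>v\<close>, which beats \<open>v powr (- l)\<close>.\<close>
      have "(P \<longlongrightarrow> 0) (at_right 0)"
      proof (rule Lim_null_comparison)
        show "\<forall>\<^sub>F v in at_right 0. norm (P v) \<le> \<bar>x\<bar> * v powr (1 - l)"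
          using eventually_at_right_less[of 0]
        proof eventually_elim
          case (elim v)
          have "norm (P v) \<le> v powr (- l) * (\<bar>x\<bar> * v)"
            using norm_iexp_diff_le(1)[of "- (v * x)"] elim
            by (auto simp: P_def abs_mult mult_ac intro!: mult_left_mono)
          then show ?case using elim by (simp add: powr_diff powr_minus field_simps)
        qed
        show "((\<lambda>v. \<bar>x\<bar> * v powr (1 - l)) \<longlongrightarrow> 0) (at_right 0)"
          using l x by real_asymp
      qed
      then show "((P \<circ> real_of_ereal) \<longlongrightarrow> 0) (at_right 0)"
        by (simp add: ereal_tendsto_simps zero_ereal_def)
      have "(P \<longlongrightarrow> P T) (at_left T)"
        unfolding P_def using T by (intro tendsto_intros) auto
      then show "((P \<circ> real_of_ereal) \<longlongrightarrow> P T) (at_left (ereal T))"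
        by (simp add: ereal_tendsto_simps)
    qed (use T in auto)
    then have "(LBINT v:{0<..<T}. p v) = P T"
      using T by (simp add: interval_lebesgue_integral_def e)
    moreover have "(LBINT v:{0<..<T}. p v) = of_real (- l) * (LBINT v:{0<..<T}. f v) - \<i> * of_real x * (LBINT v:{0<..<T}. h v)"
      unfolding p_def using fi' hi
      by (subst set_integral_diff(2))
         (intro set_integrable_mult_right impI, assumption, intro set_integrable_mult_right impI, assumption,
          simp only: set_integral_mult_right)
    ultimately show ?thesis by (simp add: algebra_simps)
  qed
  have "((\<lambda>T. of_real (- l) * (LBINT v:{0<..<T}. f v)) \<longlongrightarrow> of_real (- l) * (LBINT v:{0<..}. f v)) at_top"
    by (intro tendsto_intros tendsto_set_integral_Ioo_at_top fi)
  moreover have "((\<lambda>T. of_real (- l) * (LBINT v:{0<..<T}. f v)) \<longlongrightarrow>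
      0 + \<i> * of_real x * (of_real (Gamma (1 - l)) * (\<i> * of_real x) powr (- of_real (1 - l)))) at_top"
  proof (rule Lim_transform_eventually)
    have "(P \<longlongrightarrow> 0) at_top"
    proof (rule Lim_null_comparison)
      show "\<forall>\<^sub>F v in at_top. norm (P v) \<le> v powr (- l) * 2"
        using norm_iexp_diff_le(2)[of "- (v * x)" for v] by (intro always_eventually allI) (simp add: P_def mult_left_mono)
      show "((\<lambda>v. v powr (- l) * 2) \<longlongrightarrow> 0) at_top"
        using l by real_asymp
    qed
    then show "((\<lambda>T. P T + \<i> * of_real x * (LBINT v:{0<..<T}. h v)) \<longlongrightarrow>
        0 + \<i> * of_real x * (of_real (Gamma (1 - l)) * (\<i> * of_real x) powr (- of_real (1 - l)))) at_top"
      unfolding h_def using l x by (intro tendsto_intros tendsto_incomplete_Gamma_Fourier) auto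
    show "\<forall>\<^sub>F T in at_top. P T + \<i> * of_real x * (LBINT v:{0<..<T}. h v) = of_real (- l) * (LBINT v:{0<..<T}. f v)"
      using eventually_gt_at_top[of 0] by eventually_elim (rule FTC[symmetric])
  qed
  ultimately have eq: "of_real (- l) * (LBINT v:{0<..}. f v) =
      0 + \<i> * of_real x * (of_real (Gamma (1 - l)) * (\<i> * of_real x) powr (- of_real (1 - l)))"
    by (rule tendsto_unique[rotated]) simp
  have "- l \<notin> \<int>\<^sub>\<le>\<^sub>0"
    using l by (auto elim!: nonpos_Ints_cases Ints_cases simp: minus_equation_iff[of l])
  then have G: "Gamma (1 - l) = - l * Gamma (- l)"
    using Gamma_plus1[of "- l"] by (simp add: add.commute)
  have xi: "\<i> * of_real x * (\<i> * of_real x) powr (- of_real (1 - l)) = (\<i> * of_real x) powr of_real l"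
    using x powr_add[of "\<i> * of_real x" 1 "- of_real (1 - l)"] by simp
  have "of_real (- l) * (LBINT v:{0<..}. f v) = of_real (- l) * (of_real (Gamma (- l)) * (\<i> * of_real x) powr of_real l)"
    unfolding eq xi[symmetric] G by simp
  then show ?thesis
    using l by (simp add: f_def)
qed (simp add: set_lebesgue_integral_def)

section \<open>Polar form of the complex powers\<close>

text \<open>The principal argument of \<open>\<i> * of_real x\<close> is
  \<open>pi / 2 * sgn x\<close>; at \<open>x = 0\<close> both sides vanish. The explicit form gives
  measurability in \<open>x\<close> and reduces later phase computations to adding angles.\<close>

lemma powr_ii_times:
  "(\<i> * of_real x) powr of_real s = of_real (\<bar>x\<bar> powr s) * cis (pi / 2 * s * sgn x)"
proof (cases "x = 0")
  case False
  have "Ln (\<i> * of_real x) = of_real (ln \<bar>x\<bar>) + \<i> * of_real (pi / 2 * sgn x)"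
  proof (cases "x > 0")
    case True
    have "Ln (\<i> * of_real x) = Ln (of_real x) + Ln \<i>"
      using Ln_times_of_real[of x \<i>] True by (simp only: mult.commute) simp
    then show ?thesis using True by (simp only: Ln_of_real Ln_ii) simp
  next
    case F: False
    have "Ln (\<i> * of_real x) = Ln (of_real (- x)) + Ln (- \<i>)"
      using Ln_times_of_real[of "- x" "- \<i>"] False F by (simp add: mult.commute)
    then show ?thesis using F False by (simp only: Ln_of_real Ln_minus_ii) simp
  qed
  then show ?thesis
    using False by (simp add: powr_def cis_conv_exp exp_add[symmetric] exp_of_real[symmetric] algebra_simps)
qed simp

text \<open>Negative reals lie on the branch cut, where the principal argument is \<open>pi\<close>;
  this is the source of the phases attached to the negative half-line.\<close>

lemma powr_of_real_eq:
  "complex_of_real y powr of_real s = of_real (\<bar>y\<bar> powr s) * (if y < 0 then cis (pi * s) else 1)"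
proof (cases "y < 0")
  case True
  then have "Ln (of_real y) = of_real (ln \<bar>y\<bar>) + \<i> * of_real pi"
    by (simp add: Ln_of_real')
  then show ?thesis
    using True by (simp add: powr_def cis_conv_exp exp_add[symmetric] exp_of_real[symmetric] algebra_simps)
qed (simp add: powr_of_real)

lemma borel_measurable_powr_ii_times [measurable]:
  "(\<lambda>x. (\<i> * of_real x) powr of_real s) \<in> borel_measurable borel"
  unfolding powr_ii_times cis_conv_exp by measurable

subsection \<open>Fractional derivatives of characteristic functions\<close>

lemma integrable_pair_mult:
  fixes h k :: "_ \<Rightarrow> real"
  assumes "sigma_finite_measure M" "sigma_finite_measure N" and h: "integrable M h" and k: "integrable N k"
  shows "integrable (M \<Otimes>\<^sub>M N) (\<lambda>(v, x). h v * k x)"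
proof -
  interpret pair_sigma_finite M N using assms by (simp add: pair_sigma_finite_def)
  have [measurable]: "h \<in> borel_measurable M" "k \<in> borel_measurable N"
    using h k by auto
  show ?thesis
  proof (rule Fubini_integrable)
    show "integrable M (\<lambda>x. \<integral>y. norm (case (x, y) of (v, x) \<Rightarrow> h v * k x) \<partial>N)"
      using h by (simp add: abs_mult)
    show "AE x in M. integrable N (\<lambda>y. case (x, y) of (v, x) \<Rightarrow> h v * k x)"
      using k by simp
  qed measurable
qed

lemma integrable_bounded_by_product:
  fixes F :: "'a \<Rightarrow> 'b \<Rightarrow> 'c::{banach, second_countable_topology}" and h :: "'a \<Rightarrow> real" and k :: "'b \<Rightarrow> real"
  assumes "sigma_finite_measure M" "sigma_finite_measure N"
    and "integrable M h" "integrable N k"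
    and F: "case_prod F \<in> borel_measurable (M \<Otimes>\<^sub>M N)"
    and le: "\<And>v x. norm (F v x) \<le> h v * k x"
  shows "integrable (M \<Otimes>\<^sub>M N) (case_prod F)"
proof (rule Bochner_Integration.integrable_bound[OF integrable_pair_mult[OF assms(1-4)] F])
  show "AE z in M \<Otimes>\<^sub>M N. norm (case_prod F z) \<le> norm (case z of (v, x) \<Rightarrow> h v * k x)"
    using le by (intro AE_I2) (auto intro: order_trans[OF le abs_ge_self])
qed

text \<open>On one side of \<open>\<bar>x\<bar> = 1\<close> the power is at most 1, on the other at
  most \<open>\<bar>x\<bar> powr r\<close>; the common sign of the exponents decides which. The
  bound provides intermediate moments and a majorant for limits in the exponent.\<close>

lemma powr_le_one_plus_powr:
  fixes x r s :: real
  assumes "0 \<le> s \<and> s \<le> r \<or> r \<le> s \<and> s \<le> 0"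
  shows "\<bar>x\<bar> powr s \<le> 1 + \<bar>x\<bar> powr r"
proof (cases "x = 0")
  case x: False
  show ?thesis
  proof (cases "\<bar>x\<bar> \<le> 1")
    case True
    show ?thesis
    proof (cases "0 \<le> s \<and> s \<le> r")
      case True': True
      have "\<bar>x\<bar> powr s \<le> 1" using x True True' by (intro powr_le1) auto
      then show ?thesis by (simp add: add_increasing2)
    next
      case False
      then have "\<bar>x\<bar> powr s \<le> \<bar>x\<bar> powr r" using x True assms by (intro powr_mono') auto
      then show ?thesis by simp
    qed
  next
    case False
    show ?thesis
    proof (cases "0 \<le> s \<and> s \<le> r")
      case True
      then have "\<bar>x\<bar> powr s \<le> \<bar>x\<bar> powr r" using False by (intro powr_mono) auto
      then show ?thesis by simp
    next
      case F: False
      then have "\<bar>x\<bar> powr s \<le> \<bar>x\<bar> powr 0" using False assms by (intro powr_mono) auto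
      then show ?thesis using x by (simp add: add_increasing2)
    qed
  qed
qed simp

lemma (in finite_measure) integrable_powr_between:
  fixes X :: "'a \<Rightarrow> real"
  assumes [measurable]: "X \<in> borel_measurable M" and i: "integrable M (\<lambda>x. \<bar>X x\<bar> powr r)"
    and "0 \<le> s \<and> s \<le> r \<or> r \<le> s \<and> s \<le> 0"
  shows "integrable M (\<lambda>x. \<bar>X x\<bar> powr s)"
proof (rule Bochner_Integration.integrable_bound)
  show "integrable M (\<lambda>x. 1 + \<bar>X x\<bar> powr r)" using i by auto
  show "AE x in M. norm (\<bar>X x\<bar> powr s) \<le> norm (1 + \<bar>X x\<bar> powr r)"
    using powr_le_one_plus_powr[OF assms(3)] by (intro AE_I2) (auto intro: order_trans)
qed measurable

section \<open>The moment formula for derivatives of every real order\<close>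

context real_distribution
begin

text \<open>Fubini applies on the bounded interval \<open>(0, T)\<close>, where
  \<open>v powr (a - 1)\<close> is integrable; the limit in \<open>T\<close> is then taken under the
  expectation with majorant \<open>C * \<bar>x\<bar> powr (- a)\<close>. An atom at 0 has to be
  excluded because there the inner integral is \<open>T powr a / a\<close>, which diverges. The
  weight \<open>w\<close> allows the step to be iterated.\<close>

lemma unit_integral_fourier:
  assumes s: "-1 < s" "s < 0" and nz: "AE x in M. x \<noteq> 0"
    and w: "integrable M w" and ws: "integrable M (\<lambda>x. norm (w x) * \<bar>x\<bar> powr s)"
  shows "unit_integral s (\<lambda>t. \<integral>x. w x * iexp (t * x) \<partial>M) t =
           (\<integral>x. w x * (\<i> * of_real x) powr of_real s * iexp (t * x) \<partial>M)"
proof -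
  define a where "a = - s"
  have a: "0 < a" "a < 1" using s by (auto simp: a_def)
  have [measurable]: "w \<in> borel_measurable borel"
    using w by (metis borel_measurable_integrable measurable_cong_sets events_eq_borel)
  define A where "A = (\<lambda>T x. LBINT v:{0<..<T}. v powr (a - 1) *\<^sub>R iexp (- (v * x)))"
  obtain C where C: "\<And>x T. x \<noteq> 0 \<Longrightarrow> T > 0 \<Longrightarrow> norm (A T x) \<le> C * \<bar>x\<bar> powr (- a)"
    using incomplete_Gamma_Fourier_bounded[OF a] unfolding A_def by blast
  have [measurable]: "A T \<in> borel_measurable borel" for T
    unfolding A_def set_lebesgue_integral_def by measurable
  have swap: "(LBINT v:{0<..<T}. (\<integral>x. w x * iexp ((t - v) * x) \<partial>M) / of_real (v powr (1 + s))) =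
      (\<integral>x. w x * iexp (t * x) * A T x \<partial>M)" if T: "T > 0" for T
  proof -
    define F where "F = (\<lambda>v x. (indicator {0<..<T} v * v powr (a - 1)) *\<^sub>R (w x * iexp ((t - v) * x)))"
    have "(LBINT v:{0<..<T}. (\<integral>x. w x * iexp ((t - v) * x) \<partial>M) / of_real (v powr (1 + s))) =
      (\<integral>v. (\<integral>x. F v x \<partial>M) \<partial>lborel)"
      unfolding set_lebesgue_integral_def F_def integral_scaleR_right
      by (intro Bochner_Integration.integral_cong)
         (auto simp: indicator_def a_def powr_add powr_diff powr_minus scaleR_conv_of_real field_simps)
    also have "\<dots> = (\<integral>x. (\<integral>v. F v x \<partial>lborel) \<partial>M)"
    proof (rule pair_sigma_finite.Fubini_integral[symmetric, OF _ integrable_bounded_by_product])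
      show "pair_sigma_finite lborel M"
        by (simp add: pair_sigma_finite_def sigma_finite_lborel sigma_finite_measure_axioms)
      show "integrable lborel (\<lambda>v. indicator {0<..<T} v *\<^sub>R v powr (a - 1))"
        using set_integral_powr_from_0(1)[of "a - 1" T] a T by (simp add: set_integrable_def)
      show "integrable M (\<lambda>x. norm (w x))" using w by simp
      show "case_prod F \<in> borel_measurable (lborel \<Otimes>\<^sub>M M)"
        unfolding F_def by measurable
      show "norm (F v x) \<le> (indicator {0<..<T} v *\<^sub>R v powr (a - 1)) * norm (w x)" for v x
        unfolding F_def norm_scaleR norm_mult norm_exp_i_times by simp
    qed (auto intro: sigma_finite_lborel sigma_finite_measure_axioms)
    also have "\<dots> = (\<integral>x. w x * iexp (t * x) * A T x \<partial>M)"
    proof (intro Bochner_Integration.integral_cong refl)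
      fix x
      have "(\<integral>v. F v x \<partial>lborel) = (\<integral>v. (w x * iexp (t * x)) * (indicator {0<..<T} v *\<^sub>R v powr (a - 1) *\<^sub>R iexp (- (v * x))) \<partial>lborel)"
        unfolding F_def by (intro Bochner_Integration.integral_cong refl)
          (simp add: exp_add[symmetric] algebra_simps)
      then show "(\<integral>v. F v x \<partial>lborel) = w x * iexp (t * x) * A T x"
        unfolding A_def set_lebesgue_integral_def integral_mult_right_zero .
    qed
    finally show ?thesis .
  qed
  have "((\<lambda>T. \<integral>x. w x * iexp (t * x) * A T x \<partial>M) \<longlongrightarrow>
         (\<integral>x. w x * iexp (t * x) * (of_real (Gamma a) * (\<i> * of_real x) powr (- of_real a)) \<partial>M)) at_top"
  proof (rule integral_dominated_convergence_at_top[where w="\<lambda>x. C * (norm (w x) * \<bar>x\<bar> powr (- a))"])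
    show "integrable M (\<lambda>x. C * (norm (w x) * \<bar>x\<bar> powr (- a)))"
      using ws by (simp add: a_def)
    show "AE x in M. ((\<lambda>T. w x * iexp (t * x) * A T x) \<longlongrightarrow>
        w x * iexp (t * x) * (of_real (Gamma a) * (\<i> * of_real x) powr (- of_real a))) at_top"
      using nz
    proof eventually_elim
      case (elim x)
      show ?case unfolding A_def by (intro tendsto_intros tendsto_incomplete_Gamma_Fourier a elim)
    qed
    show "\<forall>\<^sub>F T in at_top. AE x in M. norm (w x * iexp (t * x) * A T x) \<le> C * (norm (w x) * \<bar>x\<bar> powr (- a))"
      using eventually_gt_at_top[of 0]
    proof eventually_elim
      case (elim T)
      show ?case using nz
      proof eventually_elim
        case (elim x)
        from mult_left_mono[OF C[OF elim \<open>T > 0\<close>], of "norm (w x)"]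
        show ?case by (simp only: norm_mult norm_exp_i_times) (simp add: mult_ac)
      qed
    qed
    show "(\<lambda>x. w x * iexp (t * x) * (of_real (Gamma a) * (\<i> * of_real x) powr (- of_real a))) \<in> borel_measurable M"
      using borel_measurable_powr_ii_times[of "- a"] by simp
  qed measurable
  then have "((\<lambda>T. LBINT v:{0<..<T}. (\<integral>x. w x * iexp ((t - v) * x) \<partial>M) / of_real (v powr (1 + s))) \<longlongrightarrow>
         (\<integral>x. w x * iexp (t * x) * (of_real (Gamma a) * (\<i> * of_real x) powr (- of_real a)) \<partial>M)) at_top"
    by (rule Lim_transform_eventually) (use eventually_gt_at_top[of 0] in eventually_elim, rule swap[symmetric])
  then have "unit_integral s (\<lambda>t. \<integral>x. w x * iexp (t * x) \<partial>M) t =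
     1 / of_real (Gamma a) * (\<integral>x. w x * iexp (t * x) * (of_real (Gamma a) * (\<i> * of_real x) powr (- of_real a)) \<partial>M)"
    unfolding unit_integral_def by (subst tendsto_Lim) (auto simp: a_def)
  also have "\<dots> = (\<integral>x. 1 / of_real (Gamma a) * (w x * iexp (t * x) * (of_real (Gamma a) * (\<i> * of_real x) powr (- of_real a))) \<partial>M)"
    by (rule integral_mult_right_zero[symmetric])
  also have "\<dots> = (\<integral>x. w x * (\<i> * of_real x) powr of_real s * iexp (t * x) \<partial>M)"
  proof (intro Bochner_Integration.integral_cong refl)
    fix x
    have "complex_of_real (Gamma a) \<noteq> 0"
      using Gamma_real_pos[OF a(1)] by (metis of_real_eq_0_iff less_irrefl)
    then show "1 / of_real (Gamma a) * (w x * iexp (t * x) * (of_real (Gamma a) * (\<i> * of_real x) powr (- of_real a))) =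
        w x * (\<i> * of_real x) powr of_real s * iexp (t * x)"
      by (simp add: a_def)
  qed
  finally show ?thesis .
qed

text \<open>This is the weight \<open>(\<i> * of_real x) powr of_real (- real n)\<close> produced by
  \<open>n\<close> earlier integrations. Powers of the same base add exponents on the principal
  branch, so one fractional step lands at order \<open>s\<close>.\<close>

lemma unit_integral_powr_fourier:
  assumes s: "- real (Suc n) < s" "s < - real n" and nz: "AE x in M. x \<noteq> 0"
    and i: "integrable M (\<lambda>x. \<bar>x\<bar> powr s)"
  shows "unit_integral (s + real n) (\<lambda>t. \<integral>x. (\<i> * of_real x) powr of_real (- real n) * iexp (t * x) \<partial>M) t =
           (\<integral>x. (\<i> * of_real x) powr of_real s * iexp (t * x) \<partial>M)"
proof -
  let ?w = "\<lambda>x. (\<i> * of_real x) powr of_real (- real n)"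
  have "integrable M (\<lambda>x. \<bar>x\<bar> powr (- real n))"
    using s by (intro integrable_powr_between[OF _ i]) auto
  then have iw: "integrable M ?w"
    by (rule Bochner_Integration.integrable_bound)
       (use borel_measurable_powr_ii_times[of "- real n"] norm_powr_ii_times[of _ "- real n"] in auto)
  have eq: "\<bar>x\<bar> powr s = norm (?w x) * \<bar>x\<bar> powr (s + real n)" for x
    unfolding norm_powr_ii_times by (cases "x = 0") (auto simp: powr_add[symmetric])
  have "integrable M (\<lambda>x. norm (?w x) * \<bar>x\<bar> powr (s + real n))"
    using i unfolding eq[symmetric] .
  then have "unit_integral (s + real n) (\<lambda>t. \<integral>x. ?w x * iexp (t * x) \<partial>M) t =
     (\<integral>x. ?w x * (\<i> * of_real x) powr of_real (s + real n) * iexp (t * x) \<partial>M)"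
    using s nz iw by (intro unit_integral_fourier) auto
  also have "\<dots> = (\<integral>x. (\<i> * of_real x) powr of_real s * iexp (t * x) \<partial>M)"
  proof (intro Bochner_Integration.integral_cong refl)
    fix x :: real
    have "?w x * (\<i> * of_real x) powr of_real (s + real n) = (\<i> * of_real x) powr of_real s"
      by (cases "x = 0") (auto simp: powr_add[symmetric])
    then show "?w x * (\<i> * of_real x) powr of_real (s + real n) * iexp (t * x) =
         (\<i> * of_real x) powr of_real s * iexp (t * x)" by simp
  qed
  finally show ?thesis .
qed

text \<open>Orders strictly between \<open>- real (Suc n)\<close> and \<open>- real n\<close> are
  reached from the order \<open>- real n\<close>. Letting them decrease to the left end passes under
  the expectation, since \<open>1 + \<bar>x\<bar> powr (- real (Suc n))\<close> dominates all of
  them.\<close>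

lemma neg_int_deriv_char:
  assumes nz: "AE x in M. x \<noteq> 0" and "integrable M (\<lambda>x. \<bar>x\<bar> powr (- real n))"
  shows "neg_int_deriv n (char M) = (\<lambda>t. \<integral>x. (\<i> * of_real x) powr of_real (- real n) * iexp (t * x) \<partial>M)"
  using assms(2)
proof (induction n)
  case 0
  \<comment> \<open>At \<open>n = 0\<close> the weight equals 1 only for
    \<open>x \<noteq> 0\<close>, hence the appeal to the missing atom.\<close>
  show ?case
    using nz by (auto simp: fun_eq_iff char_def intro!: integral_cong_AE)
next
  case (Suc n)
  have i: "integrable M (\<lambda>x. \<bar>x\<bar> powr s)" if "- real (Suc n) \<le> s" "s \<le> 0" for s
    using that by (intro integrable_powr_between[OF _ Suc.prems]) auto
  have IH: "neg_int_deriv n (char M) = (\<lambda>t. \<integral>x. (\<i> * of_real x) powr of_real (- real n) * iexp (t * x) \<partial>M)"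
    using i[of "- real n"] by (intro Suc.IH) auto
  have unit: "unit_integral (s + real n) (neg_int_deriv n (char M)) t =
       (\<integral>x. (\<i> * of_real x) powr of_real s * iexp (t * x) \<partial>M)"
    if s: "- real (Suc n) < s" "s < - real n" for s t
    unfolding IH using s i[of s] by (intro unit_integral_powr_fourier nz) auto
  have m: "(\<lambda>x. (\<i> * of_real x) powr of_real s * iexp (t * x)) \<in> borel_measurable M" for s t
    by measurable
  show ?case
  proof
    fix t
    have "((\<lambda>s. \<integral>x. (\<i> * of_real x) powr of_real s * iexp (t * x) \<partial>M) \<longlongrightarrow>
        (\<integral>x. (\<i> * of_real x) powr of_real (- real (Suc n)) * iexp (t * x) \<partial>M)) (at_right (- real (Suc n)))"
    proof (rule tendsto_at_right_sequentially[of _ "- real n"])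
      fix S :: "nat \<Rightarrow> real"
      assume S: "\<And>k. - real (Suc n) < S k" "\<And>k. S k < - real n" "S \<longlonglongrightarrow> - real (Suc n)"
      show "(\<lambda>k. \<integral>x. (\<i> * of_real x) powr of_real (S k) * iexp (t * x) \<partial>M) \<longlonglongrightarrow>
        (\<integral>x. (\<i> * of_real x) powr of_real (- real (Suc n)) * iexp (t * x) \<partial>M)"
      proof (rule integral_dominated_convergence[where w="\<lambda>x. 1 + \<bar>x\<bar> powr (- real (Suc n))"])
        show "AE x in M. (\<lambda>k. (\<i> * of_real x) powr of_real (S k) * iexp (t * x)) \<longlonglongrightarrow>
           (\<i> * of_real x) powr of_real (- real (Suc n)) * iexp (t * x)"
          using nz
        proof eventually_elim
          case (elim x)
          then have z: "\<i> * complex_of_real x \<noteq> 0" by simp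
          \<comment> \<open>For a fixed nonzero base the power is \<open>exp\<close> of the exponent
            times \<open>Ln\<close>, visibly continuous in the exponent.\<close>
          show ?case
            unfolding powr_def if_not_P[OF z] by (intro tendsto_intros S(3))
        qed
        fix k
        have "S k \<le> 0" using S(2)[of k] by (meson less_imp_le neg_le_0_iff_le of_nat_0_le_iff order_trans)
        then have "\<bar>x\<bar> powr S k \<le> 1 + \<bar>x\<bar> powr (- real (Suc n))" for x
          using S(1)[of k] by (intro powr_le_one_plus_powr) auto
        then show "AE x in M. norm ((\<i> * of_real x) powr of_real (S k) * iexp (t * x)) \<le> 1 + \<bar>x\<bar> powr (- real (Suc n))"
          by (intro AE_I2) (simp only: norm_mult norm_exp_i_times norm_powr_ii_times, simp)
      qed (insert Suc.prems, (rule m | simp)+)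
    qed simp
    moreover have "\<forall>\<^sub>F s in at_right (- real (Suc n)). s \<in> {- real (Suc n)<..<- real n}"
      by (rule eventually_at_right_real) simp
    then have "\<forall>\<^sub>F s in at_right (- real (Suc n)). (\<integral>x. (\<i> * of_real x) powr of_real s * iexp (t * x) \<partial>M) =
        unit_integral (s + real n) (neg_int_deriv n (char M)) t"
      by eventually_elim (use unit in auto)
    ultimately have "((\<lambda>s. unit_integral (s + real n) (neg_int_deriv n (char M)) t) \<longlongrightarrow>
        (\<integral>x. (\<i> * of_real x) powr of_real (- real (Suc n)) * iexp (t * x) \<partial>M)) (at_right (- real (Suc n)))"
      by (rule Lim_transform_eventually)
    then show "neg_int_deriv (Suc n) (char M) t =
        (\<integral>x. (\<i> * of_real x) powr of_real (- real (Suc n)) * iexp (t * x) \<partial>M)"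
      unfolding neg_int_deriv.simps by (intro tendsto_Lim) auto
  qed
qed

text \<open>Natural powers instead of \<open>powr\<close>, because at \<open>n = 0\<close> the
  weight must be 1 also at \<open>x = 0\<close>: the law may have an atom there.\<close>

lemma int_deriv_char:
  assumes "integrable M (\<lambda>x. \<bar>x\<bar> ^ n)"
  shows "int_deriv n (char M) = (\<lambda>t. \<integral>x. (\<i> * of_real x) ^ n * iexp (t * x) \<partial>M)"
  using assms
proof (induction n)
  case 0
  show ?case by (simp add: int_deriv_def char_def)
next
  case (Suc n)
  have i: "integrable M (\<lambda>x. \<bar>x\<bar> ^ n)"
  proof (rule Bochner_Integration.integrable_bound)
    show "integrable M (\<lambda>x. 1 + \<bar>x\<bar> ^ Suc n)" using Suc.prems by auto
    have "\<bar>x\<bar> ^ n \<le> 1 + \<bar>x\<bar> ^ Suc n" for x :: real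
    proof (cases "\<bar>x\<bar> \<le> 1")
      case True
      then have "\<bar>x\<bar> ^ n \<le> 1" by (simp add: power_le_one)
      then show ?thesis by (simp add: add_increasing2 del: power_Suc)
    next
      case False
      then have "\<bar>x\<bar> ^ n \<le> \<bar>x\<bar> ^ Suc n" by (intro power_increasing) auto
      then show ?thesis by simp
    qed
    then show "AE x in M. norm (\<bar>x\<bar> ^ n) \<le> norm (1 + \<bar>x\<bar> ^ Suc n)"
      by (intro AE_I2) (simp del: power_Suc add: abs_of_nonneg add_nonneg_nonneg)
  qed auto
  have "((\<lambda>t. \<integral>x. (\<i> * of_real x) ^ n * iexp (t * x) \<partial>M) has_vector_derivative
         (\<integral>x. \<i> * of_real x * (\<i> * of_real x) ^ n * iexp (t * x) \<partial>M)) (at t)" for t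
  proof (rule has_vector_derivative_fourier)
    show "integrable M (\<lambda>x. (\<i> * of_real x) ^ n)"
      by (rule Bochner_Integration.integrable_bound[OF i]) (auto simp: norm_power norm_mult)
    show "integrable M (\<lambda>x. of_real x * (\<i> * of_real x) ^ n)"
      by (rule Bochner_Integration.integrable_bound[OF Suc.prems]) (auto simp: norm_power norm_mult)
  qed simp
  then have "vector_derivative (int_deriv n (char M)) (at t) =
     (\<integral>x. \<i> * of_real x * (\<i> * of_real x) ^ n * iexp (t * x) \<partial>M)" for t
    unfolding Suc.IH[OF i] by (rule vector_derivative_at)
  then show ?case
    by (simp add: int_deriv_def fun_eq_iff)
qed

text \<open>Subtracting the value at \<open>t\<close> makes the inner integral absolutely convergent
  over the whole half-line, with norm at most \<open>C * \<bar>x\<bar> powr s\<close> after the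
  weight \<open>\<bar>x\<bar> ^ k\<close> is included. Fubini then applies at once, without
  truncation.\<close>

lemma frac_deriv_char_pos:
  assumes s: "s > 0" "s \<notin> \<int>" and i: "integrable M (\<lambda>x. \<bar>x\<bar> powr s)"
  shows "frac_deriv s (char M) t = (\<integral>x. (\<i> * of_real x) powr of_real s * iexp (t * x) \<partial>M)"
proof -
  define k where "k = nat \<lfloor>s\<rfloor>"
  define l where "l = s - real k"
  have k: "real k = of_int \<lfloor>s\<rfloor>" using s by (simp add: k_def)
  have "s \<noteq> of_int \<lfloor>s\<rfloor>" using s(2) by (metis Ints_of_int)
  then have l: "0 < l" "l < 1" unfolding l_def k by linarith+
  have kl: "\<bar>x\<bar> ^ k * \<bar>x\<bar> powr l = \<bar>x\<bar> powr s" for x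
    using l by (cases "x = 0") (auto simp: l_def powr_diff powr_realpow[symmetric])
  have ikl: "(\<i> * of_real x) ^ k * (\<i> * of_real x) powr of_real l = (\<i> * of_real x) powr of_real s" for x
  proof (cases "x = 0")
    case False
    then have "(\<i> * of_real x) ^ k = (\<i> * of_real x) powr of_nat k"
      by (subst powr_nat) auto
    then show ?thesis by (simp add: powr_add[symmetric] l_def)
  qed (use l in auto)
  \<comment> \<open>The order \<open>k = 0\<close> stands apart because \<open>0 powr 0 = 0\<close>
    differs from \<open>0 ^ 0 = 1\<close>.\<close>
  have ik: "integrable M (\<lambda>x. \<bar>x\<bar> ^ k)"
  proof (cases "k = 0")
    case False
    have "integrable M (\<lambda>x. \<bar>x\<bar> powr real k)"
      using l by (intro integrable_powr_between[OF _ i]) (auto simp: l_def)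
    moreover have "\<bar>x\<bar> powr real k = \<bar>x\<bar> ^ k" for x :: real
      using False by (cases "x = 0") (auto simp: powr_realpow)
    ultimately show ?thesis by simp
  qed simp
  have iw: "integrable M (\<lambda>x. (\<i> * of_real x) ^ k * iexp (t * x))" for t
    by (rule Bochner_Integration.integrable_bound[OF ik]) (auto simp: norm_power norm_mult)
  define F where "F = (\<lambda>x v. indicator {0<..} v *\<^sub>R v powr (- 1 - l) *\<^sub>R
     ((\<i> * of_real x) ^ k * iexp (t * x) * (iexp (- (v * x)) - 1)))"
  define C where "C = (LBINT v:{0<..}. v powr (- 1 - l) *\<^sub>R min 2 v)"
  interpret P: pair_sigma_finite M lborel
    by (simp add: pair_sigma_finite_def sigma_finite_lborel sigma_finite_measure_axioms)
  have meas [measurable]: "case_prod F \<in> borel_measurable (M \<Otimes>\<^sub>M lborel)"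
    unfolding F_def by measurable
  have nF: "norm (F x v) = \<bar>x\<bar> ^ k * (indicator {0<..} v *\<^sub>R norm (v powr (- 1 - l) *\<^sub>R (iexp (- (v * x)) - 1)))" for x v
    unfolding F_def norm_scaleR norm_mult norm_exp_i_times by (simp add: norm_power norm_mult)
  have F_eq: "F x v = (\<i> * of_real x) ^ k * iexp (t * x) *
      (indicator {0<..} v *\<^sub>R v powr (- 1 - l) *\<^sub>R (iexp (- (v * x)) - 1))" for x v
    by (simp add: F_def)
  have fi: "integrable lborel (F x)" for x
    unfolding F_eq using set_integrable_iexp_diff_powr(1)[OF l, of x]
    by (intro integrable_mult_right impI) (simp add: set_integrable_def)
  have "integrable (M \<Otimes>\<^sub>M lborel) (case_prod F)"
  proof (rule P.Fubini_integrable[OF meas])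
    have m: "(\<lambda>x. \<integral>v. norm (F x v) \<partial>lborel) \<in> borel_measurable M"
      by measurable
    show "integrable M (\<lambda>x. \<integral>v. norm (case (x, v) of (x, v) \<Rightarrow> F x v) \<partial>lborel)"
    proof (rule Bochner_Integration.integrable_bound)
      show "integrable M (\<lambda>x. C * \<bar>x\<bar> powr s)" using i by simp
      have "(\<integral>v. norm (F x v) \<partial>lborel) \<le> C * \<bar>x\<bar> powr s" for x
      proof -
        have "(\<integral>v. norm (F x v) \<partial>lborel) =
           \<bar>x\<bar> ^ k * (LBINT v:{0<..}. norm (v powr (- 1 - l) *\<^sub>R (iexp (- (v * x)) - 1)))"
          unfolding nF set_lebesgue_integral_def by simp
        also have "\<dots> \<le> \<bar>x\<bar> ^ k * (\<bar>x\<bar> powr l * C)"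
          unfolding C_def using l by (intro mult_left_mono set_integrable_iexp_diff_powr) auto
        finally show ?thesis by (simp add: kl[symmetric] mult_ac)
      qed
      then show "AE x in M. norm (\<integral>v. norm (case (x, v) of (x, v) \<Rightarrow> F x v) \<partial>lborel) \<le> norm (C * \<bar>x\<bar> powr s)"
        by (intro AE_I2) (auto intro: order_trans[OF _ abs_ge_self])
    qed (use m in simp)
    show "AE x in M. integrable lborel (\<lambda>v. case (x, v) of (x, v) \<Rightarrow> F x v)"
      using fi by simp
  qed
  from P.Fubini_integral[OF this]
  have swap: "(\<integral>v. (\<integral>x. F x v \<partial>M) \<partial>lborel) = (\<integral>x. (\<integral>v. F x v \<partial>lborel) \<partial>M)" .
  have "(LBINT v:{0<..}. (int_deriv k (char M) (t - v) - int_deriv k (char M) t) / of_real (v powr (1 + l)))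
      = (\<integral>v. (\<integral>x. F x v \<partial>M) \<partial>lborel)"
    unfolding set_lebesgue_integral_def
  proof (intro Bochner_Integration.integral_cong refl)
    fix v :: real
    have "int_deriv k (char M) (t - v) - int_deriv k (char M) t =
        (\<integral>x. (\<i> * of_real x) ^ k * iexp (t * x) * (iexp (- (v * x)) - 1) \<partial>M)"
      unfolding int_deriv_char[OF ik] Bochner_Integration.integral_diff[OF iw iw, symmetric]
      by (intro Bochner_Integration.integral_cong refl) (simp add: algebra_simps exp_add exp_diff exp_minus field_simps)
    then show "indicator {0<..} v *\<^sub>R ((int_deriv k (char M) (t - v) - int_deriv k (char M) t) / of_real (v powr (1 + l)))
        = (\<integral>x. F x v \<partial>M)"
      unfolding F_def integral_scaleR_right
      by (simp add: powr_add powr_diff powr_minus scaleR_conv_of_real field_simps)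
  qed
  also have "\<dots> = (\<integral>x. of_real (Gamma (- l)) * ((\<i> * of_real x) powr of_real s * iexp (t * x)) \<partial>M)"
    unfolding swap
  proof (intro Bochner_Integration.integral_cong refl)
    fix x
    have "(\<integral>v. F x v \<partial>lborel) = (\<i> * of_real x) ^ k * iexp (t * x) *
        (LBINT v:{0<..}. v powr (- 1 - l) *\<^sub>R (iexp (- (v * x)) - 1))"
      unfolding F_eq set_lebesgue_integral_def integral_mult_right_zero ..
    also have "\<dots> = of_real (Gamma (- l)) * ((\<i> * of_real x) powr of_real s * iexp (t * x))"
      unfolding set_integral_iexp_diff_powr[OF l] ikl[symmetric] by (simp only: mult_ac)
    finally show "(\<integral>v. F x v \<partial>lborel) = of_real (Gamma (- l)) * ((\<i> * of_real x) powr of_real s * iexp (t * x))" .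
  qed
  finally have main: "(LBINT v:{0<..}. (int_deriv k (char M) (t - v) - int_deriv k (char M) t) / of_real (v powr (1 + l)))
     = of_real (Gamma (- l)) * (\<integral>x. (\<i> * of_real x) powr of_real s * iexp (t * x) \<partial>M)"
    by simp
  have "Gamma (- l) \<noteq> 0"
    using l by (auto simp: Gamma_eq_zero_iff elim!: nonpos_Ints_cases Ints_cases simp: minus_equation_iff[of l])
  moreover have "real k - s = - l" by (simp add: l_def)
  ultimately show ?thesis
    using s main by (simp add: frac_deriv_def Let_def k_def[symmetric] l_def[symmetric])
qed

lemma frac_deriv_char:
  assumes i: "integrable M (\<lambda>x. \<bar>x\<bar> powr s)" and nz: "s < 0 \<Longrightarrow> AE x in M. x \<noteq> 0"
  shows "frac_deriv s (char M) t = (\<integral>x. (\<i> * of_real x) powr of_real s * iexp (t * x) \<partial>M) +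
           (if s = 0 then of_real (measure M {0}) else 0)"
proof (cases "s \<in> \<int>")
  case True
  then obtain m where m: "s = of_int m" by (elim Ints_cases)
  consider "s = 0" | "s > 0" | "s < 0" by linarith
  then show ?thesis
  proof cases
    case 1
    \<comment> \<open>The indicator restores the mass at 0 that \<open>0 powr 0 = 0\<close>
      discards.\<close>
    have eq: "iexp (t * x) = (\<i> * of_real x) powr of_real s * iexp (t * x) + of_real (indicator {0} x)" for x
      using 1 by (cases "x = 0") auto
    have "(\<integral>x. iexp (t * x) \<partial>M) = (\<integral>x. (\<i> * of_real x) powr of_real s * iexp (t * x) + of_real (indicator {0} x) \<partial>M)"
      using eq by simp
    also have "\<dots> = (\<integral>x. (\<i> * of_real x) powr of_real s * iexp (t * x) \<partial>M) + (\<integral>x. of_real (indicator {0} x) \<partial>M)"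
    proof (rule Bochner_Integration.integral_add)
      show "integrable M (\<lambda>x. (\<i> * of_real x) powr of_real s * iexp (t * x))"
        by (rule integrable_const_bound[of _ 1])
           (use norm_powr_ii_times[of _ s] borel_measurable_powr_ii_times[of s] 1 in \<open>auto simp: norm_mult powr_def\<close>)
      show "integrable M (\<lambda>x. complex_of_real (indicator {0} x))"
        by (rule integrable_const_bound[of _ 1]) (auto simp: indicator_def)
    qed
    also have "(\<integral>x. complex_of_real (indicator {0} x) \<partial>M) = of_real (measure M {0})"
      by (subst integral_complex_of_real) simp
    finally show ?thesis using 1 by (simp add: frac_deriv_def int_deriv_def char_def)
  next
    case 2
    define n where "n = nat m"
    have n: "s = real n" "n > 0" using m 2 by (auto simp: n_def)
    have "\<bar>x\<bar> powr s = \<bar>x\<bar> ^ n" for x :: real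
      using n by (cases "x = 0") (auto simp: powr_realpow)
    then have "int_deriv n (char M) = (\<lambda>t. \<integral>x. (\<i> * of_real x) ^ n * iexp (t * x) \<partial>M)"
      using i by (intro int_deriv_char) auto
    moreover have "(\<i> * of_real x) ^ n = (\<i> * of_real x) powr of_real s" for x
      using n by (cases "x = 0") (auto simp: powr_nat)
    ultimately show ?thesis
      using n by (simp add: frac_deriv_def)
  next
    case 3
    define n where "n = nat (- m)"
    have n: "s = - real n" "n > 0" using m 3 by (auto simp: n_def)
    have "nat (- \<lfloor>s\<rfloor>) = n" using m n by simp
    then show ?thesis
      using neg_int_deriv_char[OF nz[OF 3], of n] i n True by (simp add: frac_deriv_def)
  qed
next
  case False
  show ?thesis
  proof (cases "s > 0")
    case True
    then show ?thesis using frac_deriv_char_pos[OF True False i] by simp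
  next
    case F: False
    then have s: "s < 0" using False by (cases "s = 0") auto
    \<comment> \<open>\<open>s\<close> lies strictly between \<open>- real (Suc n)\<close> and
      \<open>- real n\<close>, so a single fractional step from the derivative of order
      \<open>- real n\<close> reaches it.\<close>
    define n where "n = nat (- \<lceil>s\<rceil>)"
    have n: "real n = - of_int \<lceil>s\<rceil>" using s by (simp add: n_def)
    have "s \<noteq> of_int \<lceil>s\<rceil>" using False by (metis Ints_of_int)
    then have b: "- real (Suc n) < s" "s < - real n" using n by (simp_all, linarith+)
    have "integrable M (\<lambda>x. \<bar>x\<bar> powr (- real n))"
      using b by (intro integrable_powr_between[OF _ i]) auto
    from neg_int_deriv_char[OF nz[OF s] this]
    have "frac_deriv s (char M) t = unit_integral (s + real n) (\<lambda>t. \<integral>x. (\<i> * of_real x) powr of_real (- real n) * iexp (t * x) \<partial>M) t"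
      using s False F n by (simp add: frac_deriv_def n_def[symmetric])
    also have "\<dots> = (\<integral>x. (\<i> * of_real x) powr of_real s * iexp (t * x) \<partial>M)"
      by (rule unit_integral_powr_fourier[OF b nz[OF s] i])
    finally show ?thesis using s by simp
  qed
qed

end

subsection \<open>Integrals of exponential sums against a power\<close>

text \<open>Completeness yields a limit along the integers; letting \<open>T\<close> run through the
  integers in the hypothesis then gives the error bound \<open>h S\<close> for every real
  \<open>S\<close>.\<close>

lemma convergent_at_top_Cauchy:
  fixes f :: "real \<Rightarrow> 'a::banach"
  assumes h: "(h \<longlongrightarrow> (0::real)) at_top"
    and f: "\<And>S T. a \<le> S \<Longrightarrow> S \<le> T \<Longrightarrow> norm (f T - f S) \<le> h S"
  shows "\<exists>c. (f \<longlongrightarrow> c) at_top"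
proof -
  have "Cauchy (\<lambda>n. f (real n))"
    unfolding Cauchy_altdef2
  proof (intro allI impI)
    fix e :: real assume "e > 0"
    have "\<forall>\<^sub>F n in sequentially. h (real n) < e"
      using filterlim_compose[OF h filterlim_real_sequentially] \<open>e > 0\<close> by (rule order_tendstoD)
    moreover have "\<forall>\<^sub>F n in sequentially. a \<le> real n"
      by (rule eventually_compose_filterlim[OF eventually_ge_at_top filterlim_real_sequentially])
    ultimately have "\<forall>\<^sub>F n in sequentially. h (real n) < e \<and> a \<le> real n"
      by (rule eventually_conj)
    then obtain N where "h (real N) < e" "a \<le> real N" by (auto simp: eventually_sequentially)
    then have "dist (f (real n)) (f (real N)) < e" if "n \<ge> N" for n
      using f[of "real N" "real n"] that by (simp add: dist_norm)
    then show "\<exists>N. \<forall>n\<ge>N. dist (f (real n)) (f (real N)) < e"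
      by blast
  qed
  then obtain c where c: "(\<lambda>n. f (real n)) \<longlonglongrightarrow> c"
    by (auto simp: Cauchy_convergent_iff convergent_def)
  have "(f \<longlongrightarrow> c) at_top"
  proof (rule Lim_null_comparison[THEN LIM_zero_cancel])
    show "\<forall>\<^sub>F S in at_top. norm (f S - c) \<le> h S"
      using eventually_ge_at_top[of a]
    proof eventually_elim
      case (elim S)
      have "(\<lambda>n. norm (f (real n) - f S)) \<longlonglongrightarrow> norm (c - f S)"
        by (intro tendsto_intros c)
      moreover have "\<forall>\<^sub>F n in sequentially. norm (f (real n) - f S) \<le> h S"
        using eventually_compose_filterlim[OF eventually_ge_at_top[of S] filterlim_real_sequentially]
        by eventually_elim (use f elim in auto)
      ultimately have "norm (c - f S) \<le> h S" by (rule tendsto_upperbound) simp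
      then show ?case by (simp add: norm_minus_commute)
    qed
  qed (rule h)
  then show ?thesis by blast
qed

lemma set_integral_Ioo_split:
  fixes f :: "real \<Rightarrow> 'a::{banach, second_countable_topology}"
  assumes f: "set_integrable lborel {0<..<T} f" and "0 < e" "e \<le> T"
  shows "(LBINT t:{e..T}. f t) = (LBINT t:{0<..<T}. f t) - (LBINT t:{0<..<e}. f t)"
    and "set_integrable lborel {e..T} f"
proof -
  have i1: "set_integrable lborel {0<..<e} f" and i2: "set_integrable lborel {e..<T} f"
    by (rule set_integrable_subset[OF f]; use assms in auto)+
  have "(LBINT t:{0<..<e} \<union> {e..<T}. f t) = (LBINT t:{0<..<e}. f t) + (LBINT t:{e..<T}. f t)"
    by (rule set_integral_Un[OF _ i1 i2]) auto
  moreover have "{0<..<e} \<union> {e..<T} = {0<..<T}" using assms by auto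
  moreover have "(LBINT t:{e..<T}. f t) = (LBINT t:{e..T}. f t)"
    by (rule set_integral_discrete_difference[of "{T}"]) auto
  ultimately show "(LBINT t:{e..T}. f t) = (LBINT t:{0<..<T}. f t) - (LBINT t:{0<..<e}. f t)"
    by simp
  show "set_integrable lborel {e..T} f"
    using i2 by (subst set_integrable_discrete_difference[of "{T}" _ "{e..<T}"]) auto
qed

lemma has_real_derivative_powr_antiderivative:
  fixes c x :: real
  assumes "x > 0" "c \<noteq> 0"
  shows "((\<lambda>s. s powr c / c) has_real_derivative x powr (c - 1)) (at x within A)"
  using assms by (auto intro!: derivative_eq_intros simp: powr_diff)

text \<open>\<open>k\<close> stands for \<open>g (\<sigma> * s)\<close> with \<open>\<sigma>\<close>
  equal to 1 or -1, so each half-line is treated by the same lemmas. The coefficients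
  \<open>b\<close> absorb the phases of negative arguments, and \<open>q0\<close>, \<open>C\<close>,
  \<open>d\<close> make the growth condition at 0 explicit.\<close>

locale oscillatory_kernel =
  fixes J :: "'j set" and b :: "'j \<Rightarrow> complex" and q y :: "'j \<Rightarrow> real" and p q0 C d :: real
    and k :: "real \<Rightarrow> complex"
  assumes fin: "finite J"
    and k: "\<And>s. s > 0 \<Longrightarrow> k s = (\<Sum>j\<in>J. b j * of_real (s powr q j) * iexp (y j * s))"
    and kmeas [measurable]: "k \<in> borel_measurable borel"
    and q0: "q0 > p" and d: "d > 0"
    and small: "\<And>s. 0 < s \<Longrightarrow> s < d \<Longrightarrow> norm (k s) \<le> C * s powr q0"
begin

lemma kernel_norm_le:
  assumes "s > 0"
  shows "norm (s powr (- p - 1) *\<^sub>R k s) \<le> (\<Sum>j\<in>J. norm (b j) * s powr (q j - p - 1))"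
proof -
  have "norm (k s) \<le> (\<Sum>j\<in>J. norm (b j) * s powr q j)"
    unfolding k[OF assms] by (rule sum_norm_le) (simp add: norm_mult)
  then have "norm (s powr (- p - 1) *\<^sub>R k s) \<le> s powr (- p - 1) * (\<Sum>j\<in>J. norm (b j) * s powr q j)"
    by (simp add: mult_left_mono)
  also have "\<dots> = (\<Sum>j\<in>J. norm (b j) * s powr (q j - p - 1))"
    unfolding sum_distrib_left by (intro sum.cong refl) (simp add: powr_add[symmetric] algebra_simps)
  finally show ?thesis .
qed

text \<open>Individual terms with \<open>q j \<le> p\<close> are not integrable at 0 against this
  weight; the sum is, because cancellation makes it \<open>O(s powr q0)\<close> with
  \<open>q0 > p\<close>.\<close>

lemma kernel_small:
  assumes "0 < B" "B \<le> d"
  shows "set_integrable lborel {0<..<B} (\<lambda>s. s powr (- p - 1) *\<^sub>R k s)"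
    and "norm (LBINT s:{0<..<B}. s powr (- p - 1) *\<^sub>R k s) \<le> C * (B powr (q0 - p) / (q0 - p))"
proof -
  have le: "norm (s powr (- p - 1) *\<^sub>R k s) \<le> C * s powr (q0 - p - 1)" if "0 < s" "s < B" for s
  proof -
    have "norm (s powr (- p - 1) *\<^sub>R k s) \<le> s powr (- p - 1) * (C * s powr q0)"
      using small[of s] that assms by (simp add: mult_left_mono)
    also have "\<dots> = C * s powr (q0 - p - 1)"
      using that by (simp add: powr_add[symmetric] algebra_simps)
    finally show ?thesis .
  qed
  have i: "set_integrable lborel {0<..<B} (\<lambda>s. C * s powr (q0 - p - 1))"
    and I: "(LBINT s:{0<..<B}. C * s powr (q0 - p - 1)) = C * (B powr (q0 - p) / (q0 - p))"
    using set_integral_powr_from_0[of "q0 - p - 1" B] q0 assms by auto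
  show i': "set_integrable lborel {0<..<B} (\<lambda>s. s powr (- p - 1) *\<^sub>R k s)"
  proof (rule set_integrable_bound[OF i])
    show "AE s in lborel. s \<in> {0<..<B} \<longrightarrow> norm (s powr (- p - 1) *\<^sub>R k s) \<le> norm (C * s powr (q0 - p - 1))"
      using le by (intro AE_I2) (auto intro: order_trans[OF _ abs_ge_self])
  qed (auto simp: set_borel_measurable_def)
  have "norm (LBINT s:{0<..<B}. s powr (- p - 1) *\<^sub>R k s) \<le> (LBINT s:{0<..<B}. norm (s powr (- p - 1) *\<^sub>R k s))"
    by (rule set_integral_norm_bound[OF i'])
  also have "\<dots> \<le> (LBINT s:{0<..<B}. C * s powr (q0 - p - 1))"
    using le by (intro set_integral_mono i set_integrable_norm i') auto
  finally show "norm (LBINT s:{0<..<B}. s powr (- p - 1) *\<^sub>R k s) \<le> C * (B powr (q0 - p) / (q0 - p))"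
    using I by simp
qed

lemma kernel_set_integrable: "set_integrable lborel {0<..<B} (\<lambda>s. s powr (- p - 1) *\<^sub>R k s)"
proof -
  have "set_integrable lborel ({0<..<d} \<union> {d..B}) (\<lambda>s. s powr (- p - 1) *\<^sub>R k s)"
  proof (rule set_integrable_Un[OF kernel_small(1)])
    have "set_integrable lborel {d..B} (\<lambda>s. s powr (- p - 1) *\<^sub>R (\<Sum>j\<in>J. b j * of_real (s powr q j) * iexp (y j * s)))"
      using d by (intro borel_integrable_atLeastAtMost') (auto intro!: continuous_intros)
    moreover have "set_integrable lborel {d..B} (\<lambda>s. s powr (- p - 1) *\<^sub>R (\<Sum>j\<in>J. b j * of_real (s powr q j) * iexp (y j * s)))
       \<longleftrightarrow> set_integrable lborel {d..B} (\<lambda>s. s powr (- p - 1) *\<^sub>R k s)"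
      using d k by (intro set_integrable_cong) auto
    ultimately show "set_integrable lborel {d..B} (\<lambda>s. s powr (- p - 1) *\<^sub>R k s)" by simp
  qed (use d in auto)
  then show ?thesis
    by (rule set_integrable_subset) auto
qed

lemma kernel_integral_tendsto_0:
  "((\<lambda>B. LBINT s:{0<..<B}. s powr (- p - 1) *\<^sub>R k s) \<longlongrightarrow> 0) (at_right 0)"
proof (rule Lim_null_comparison)
  show "\<forall>\<^sub>F B in at_right 0. norm (LBINT s:{0<..<B}. s powr (- p - 1) *\<^sub>R k s) \<le> C * (B powr (q0 - p) / (q0 - p))"
    using eventually_at_right_real[OF d] by eventually_elim (rule kernel_small(2), auto)
  have "((\<lambda>B. B powr (q0 - p)) \<longlongrightarrow> 0) (at_right 0)" using q0 by real_asymp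
  then show "((\<lambda>B. C * (B powr (q0 - p) / (q0 - p))) \<longlongrightarrow> 0) (at_right 0)"
    by (intro tendsto_mult_right_zero tendsto_divide_zero)
qed

text \<open>Away from 0 the sum may be treated term by term. A nonzero frequency gains one power of
  \<open>s\<close> by oscillation, whereas frequency zero has to converge absolutely: this is the
  reason for the two different bounds on \<open>q j\<close>.\<close>

lemma kernel_integral_convergent:
  assumes y: "\<And>j. j \<in> J \<Longrightarrow> y j \<noteq> 0 \<Longrightarrow> q j < p + 1" and y0: "\<And>j. j \<in> J \<Longrightarrow> y j = 0 \<Longrightarrow> q j < p"
  shows "\<exists>c. ((\<lambda>B. LBINT s:{0<..<B}. s powr (- p - 1) *\<^sub>R k s) \<longlongrightarrow> c) at_top"
proof -
  \<comment> \<open>\<open>D j * S powr e j\<close> bounds the tail of the \<open>j\<close>-th term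
    beyond \<open>S\<close>: the exact tail of the power at frequency zero, the oscillation estimate
    otherwise.\<close>
  define e where "e = (\<lambda>j. if y j = 0 then q j - p else q j - p - 1)"
  define D where "D = (\<lambda>j. if y j = 0 then 1 / (p - q j) else 2 / \<bar>y j\<bar>)"
  have e: "e j < 0" if "j \<in> J" for j using y[OF that] y0[OF that] by (auto simp: e_def)
  have cont: "set_integrable lborel {S..T} (\<lambda>s. s powr (q j - p - 1) *\<^sub>R iexp (y j * s))" if "0 < S" for S T j
    using that by (intro borel_integrable_atLeastAtMost') (auto intro!: continuous_intros)
  have osc: "norm (LBINT s:{S..T}. s powr (q j - p - 1) *\<^sub>R iexp (y j * s)) \<le> D j * S powr e j"
    if j: "j \<in> J" and S: "0 < S" "S \<le> T" for j S T
  proof (cases "y j = 0")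
    case True
    have qp: "q j - p < 0" using y0[OF j True] by simp
    have "(LBINT s:{S..T}. s powr (q j - p - 1)) = T powr (q j - p) / (q j - p) - S powr (q j - p) / (q j - p)"
      unfolding set_lebesgue_integral_def
    proof (rule integral_FTC_atLeastAtMost)
      show "((\<lambda>s. s powr (q j - p) / (q j - p)) has_vector_derivative s powr (q j - p - 1)) (at s within {S..T})"
        if "S \<le> s" "s \<le> T" for s
        unfolding has_real_derivative_iff_has_vector_derivative[symmetric]
        using that S qp by (intro has_real_derivative_powr_antiderivative) auto
    qed (use S in \<open>auto intro!: continuous_intros\<close>)
    also have "\<dots> \<le> D j * S powr e j"
    proof -
      have "T powr (q j - p) / (q j - p) \<le> 0" using qp by (simp add: divide_nonneg_neg)
      moreover have "D j * S powr e j = - (S powr (q j - p) / (q j - p))"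
        using True minus_divide_right[of "S powr (q j - p)" "q j - p"] by (simp add: D_def e_def)
      ultimately show ?thesis by simp
    qed
    finally have "(LBINT s:{S..T}. s powr (q j - p - 1)) \<le> D j * S powr e j" .
    moreover have "norm (LBINT s:{S..T}. s powr (q j - p - 1) *\<^sub>R iexp (y j * s)) \<le>
        (LBINT s:{S..T}. norm (s powr (q j - p - 1) *\<^sub>R iexp (y j * s)))"
      using cont[OF S(1)] by (rule set_integral_norm_bound)
    moreover have "norm (s powr (q j - p - 1) *\<^sub>R iexp (y j * s)) = s powr (q j - p - 1)" for s
      unfolding norm_scaleR norm_exp_i_times by simp
    ultimately show ?thesis by simp
  next
    case False
    have "norm (LBINT s:{S..T}. s powr (q j - p - 1) *\<^sub>R exp (- (- \<i> * of_real (y j)) * of_real s))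
        \<le> 2 * S powr (q j - p - 1) / norm (- \<i> * of_real (y j))"
      using y[OF j False] False S by (intro norm_oscillatory_integral_le) auto
    then show ?thesis using False by (simp add: D_def e_def norm_mult mult_ac)
  qed
  show ?thesis
  proof (rule convergent_at_top_Cauchy)
    show "((\<lambda>S. \<Sum>j\<in>J. norm (b j) * (D j * S powr e j)) \<longlongrightarrow> 0) at_top"
    proof (rule tendsto_null_sum)
      fix j assume "j \<in> J"
      then have "e j < 0" by (rule e)
      then have "((\<lambda>S. S powr e j) \<longlongrightarrow> 0) at_top" by real_asymp
      then show "((\<lambda>S. norm (b j) * (D j * S powr e j)) \<longlongrightarrow> 0) at_top"
        by (intro tendsto_mult_right_zero)
    qed
    fix S T :: real assume S: "1 \<le> S" "S \<le> T"
    have "(LBINT s:{0<..<T}. s powr (- p - 1) *\<^sub>R k s) - (LBINT s:{0<..<S}. s powr (- p - 1) *\<^sub>R k s)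
      = (LBINT s:{S..T}. s powr (- p - 1) *\<^sub>R k s)"
      using S by (intro set_integral_Ioo_split(1)[symmetric] kernel_set_integrable) auto
    also have "\<dots> = (LBINT s:{S..T}. (\<Sum>j\<in>J. b j * (s powr (q j - p - 1) *\<^sub>R iexp (y j * s))))"
    proof (rule set_lebesgue_integral_cong)
      show "\<forall>s. s \<in> {S..T} \<longrightarrow> s powr (- p - 1) *\<^sub>R k s = (\<Sum>j\<in>J. b j * (s powr (q j - p - 1) *\<^sub>R iexp (y j * s)))"
      proof (intro allI impI)
        fix s assume "s \<in> {S..T}"
        then have s: "s > 0" using S by auto
        show "s powr (- p - 1) *\<^sub>R k s = (\<Sum>j\<in>J. b j * (s powr (q j - p - 1) *\<^sub>R iexp (y j * s)))"
          unfolding k[OF s] scaleR_sum_right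
        proof (intro sum.cong refl)
          fix j
          have "s powr (q j - p - 1) = s powr (- p - 1) * s powr q j"
            by (simp add: powr_add[symmetric] algebra_simps)
          then show "s powr (- p - 1) *\<^sub>R (b j * of_real (s powr q j) * iexp (y j * s)) =
              b j * (s powr (q j - p - 1) *\<^sub>R iexp (y j * s))"
            by (simp add: scaleR_conv_of_real mult_ac)
        qed
      qed
    qed simp
    also have "\<dots> = (\<Sum>j\<in>J. LBINT s:{S..T}. b j * (s powr (q j - p - 1) *\<^sub>R iexp (y j * s)))"
    proof -
      have "integrable lborel (\<lambda>s. indicator {S..T} s *\<^sub>R (b j * (s powr (q j - p - 1) *\<^sub>R iexp (y j * s))))" for j
        using set_integrable_mult_right[OF cont[of S T j], of "b j"] S unfolding set_integrable_def by auto
      then show ?thesis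
        unfolding set_lebesgue_integral_def scaleR_sum_right
        by (intro Bochner_Integration.integral_sum)
    qed
    also have "\<dots> = (\<Sum>j\<in>J. b j * (LBINT s:{S..T}. s powr (q j - p - 1) *\<^sub>R iexp (y j * s)))"
      by (intro sum.cong refl set_integral_mult_right)
    finally show "norm ((LBINT s:{0<..<T}. s powr (- p - 1) *\<^sub>R k s) - (LBINT s:{0<..<S}. s powr (- p - 1) *\<^sub>R k s))
        \<le> (\<Sum>j\<in>J. norm (b j) * (D j * S powr e j))"
    proof (simp only:, intro sum_norm_le)
      fix j assume "j \<in> J"
      then show "norm (b j * (LBINT s:{S..T}. s powr (q j - p - 1) *\<^sub>R iexp (y j * s))) \<le> norm (b j) * (D j * S powr e j)"
        unfolding norm_mult using S by (intro mult_left_mono osc) auto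
    qed
  qed
qed

text \<open>For large \<open>B\<close> the limit controls the primitive, for all smaller
  \<open>B\<close> the absolute integral up to a fixed point does. This bound becomes the majorant
  under the expectation.\<close>

lemma kernel_integral_bounded:
  assumes "((\<lambda>B. LBINT s:{0<..<B}. s powr (- p - 1) *\<^sub>R k s) \<longlongrightarrow> c) at_top"
  shows "\<exists>D. \<forall>B. norm (LBINT s:{0<..<B}. s powr (- p - 1) *\<^sub>R k s) \<le> D"
proof -
  let ?K = "\<lambda>B. LBINT s:{0<..<B}. s powr (- p - 1) *\<^sub>R k s"
  have "\<forall>\<^sub>F B in at_top. dist (?K B) c < 1" using assms by (rule tendstoD) simp
  then obtain B1 where B1: "\<And>B. B \<ge> B1 \<Longrightarrow> dist (?K B) c < 1"
    by (auto simp: eventually_at_top_linorder)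
  define D1 where "D1 = (LBINT s:{0<..<B1}. norm (s powr (- p - 1) *\<^sub>R k s))"
  have "norm (?K B) \<le> max D1 (norm c + 1)" for B
  proof (cases "B \<ge> B1")
    case True
    have "norm (?K B) \<le> norm c + dist (?K B) c" by (simp add: dist_norm norm_triangle_sub)
    then show ?thesis using B1[OF True] by simp
  next
    case False
    have "norm (?K B) \<le> (LBINT s:{0<..<B}. norm (s powr (- p - 1) *\<^sub>R k s))"
      by (rule set_integral_norm_bound[OF kernel_set_integrable])
    also have "\<dots> \<le> D1"
      unfolding D1_def set_lebesgue_integral_def
      using set_integrable_norm[OF kernel_set_integrable] False
      by (intro integral_mono) (auto simp: set_integrable_def indicator_def)
    finally show ?thesis by simp
  qed
  then show ?thesis by blast
qed

lemma kernel_abs_integrable: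
  assumes "\<And>j. j \<in> J \<Longrightarrow> q j < p"
  shows "set_integrable lborel {0<..} (\<lambda>s. s powr (- p - 1) *\<^sub>R k s)"
proof -
  have "set_integrable lborel {d/2<..} (\<lambda>s. s powr (- p - 1) *\<^sub>R k s)"
  proof (rule set_integrable_bound)
    show "set_integrable lborel {d/2<..} (\<lambda>s. \<Sum>j\<in>J. norm (b j) * s powr (q j - p - 1))"
    proof -
      have "set_integrable lborel {d/2<..} (\<lambda>s. norm (b j) * s powr (q j - p - 1))" if "j \<in> J" for j
        using assms[OF that] d by (intro set_integrable_mult_right set_integrable_powr_to_infinity) auto
      then show ?thesis
        unfolding set_integrable_def scaleR_sum_right by (intro Bochner_Integration.integrable_sum)
    qed
    show "AE s in lborel. s \<in> {d/2<..} \<longrightarrow> norm (s powr (- p - 1) *\<^sub>R k s) \<le>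
        norm (\<Sum>j\<in>J. norm (b j) * s powr (q j - p - 1))"
      using kernel_norm_le d by (intro AE_I2) (force intro: order_trans[OF _ abs_ge_self])
  qed (auto simp: set_borel_measurable_def)
  then have "set_integrable lborel ({0<..<d} \<union> {d/2<..}) (\<lambda>s. s powr (- p - 1) *\<^sub>R k s)"
    by (intro set_integrable_Un kernel_set_integrable) auto
  moreover have "{0<..<d} \<union> {d/2<..} = {0<..}" using d by auto
  ultimately show ?thesis by simp
qed

text \<open>Beyond 1 every term is dominated by the highest power, whose primitive is
  \<open>B powr (Q - p) / (Q - p)\<close>; strictness of \<open>Q > p\<close> excludes a logarithm.
  Evaluated at \<open>B = T * \<bar>x\<bar>\<close>, the bound calls only for moments of orders
  \<open>r + p\<close> and \<open>r + Q\<close>.\<close>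

lemma kernel_abs_integral_le:
  assumes Q: "Q > p" "\<And>j. j \<in> J \<Longrightarrow> q j \<le> Q"
  shows "\<exists>D\<ge>0. \<forall>B. (LBINT s:{0<..<B}. norm (s powr (- p - 1) *\<^sub>R k s)) \<le> D * (1 + B powr (Q - p))"
proof -
  define D1 where "D1 = (LBINT s:{0<..<1}. norm (s powr (- p - 1) *\<^sub>R k s))"
  define b1 where "b1 = (\<Sum>j\<in>J. norm (b j))"
  have "D1 \<ge> 0" "b1 \<ge> 0"
    unfolding D1_def b1_def set_lebesgue_integral_def by (auto intro!: sum_nonneg integral_nonneg_AE)
  have b1: "norm (s powr (- p - 1) *\<^sub>R k s) \<le> b1 * s powr (Q - p - 1)" if "s \<ge> 1" for s
  proof -
    have "norm (s powr (- p - 1) *\<^sub>R k s) \<le> (\<Sum>j\<in>J. norm (b j) * s powr (q j - p - 1))"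
      using that by (intro kernel_norm_le) auto
    also have "\<dots> \<le> (\<Sum>j\<in>J. norm (b j) * s powr (Q - p - 1))"
      using that Q(2) by (intro sum_mono mult_left_mono powr_mono) auto
    finally show ?thesis by (simp add: b1_def sum_distrib_right)
  qed
  have i: "set_integrable lborel {0<..<B} (\<lambda>s. norm (s powr (- p - 1) *\<^sub>R k s))" for B
    by (rule set_integrable_norm[OF kernel_set_integrable])
  have "(LBINT s:{0<..<B}. norm (s powr (- p - 1) *\<^sub>R k s)) \<le> (D1 + b1 / (Q - p)) * (1 + B powr (Q - p))" for B
  proof (cases "B > 0")
    case True
    have iQ: "set_integrable lborel {0<..<B} (\<lambda>s. b1 * s powr (Q - p - 1))"
      and IQ: "(LBINT s:{0<..<B}. b1 * s powr (Q - p - 1)) = b1 * (B powr (Q - p) / (Q - p))"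
      using set_integral_powr_from_0[of "Q - p - 1" B] Q(1) True by auto
    \<comment> \<open>The power is kept on all of \<open>(0, B)\<close>, not just beyond 1, so that
      one formula serves every positive \<open>B\<close>.\<close>
    have "(LBINT s:{0<..<B}. norm (s powr (- p - 1) *\<^sub>R k s)) \<le>
        (\<integral>s. indicator {0<..<1} s *\<^sub>R norm (s powr (- p - 1) *\<^sub>R k s) + indicator {0<..<B} s *\<^sub>R (b1 * s powr (Q - p - 1)) \<partial>lborel)"
      unfolding set_lebesgue_integral_def
    proof (rule integral_mono)
      fix s :: real
      show "indicator {0<..<B} s *\<^sub>R norm (s powr (- p - 1) *\<^sub>R k s) \<le>
        indicator {0<..<1} s *\<^sub>R norm (s powr (- p - 1) *\<^sub>R k s) + indicator {0<..<B} s *\<^sub>R (b1 * s powr (Q - p - 1))"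
        using b1[of s] \<open>b1 \<ge> 0\<close> by (cases "s < 1") (auto simp: indicator_def)
    qed (use i[of B] i[of 1] iQ in \<open>auto simp: set_integrable_def\<close>)
    also have "\<dots> = D1 + b1 * (B powr (Q - p) / (Q - p))"
      unfolding IQ[symmetric] D1_def set_lebesgue_integral_def
      using i[of 1] iQ by (intro Bochner_Integration.integral_add) (auto simp: set_integrable_def)
    also have "\<dots> \<le> (D1 + b1 / (Q - p)) * (1 + B powr (Q - p))"
      using \<open>D1 \<ge> 0\<close> \<open>b1 \<ge> 0\<close> Q(1) by (simp add: algebra_simps)
    finally show ?thesis .
  next
    case False
    then have "{0<..<B} = {}" by auto
    then show ?thesis
      using \<open>D1 \<ge> 0\<close> \<open>b1 \<ge> 0\<close> Q(1) by (simp add: set_lebesgue_integral_def)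
  qed
  then show ?thesis
    using \<open>D1 \<ge> 0\<close> \<open>b1 \<ge> 0\<close> Q(1) by (intro exI[of _ "D1 + b1 / (Q - p)"]) auto
qed

end

subsection \<open>Averages of a scaled kernel\<close>

lemma set_integral_powr_scale_Ioo:
  fixes f :: "real \<Rightarrow> 'a::{banach, second_countable_topology}"
  assumes c: "c > 0"
  shows "set_integrable lborel {0<..<T} (\<lambda>t. t powr s *\<^sub>R f (c * t)) \<longleftrightarrow>
           set_integrable lborel {0<..<c * T} (\<lambda>t. t powr s *\<^sub>R f t)"
    and "(LBINT t:{0<..<T}. t powr s *\<^sub>R f (c * t)) =
           c powr (- s - 1) *\<^sub>R (LBINT t:{0<..<c * T}. t powr s *\<^sub>R f t)"
proof -
  \<comment> \<open>Cutting \<open>f\<close> off at \<open>c * T\<close> reduces the bounded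
    interval to the half-line.\<close>
  define h where "h = (\<lambda>u. indicator {..<c * T} u *\<^sub>R f u)"
  have 1: "indicator {0<..<T} t *\<^sub>R (t powr s *\<^sub>R f (c * t)) = indicator {0<..} t *\<^sub>R (t powr s *\<^sub>R h (c * t))" for t
    using c by (auto simp: h_def indicator_def)
  have 2: "indicator {0<..<c * T} t *\<^sub>R (t powr s *\<^sub>R f t) = indicator {0<..} t *\<^sub>R (t powr s *\<^sub>R h t)" for t
    by (auto simp: h_def indicator_def)
  show "set_integrable lborel {0<..<T} (\<lambda>t. t powr s *\<^sub>R f (c * t)) \<longleftrightarrow>
           set_integrable lborel {0<..<c * T} (\<lambda>t. t powr s *\<^sub>R f t)"
    using set_integral_powr_scale(1)[OF c, of s h] unfolding set_integrable_def 1 2 .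
  show "(LBINT t:{0<..<T}. t powr s *\<^sub>R f (c * t)) =
           c powr (- s - 1) *\<^sub>R (LBINT t:{0<..<c * T}. t powr s *\<^sub>R f t)"
    using set_integral_powr_scale(2)[OF c, of s h] unfolding set_lebesgue_integral_def 1 2 .
qed

lemma tendsto_set_integral_Ioo_at_right_0:
  fixes f :: "real \<Rightarrow> 'a::{banach, second_countable_topology}"
  assumes f: "set_integrable lborel {0<..<b} f" and b: "b > 0"
  shows "((\<lambda>e. LBINT v:{0<..<e}. f v) \<longlongrightarrow> 0) (at_right 0)"
proof (rule tendsto_at_right_sequentially[OF b])
  fix S :: "nat \<Rightarrow> real" assume S: "\<And>n. 0 < S n" "\<And>n. S n < b" "S \<longlonglongrightarrow> 0"
  have "(\<lambda>n. LBINT v:{0<..<S n}. f v) \<longlonglongrightarrow> (\<integral>v. 0 \<partial>(lborel :: real measure))"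
    unfolding set_lebesgue_integral_def
  proof (rule integral_dominated_convergence[where w="\<lambda>v. norm (indicator {0<..<b} v *\<^sub>R f v)"])
    show "integrable lborel (\<lambda>v. norm (indicator {0<..<b} v *\<^sub>R f v))"
      using f unfolding set_integrable_def by (rule integrable_norm)
    show "(\<lambda>v. indicator {0<..<S n} v *\<^sub>R f v) \<in> borel_measurable lborel" for n
      using borel_measurable_integrable[OF set_integrable_subset[OF f, of "{0<..<S n}", unfolded set_integrable_def]] S(2)[of n]
      by (auto simp: subset_eq intro: less_trans)
    show "AE v in lborel. (\<lambda>n. indicator {0<..<S n} v *\<^sub>R f v) \<longlonglongrightarrow> 0"
    proof (intro AE_I2)
      fix v :: real
      show "(\<lambda>n. indicator {0<..<S n} v *\<^sub>R f v) \<longlonglongrightarrow> 0"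
      proof (cases "v > 0")
        case True
        show ?thesis
          by (rule tendsto_eventually, use order_tendstoD(2)[OF S(3) True] in eventually_elim)
             (auto simp: indicator_def)
      qed simp
    qed
    show "AE v in lborel. norm (indicator {0<..<S n} v *\<^sub>R f v) \<le> norm (indicator {0<..<b} v *\<^sub>R f v)" for n
      using S(2)[of n] by (intro AE_I2) (auto simp: indicator_def)
  qed simp
  then show "(\<lambda>n. LBINT v:{0<..<S n}. f v) \<longlonglongrightarrow> 0" by simp
qed

text \<open>This separates the probabilistic half of the argument from the analysis of
  \<open>g\<close>: what is assumed of the kernel is a power bound and a primitive that vanishes at
  0, is bounded, and converges to \<open>c \<sigma>\<close> at infinity.\<close>

locale scaled_kernel_average = real_distribution +
  fixes J :: "'j set" and A q :: "'j \<Rightarrow> real" and r p D :: real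
    and W g :: "real \<Rightarrow> complex" and c :: "real \<Rightarrow> complex"
  assumes fin: "finite J"
    and q: "\<And>j. j \<in> J \<Longrightarrow> q j \<ge> 0" and A: "\<And>j. j \<in> J \<Longrightarrow> A j \<ge> 0"
    and W_meas [measurable]: "W \<in> borel_measurable borel"
    and g_meas [measurable]: "g \<in> borel_measurable borel"
    and norm_W: "\<And>x. norm (W x) = \<bar>x\<bar> powr r"
    and norm_g: "\<And>x. norm (g x) \<le> (\<Sum>j\<in>J. A j * \<bar>x\<bar> powr q j)"
    and moment_q: "\<And>j. j \<in> J \<Longrightarrow> integrable M (\<lambda>x. \<bar>x\<bar> powr (r + q j))"
    and moment_p: "integrable M (\<lambda>x. \<bar>x\<bar> powr (r + p))"
    and kernel_integrable:
      "\<And>\<sigma> B. \<bar>\<sigma>\<bar> = 1 \<Longrightarrow> set_integrable lborel {0<..<B} (\<lambda>s. s powr (- p - 1) *\<^sub>R g (\<sigma> * s))"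
    and kernel_0:
      "\<And>\<sigma>. \<bar>\<sigma>\<bar> = 1 \<Longrightarrow> ((\<lambda>B. LBINT s:{0<..<B}. s powr (- p - 1) *\<^sub>R g (\<sigma> * s)) \<longlongrightarrow> 0) (at_right 0)"
    and kernel_infinity:
      "\<And>\<sigma>. \<bar>\<sigma>\<bar> = 1 \<Longrightarrow> ((\<lambda>B. LBINT s:{0<..<B}. s powr (- p - 1) *\<^sub>R g (\<sigma> * s)) \<longlongrightarrow> c \<sigma>) at_top"
    and kernel_bounded:
      "\<And>\<sigma> B. \<bar>\<sigma>\<bar> = 1 \<Longrightarrow> norm (LBINT s:{0<..<B}. s powr (- p - 1) *\<^sub>R g (\<sigma> * s)) \<le> D"
begin

definition "average t = t powr (- p - 1) *\<^sub>R (\<integral>x. W x * g (t * x) \<partial>M)"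

definition "kernel_integral \<sigma> B = (LBINT s:{0<..<B}. s powr (- p - 1) *\<^sub>R g (\<sigma> * s))"

definition "average_integral B = (\<integral>x. W x * of_real (\<bar>x\<bar> powr p) * kernel_integral (sgn x) (B * \<bar>x\<bar>) \<partial>M)"

definition "average_limit = (\<integral>x. W x * of_real (\<bar>x\<bar> powr p) * c (sgn x) \<partial>M)"

text \<open>\<open>0 powr r = 0\<close> for every \<open>r\<close>, so the point 0, where the
  scaling by \<open>\<bar>x\<bar>\<close> degenerates and the sign is 0, contributes nothing to any
  of the averages.\<close>

lemma W_0 [simp]: "W 0 = 0"
  using norm_W[of 0] by simp

text \<open>The substitution is \<open>s = t * \<bar>x\<bar>\<close> with the sign of
  \<open>x\<close> kept inside \<open>g\<close>; the exponent \<open>- p - 1\<close> of the weight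
  leaves the factor \<open>\<bar>x\<bar> powr p\<close>.\<close>

lemma kernel_scaled:
  assumes "x \<noteq> 0"
  shows "set_integrable lborel {0<..<T} (\<lambda>t. t powr (- p - 1) *\<^sub>R g (t * x))"
    and "(LBINT t:{0<..<T}. t powr (- p - 1) *\<^sub>R g (t * x)) = \<bar>x\<bar> powr p *\<^sub>R kernel_integral (sgn x) (T * \<bar>x\<bar>)"
    and "(LBINT t:{0<..<T}. norm (t powr (- p - 1) *\<^sub>R g (t * x))) =
           \<bar>x\<bar> powr p * (LBINT s:{0<..<T * \<bar>x\<bar>}. norm (s powr (- p - 1) *\<^sub>R g (sgn x * s)))"
proof -
  have x: "\<bar>x\<bar> > 0" "\<bar>sgn x\<bar> = 1" using assms by (auto simp: sgn_if)
  have gx: "g (t * x) = g (sgn x * (\<bar>x\<bar> * t))" for t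
    by (metis mult.commute mult.left_commute mult_sgn_abs)
  show "set_integrable lborel {0<..<T} (\<lambda>t. t powr (- p - 1) *\<^sub>R g (t * x))"
    unfolding gx set_integral_powr_scale_Ioo(1)[OF x(1), of T "- p - 1" "\<lambda>s. g (sgn x * s)"]
    by (rule kernel_integrable[OF x(2)])
  show "(LBINT t:{0<..<T}. t powr (- p - 1) *\<^sub>R g (t * x)) = \<bar>x\<bar> powr p *\<^sub>R kernel_integral (sgn x) (T * \<bar>x\<bar>)"
    unfolding gx set_integral_powr_scale_Ioo(2)[OF x(1), of T "- p - 1" "\<lambda>s. g (sgn x * s)"]
    by (simp add: kernel_integral_def mult.commute)
  show "(LBINT t:{0<..<T}. norm (t powr (- p - 1) *\<^sub>R g (t * x))) =
           \<bar>x\<bar> powr p * (LBINT s:{0<..<T * \<bar>x\<bar>}. norm (s powr (- p - 1) *\<^sub>R g (sgn x * s)))"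
    using set_integral_powr_scale_Ioo(2)[OF x(1), of T "- p - 1" "\<lambda>s. norm (g (sgn x * s))"]
    by (simp add: gx mult.commute)
qed

lemma kernel_scaled_infinite:
  assumes "x \<noteq> 0" and i: "set_integrable lborel {0<..} (\<lambda>s. s powr (- p - 1) *\<^sub>R g (sgn x * s))"
  shows "set_integrable lborel {0<..} (\<lambda>t. t powr (- p - 1) *\<^sub>R g (t * x))"
    and "(LBINT t:{0<..}. norm (t powr (- p - 1) *\<^sub>R g (t * x))) =
           \<bar>x\<bar> powr p * (LBINT s:{0<..}. norm (s powr (- p - 1) *\<^sub>R g (sgn x * s)))"
proof -
  have x: "\<bar>x\<bar> > 0" using assms by auto
  have gx: "g (t * x) = g (sgn x * (\<bar>x\<bar> * t))" for t
    by (metis mult.commute mult.left_commute mult_sgn_abs)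
  show "set_integrable lborel {0<..} (\<lambda>t. t powr (- p - 1) *\<^sub>R g (t * x))"
    unfolding gx set_integral_powr_scale(1)[OF x(1), of "- p - 1" "\<lambda>s. g (sgn x * s)"] by (rule i)
  show "(LBINT t:{0<..}. norm (t powr (- p - 1) *\<^sub>R g (t * x))) =
           \<bar>x\<bar> powr p * (LBINT s:{0<..}. norm (s powr (- p - 1) *\<^sub>R g (sgn x * s)))"
    using set_integral_powr_scale(2)[OF x(1), of "- p - 1" "\<lambda>s. norm (g (sgn x * s))"]
    by (simp add: gx mult.commute)
qed

lemma kernel_integral_measurable [measurable]: "kernel_integral \<sigma> \<in> borel_measurable borel"
  \<comment> \<open>With the indicator written as a condition, the moving endpoint becomes an
    ordinary measurable parameter.\<close>
  unfolding kernel_integral_def set_lebesgue_integral_def indicator_def greaterThanLessThan_iff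
  by measurable

lemma kernel_integral_sgn_measurable [measurable]:
  "(\<lambda>x. kernel_integral (sgn x) (B * \<bar>x\<bar>)) \<in> borel_measurable borel"
proof -
  \<comment> \<open>The sign takes three values, so measurability in \<open>x\<close> reduces to
    that of finitely many fixed kernels.\<close>
  have "(\<lambda>x. kernel_integral (sgn x) (B * \<bar>x\<bar>)) =
      (\<lambda>x. if x > 0 then kernel_integral 1 (B * \<bar>x\<bar>) else if x < 0 then kernel_integral (-1) (B * \<bar>x\<bar>)
         else kernel_integral 0 0)"
    by (auto simp: fun_eq_iff sgn_if)
  also have "\<dots> \<in> borel_measurable borel" by measurable
  finally show ?thesis .
qed

lemma average_integrand_norm_le:
  "norm (W x * of_real (\<bar>x\<bar> powr p) * kernel_integral (sgn x) B) \<le> D * \<bar>x\<bar> powr (r + p)"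
proof (cases "x = 0")
  case False
  then have "norm (kernel_integral (sgn x) B) \<le> D"
    unfolding kernel_integral_def by (intro kernel_bounded) (auto simp: sgn_if)
  then have "\<bar>x\<bar> powr (r + p) * norm (kernel_integral (sgn x) B) \<le> \<bar>x\<bar> powr (r + p) * D"
    by (intro mult_left_mono) auto
  then show ?thesis by (simp add: norm_mult norm_W powr_add mult_ac)
qed simp

lemma average_integrand_integrable:
  "integrable M (\<lambda>x. W x * of_real (\<bar>x\<bar> powr p) * kernel_integral (sgn x) (B * \<bar>x\<bar>))"
proof (rule Bochner_Integration.integrable_bound)
  show "integrable M (\<lambda>x. D * \<bar>x\<bar> powr (r + p))" using moment_p by simp
  show "AE x in M. norm (W x * of_real (\<bar>x\<bar> powr p) * kernel_integral (sgn x) (B * \<bar>x\<bar>)) \<le> norm (D * \<bar>x\<bar> powr (r + p))"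
    by (intro AE_I2 order_trans[OF average_integrand_norm_le]) simp
qed measurable

text \<open>On a compact interval away from 0 the integrand is dominated by a function of
  \<open>t\<close> times a function of \<open>x\<close>: since \<open>q j \<ge> 0\<close>, each
  \<open>t powr q j\<close> is at most \<open>T powr q j\<close>. Fubini then turns the integral
  into a difference of scaled primitives.\<close>

lemma average_set_integrable_Icc:
  assumes eT: "0 < e" "e \<le> T"
  shows "set_integrable lborel {e..T} average"
    and "(LBINT t:{e..T}. average t) = average_integral T - average_integral e"
proof -
  define F where "F = (\<lambda>t x. indicator {e..T} t *\<^sub>R t powr (- p - 1) *\<^sub>R (W x * g (t * x)))"
  define h where "h = (\<lambda>t. indicator {e..T} t *\<^sub>R t powr (- p - 1))"
  define k where "k = (\<lambda>x. \<Sum>j\<in>J. A j * T powr q j * \<bar>x\<bar> powr (r + q j))"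
  have sf: "sigma_finite_measure (lborel :: real measure)" "sigma_finite_measure M"
    by (auto intro: sigma_finite_lborel sigma_finite_measure_axioms)
  have h: "integrable lborel h"
    unfolding h_def set_integrable_def[symmetric] using eT
    by (intro borel_integrable_atLeastAtMost') (auto intro!: continuous_intros)
  have k: "integrable M k"
    unfolding k_def using moment_q by auto
  have Fm: "case_prod F \<in> borel_measurable (lborel \<Otimes>\<^sub>M M)"
    unfolding F_def by measurable
  have le: "norm (F t x) \<le> h t * k x" for t x
  proof (cases "t \<in> {e..T}")
    case True
    then have t: "0 < t" "t \<le> T" using eT by auto
    have "norm (W x * g (t * x)) \<le> \<bar>x\<bar> powr r * (\<Sum>j\<in>J. A j * \<bar>t * x\<bar> powr q j)"
      unfolding norm_mult norm_W using norm_g by (intro mult_left_mono) auto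
    also have "\<dots> \<le> \<bar>x\<bar> powr r * (\<Sum>j\<in>J. A j * (T powr q j * \<bar>x\<bar> powr q j))"
    proof (intro mult_left_mono sum_mono)
      fix j assume j: "j \<in> J"
      show "\<bar>t * x\<bar> powr q j \<le> T powr q j * \<bar>x\<bar> powr q j"
        using t q[OF j] by (auto simp: abs_mult powr_mult intro!: mult_right_mono powr_mono2)
    qed (use A in auto)
    also have "\<dots> = k x"
      unfolding k_def sum_distrib_left by (intro sum.cong refl) (simp add: powr_add mult_ac)
    finally have "t powr (- p - 1) * norm (W x * g (t * x)) \<le> t powr (- p - 1) * k x"
      by (intro mult_left_mono) auto
    then show ?thesis using True unfolding F_def h_def norm_scaleR by simp
  qed (simp add: F_def h_def)
  interpret P: pair_sigma_finite "lborel :: real measure" M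
    using sf by (rule pair_sigma_finite.intro)
  have int: "integrable (lborel \<Otimes>\<^sub>M M) (case_prod F)"
    by (rule integrable_bounded_by_product[OF sf h k Fm le])
  have eq: "indicator {e..T} t *\<^sub>R average t = (\<integral>x. F t x \<partial>M)" for t
    unfolding F_def integral_scaleR_right average_def ..
  show "set_integrable lborel {e..T} average"
    unfolding set_integrable_def eq by (rule P.integrable_fst[OF int])
  have "(LBINT t:{e..T}. average t) = (\<integral>x. (\<integral>t. F t x \<partial>lborel) \<partial>M)"
    unfolding set_lebesgue_integral_def eq by (rule P.Fubini_integral[OF int, symmetric])
  also have "\<dots> = (\<integral>x. W x * of_real (\<bar>x\<bar> powr p) * kernel_integral (sgn x) (T * \<bar>x\<bar>)
      - W x * of_real (\<bar>x\<bar> powr p) * kernel_integral (sgn x) (e * \<bar>x\<bar>) \<partial>M)"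
  proof (intro Bochner_Integration.integral_cong refl)
    fix x
    show "(\<integral>t. F t x \<partial>lborel) = W x * of_real (\<bar>x\<bar> powr p) * kernel_integral (sgn x) (T * \<bar>x\<bar>)
      - W x * of_real (\<bar>x\<bar> powr p) * kernel_integral (sgn x) (e * \<bar>x\<bar>)"
    proof (cases "x = 0")
      case False
      have "(\<integral>t. F t x \<partial>lborel) = (\<integral>t. W x * (indicator {e..T} t *\<^sub>R t powr (- p - 1) *\<^sub>R g (t * x)) \<partial>lborel)"
        unfolding F_def by (simp only: mult_scaleR_right)
      also have "\<dots> = W x * (LBINT t:{e..T}. t powr (- p - 1) *\<^sub>R g (t * x))"
        unfolding set_lebesgue_integral_def by (rule integral_mult_right_zero)
      also have "(LBINT t:{e..T}. t powr (- p - 1) *\<^sub>R g (t * x)) =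
          \<bar>x\<bar> powr p *\<^sub>R kernel_integral (sgn x) (T * \<bar>x\<bar>) - \<bar>x\<bar> powr p *\<^sub>R kernel_integral (sgn x) (e * \<bar>x\<bar>)"
        using set_integral_Ioo_split(1)[OF kernel_scaled(1)[OF False] eT] kernel_scaled(2)[OF False] by simp
      finally show ?thesis by (simp add: scaleR_conv_of_real algebra_simps)
    qed (simp add: F_def)
  qed
  also have "\<dots> = average_integral T - average_integral e"
    unfolding average_integral_def by (intro Bochner_Integration.integral_diff average_integrand_integrable)
  finally show "(LBINT t:{e..T}. average t) = average_integral T - average_integral e" .
qed

lemma sgn_measurable_compose: "(\<lambda>x. c (sgn x)) \<in> borel_measurable borel"
proof -
  have "(\<lambda>x. c (sgn x)) = (\<lambda>x. if x > 0 then c 1 else if x < 0 then c (-1) else c 0)"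
    by (auto simp: fun_eq_iff sgn_if)
  then show ?thesis by simp
qed

lemma average_integral_tendsto_0: "(average_integral \<longlongrightarrow> 0) (at_right 0)"
proof (rule tendsto_at_right_sequentially[of _ 1])
  fix S :: "nat \<Rightarrow> real" assume S: "\<And>n. 0 < S n" "S \<longlonglongrightarrow> 0"
  have "(\<lambda>n. average_integral (S n)) \<longlonglongrightarrow> (\<integral>x. 0 \<partial>M)"
    unfolding average_integral_def
  proof (rule integral_dominated_convergence[where w="\<lambda>x. D * \<bar>x\<bar> powr (r + p)"])
    show "AE x in M. (\<lambda>n. W x * of_real (\<bar>x\<bar> powr p) * kernel_integral (sgn x) (S n * \<bar>x\<bar>)) \<longlonglongrightarrow> 0"
    proof (intro AE_I2)
      fix x :: real
      show "(\<lambda>n. W x * of_real (\<bar>x\<bar> powr p) * kernel_integral (sgn x) (S n * \<bar>x\<bar>)) \<longlonglongrightarrow> 0"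
      proof (cases "x = 0")
        case False
        have "filterlim (\<lambda>n. S n * \<bar>x\<bar>) (at_right 0) sequentially"
          unfolding filterlim_at using S False
          by (auto simp: less_imp_neq[symmetric] intro!: always_eventually tendsto_eq_intros)
        moreover have "(kernel_integral (sgn x) \<longlongrightarrow> 0) (at_right 0)"
          unfolding kernel_integral_def using False by (intro kernel_0) (auto simp: sgn_if)
        ultimately have "(\<lambda>n. kernel_integral (sgn x) (S n * \<bar>x\<bar>)) \<longlonglongrightarrow> 0"
          by (rule filterlim_compose[rotated])
        then show ?thesis by (rule tendsto_mult_right_zero)
      qed simp
    qed
  qed (use average_integrand_integrable average_integrand_norm_le moment_p in auto)
  then show "(\<lambda>n. average_integral (S n)) \<longlonglongrightarrow> 0" by simp
qed simp

lemma average_integral_tendsto_limit: "(average_integral \<longlongrightarrow> average_limit) at_top"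
  unfolding average_integral_def average_limit_def
proof (rule integral_dominated_convergence_at_top[where w="\<lambda>x. D * \<bar>x\<bar> powr (r + p)"])
  show "AE x in M. ((\<lambda>B. W x * of_real (\<bar>x\<bar> powr p) * kernel_integral (sgn x) (B * \<bar>x\<bar>)) \<longlongrightarrow>
          W x * of_real (\<bar>x\<bar> powr p) * c (sgn x)) at_top"
  proof (intro AE_I2)
    fix x :: real
    show "((\<lambda>B. W x * of_real (\<bar>x\<bar> powr p) * kernel_integral (sgn x) (B * \<bar>x\<bar>)) \<longlongrightarrow>
          W x * of_real (\<bar>x\<bar> powr p) * c (sgn x)) at_top"
    proof (cases "x = 0")
      case False
      have "filterlim (\<lambda>B. B * \<bar>x\<bar>) at_top at_top"
        using False by (intro filterlim_at_top_mult_tendsto_pos[OF tendsto_const _ filterlim_ident]) auto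
      moreover have "(kernel_integral (sgn x) \<longlongrightarrow> c (sgn x)) at_top"
        unfolding kernel_integral_def using False by (intro kernel_infinity) (auto simp: sgn_if)
      ultimately have "((\<lambda>B. kernel_integral (sgn x) (B * \<bar>x\<bar>)) \<longlongrightarrow> c (sgn x)) at_top"
        by (rule filterlim_compose[rotated])
      then show ?thesis by (intro tendsto_intros)
    qed simp
  qed
  show "\<forall>\<^sub>F B in at_top. AE x in M. norm (W x * of_real (\<bar>x\<bar> powr p) * kernel_integral (sgn x) (B * \<bar>x\<bar>))
      \<le> D * \<bar>x\<bar> powr (r + p)"
    using average_integrand_norm_le by (intro always_eventually allI AE_I2) auto
qed (use moment_p sgn_measurable_compose in auto)

text \<open>Here the absolute integral over \<open>t\<close> comes first and its bound
  \<open>H x\<close> is averaged afterwards. On sets reaching 0 or infinity the substitution links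
  \<open>t\<close> and \<open>x\<close>, and a product majorant is no longer at hand.\<close>

lemma average_set_integrable:
  assumes S: "S \<in> sets borel" "S \<subseteq> {0<..}"
    and i: "\<And>x. x \<noteq> 0 \<Longrightarrow> set_integrable lborel S (\<lambda>t. t powr (- p - 1) *\<^sub>R g (t * x))"
    and H: "\<And>x. x \<noteq> 0 \<Longrightarrow> (LBINT t:S. norm (t powr (- p - 1) *\<^sub>R g (t * x))) \<le> H x"
    and iH: "integrable M (\<lambda>x. \<bar>x\<bar> powr r * H x)"
  shows "set_integrable lborel S average"
proof -
  have [measurable]: "S \<in> sets lborel" using S by simp
  define F where "F = (\<lambda>x t. indicator S t *\<^sub>R t powr (- p - 1) *\<^sub>R (W x * g (t * x)))"
  interpret P: pair_sigma_finite M lborel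
    by (simp add: pair_sigma_finite_def sigma_finite_lborel sigma_finite_measure_axioms)
  have Fm [measurable]: "case_prod F \<in> borel_measurable (M \<Otimes>\<^sub>M lborel)"
    unfolding F_def by measurable
  have F_eq: "F x t = W x * (indicator S t *\<^sub>R t powr (- p - 1) *\<^sub>R g (t * x))" for x t
    by (simp add: F_def)
  have nF: "norm (F x t) = \<bar>x\<bar> powr r * (indicator S t *\<^sub>R norm (t powr (- p - 1) *\<^sub>R g (t * x)))" for x t
    unfolding F_eq norm_mult norm_W norm_scaleR by simp
  have int: "integrable (M \<Otimes>\<^sub>M lborel) (case_prod F)"
  proof (rule P.Fubini_integrable[OF Fm])
    have m: "(\<lambda>x. \<integral>t. norm (F x t) \<partial>lborel) \<in> borel_measurable M" by measurable
    show "integrable M (\<lambda>x. \<integral>t. norm (case (x, t) of (x, t) \<Rightarrow> F x t) \<partial>lborel)"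
    proof (rule Bochner_Integration.integrable_bound[OF iH])
      show "AE x in M. norm (\<integral>t. norm (case (x, t) of (x, t) \<Rightarrow> F x t) \<partial>lborel) \<le> norm (\<bar>x\<bar> powr r * H x)"
      proof (intro AE_I2)
        fix x
        show "norm (\<integral>t. norm (case (x, t) of (x, t) \<Rightarrow> F x t) \<partial>lborel) \<le> norm (\<bar>x\<bar> powr r * H x)"
        proof (cases "x = 0")
          case False
          have "(\<integral>t. norm (F x t) \<partial>lborel) = \<bar>x\<bar> powr r * (LBINT t:S. norm (t powr (- p - 1) *\<^sub>R g (t * x)))"
            unfolding nF set_lebesgue_integral_def by (rule integral_mult_right_zero)
          also have "\<dots> \<le> \<bar>x\<bar> powr r * H x"
            by (intro mult_left_mono H False) auto
          finally show ?thesis by (simp add: integral_nonneg_AE)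
        qed (simp add: F_def)
      qed
    qed (use m in simp)
    show "AE x in M. integrable lborel (\<lambda>t. case (x, t) of (x, t) \<Rightarrow> F x t)"
    proof (intro AE_I2)
      fix x
      show "integrable lborel (\<lambda>t. case (x, t) of (x, t) \<Rightarrow> F x t)"
      proof (cases "x = 0")
        case False
        then show ?thesis
          using i[OF False] unfolding F_eq set_integrable_def prod.case by (intro integrable_mult_right)
      qed (simp add: F_def)
    qed
  qed
  have eq: "indicator S t *\<^sub>R average t = (\<integral>x. F x t \<partial>M)" for t
    unfolding F_def integral_scaleR_right average_def ..
  show ?thesis
    unfolding set_integrable_def eq by (rule P.integrable_snd[OF int])
qed

lemma average_set_integrable_Ioi:
  assumes "\<And>\<sigma>. \<bar>\<sigma>\<bar> = 1 \<Longrightarrow> set_integrable lborel {0<..} (\<lambda>s. s powr (- p - 1) *\<^sub>R g (\<sigma> * s))"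
  shows "set_integrable lborel {0<..} average"
proof -
  define I where "I = (\<lambda>\<sigma>. LBINT s:{0<..}. norm (s powr (- p - 1) *\<^sub>R g (\<sigma> * s)))"
  show ?thesis
  proof (rule average_set_integrable)
    fix x :: real assume x: "x \<noteq> 0"
    have i: "set_integrable lborel {0<..} (\<lambda>s. s powr (- p - 1) *\<^sub>R g (sgn x * s))"
      using x by (intro assms) (auto simp: sgn_if)
    show "set_integrable lborel {0<..} (\<lambda>t. t powr (- p - 1) *\<^sub>R g (t * x))"
      by (rule kernel_scaled_infinite[OF x i])
    have "I (sgn x) \<le> max (I 1) (I (-1))" using x by (auto simp: sgn_if)
    then show "(LBINT t:{0<..}. norm (t powr (- p - 1) *\<^sub>R g (t * x))) \<le> \<bar>x\<bar> powr p * max (I 1) (I (-1))"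
      unfolding kernel_scaled_infinite(2)[OF x i] by (intro mult_left_mono) (simp only: I_def, simp)
  next
    have eq: "\<bar>x\<bar> powr r * (\<bar>x\<bar> powr p * max (I 1) (I (-1))) = \<bar>x\<bar> powr (r + p) * max (I 1) (I (-1))" for x
      by (simp add: powr_add)
    show "integrable M (\<lambda>x. \<bar>x\<bar> powr r * (\<bar>x\<bar> powr p * max (I 1) (I (-1))))"
      unfolding eq using moment_p by simp
  qed auto
qed

text \<open>Inserting the scaled bound gives \<open>\<bar>x\<bar> powr (r + p)\<close> plus a
  constant times \<open>\<bar>x\<bar> powr (r + Q)\<close>, both of finite mean.\<close>

lemma average_set_integrable_Ioo:
  assumes D': "\<And>\<sigma> B. \<bar>\<sigma>\<bar> = 1 \<Longrightarrow>
      (LBINT s:{0<..<B}. norm (s powr (- p - 1) *\<^sub>R g (\<sigma> * s))) \<le> D' * (1 + B powr (Q - p))"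
    and Q: "integrable M (\<lambda>x. \<bar>x\<bar> powr (r + Q))"
  shows "set_integrable lborel {0<..<T} average"
proof (cases "T > 0")
  case T: True
  show ?thesis
  proof (rule average_set_integrable)
    fix x :: real assume x: "x \<noteq> 0"
    show "set_integrable lborel {0<..<T} (\<lambda>t. t powr (- p - 1) *\<^sub>R g (t * x))"
      by (rule kernel_scaled(1)[OF x])
    show "(LBINT t:{0<..<T}. norm (t powr (- p - 1) *\<^sub>R g (t * x))) \<le>
        \<bar>x\<bar> powr p * (D' * (1 + (T * \<bar>x\<bar>) powr (Q - p)))"
      unfolding kernel_scaled(3)[OF x] using x by (intro mult_left_mono D') (auto simp: sgn_if)
  next
    have "\<bar>x\<bar> powr r * (\<bar>x\<bar> powr p * (D' * (1 + (T * \<bar>x\<bar>) powr (Q - p)))) =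
        D' * \<bar>x\<bar> powr (r + p) + D' * T powr (Q - p) * \<bar>x\<bar> powr (r + Q)" for x
    proof (cases "x = 0")
      case False
      have "\<bar>x\<bar> powr p * \<bar>x\<bar> powr (Q - p) = \<bar>x\<bar> powr Q" by (simp add: powr_add[symmetric])
      then show ?thesis using T by (simp add: powr_mult powr_add algebra_simps)
    qed simp
    then show "integrable M (\<lambda>x. \<bar>x\<bar> powr r * (\<bar>x\<bar> powr p * (D' * (1 + (T * \<bar>x\<bar>) powr (Q - p)))))"
      using moment_p Q by simp
  qed auto
next
  case False
  then have "{0<..<T} = {}" by auto
  then show ?thesis by (simp only: set_integrable_empty)
qed

text \<open>Both the integral over \<open>(0, e)\<close> and \<open>average_integral e\<close>
  vanish as \<open>e\<close> tends to 0, so the formula on \<open>[e, T]\<close> extends to the open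
  interval.\<close>

lemma average_integral_Ioo:
  assumes i: "set_integrable lborel {0<..<T} average" and T: "T > 0"
  shows "(LBINT t:{0<..<T}. average t) = average_integral T"
proof -
  have "((\<lambda>e. (LBINT t:{0<..<T}. average t) - (LBINT t:{0<..<e}. average t)) \<longlongrightarrow>
      (LBINT t:{0<..<T}. average t) - 0) (at_right 0)"
    by (intro tendsto_intros tendsto_set_integral_Ioo_at_right_0[OF i T])
  moreover have "\<forall>\<^sub>F e in at_right 0. (LBINT t:{0<..<T}. average t) - (LBINT t:{0<..<e}. average t) =
      average_integral T - average_integral e"
    using eventually_at_right_real[OF T]
  proof eventually_elim
    case (elim e)
    then show ?case
      using set_integral_Ioo_split(1)[OF i, of e] average_set_integrable_Icc(2)[of e T] by simp
  qed
  ultimately have "((\<lambda>e. average_integral T - average_integral e) \<longlongrightarrow> (LBINT t:{0<..<T}. average t) - 0) (at_right 0)"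
    by (rule Lim_transform_eventually)
  moreover have "((\<lambda>e. average_integral T - average_integral e) \<longlongrightarrow> average_integral T - 0) (at_right 0)"
    by (intro tendsto_intros average_integral_tendsto_0)
  ultimately have "(LBINT t:{0<..<T}. average t) - 0 = average_integral T - 0"
    by (rule tendsto_unique[rotated]) simp
  then show ?thesis by simp
qed

lemma average_improper_integral: "has_improper_integral average average_limit"
  unfolding has_improper_integral_def
proof (intro conjI allI impI)
  show "set_integrable lborel {e..T} average" if "0 < e \<and> e < T" for e T
    using that by (intro average_set_integrable_Icc) auto
  have "((\<lambda>z. average_integral (snd z) - average_integral (fst z)) \<longlongrightarrow> average_limit - 0) zero_inf"
    by (intro tendsto_diff filterlim_compose[OF average_integral_tendsto_limit filterlim_snd]
        filterlim_compose[OF average_integral_tendsto_0 filterlim_fst])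
  moreover have "\<forall>\<^sub>F z in zero_inf. average_integral (snd z) - average_integral (fst z) =
      (case z of (e, T) \<Rightarrow> LBINT t:{e..T}. average t)"
  proof -
    \<comment> \<open>Separating the two limits at 1 guarantees that the lower end lies below the
      upper one.\<close>
    have "\<forall>\<^sub>F z in zero_inf. fst z \<in> {0<..<1::real} \<and> snd z \<ge> (1::real)"
      by (intro eventually_prodI eventually_at_right_real eventually_ge_at_top) auto
    then show ?thesis
      by eventually_elim (auto simp: average_set_integrable_Icc(2) split: prod.split)
  qed
  ultimately show "((\<lambda>(e, T). LBINT t:{e..T}. average t) \<longlongrightarrow> average_limit) zero_inf"
    by (auto intro: Lim_transform_eventually)
qed

lemma average_inf_minus:
  assumes "\<And>T. set_integrable lborel {0<..<T} average"
  shows "has_integral_inf_minus average average_limit"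
  unfolding has_integral_inf_minus_def
proof (intro conjI allI impI assms)
  show "((\<lambda>T. LBINT t:{0<..<T}. average t) \<longlongrightarrow> average_limit) at_top"
    by (rule Lim_transform_eventually[OF average_integral_tendsto_limit],
        use eventually_gt_at_top[of 0] in eventually_elim)
       (simp add: average_integral_Ioo assms)
qed

end

subsection \<open>The integral formula\<close>

lemma has_improper_integral_cong:
  assumes "\<And>t. t > 0 \<Longrightarrow> F t = G t"
  shows "has_improper_integral F L \<longleftrightarrow> has_improper_integral G L"
proof -
  have i: "set_integrable lborel {e..T} F \<longleftrightarrow> set_integrable lborel {e..T} G"
    and I: "(LBINT t:{e..T}. F t) = (LBINT t:{e..T}. G t)" if "0 < e" for e T
    by (intro set_integrable_cong set_lebesgue_integral_cong refl; use assms that in auto)+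
  have "\<forall>\<^sub>F z in zero_inf. (case z of (e, T) \<Rightarrow> LBINT t:{e..T}. F t) = (case z of (e, T) \<Rightarrow> LBINT t:{e..T}. G t)"
  proof -
    have "\<forall>\<^sub>F z in zero_inf. fst z > (0::real) \<and> True"
      by (intro eventually_prodI eventually_at_right_less) auto
    then show ?thesis by eventually_elim (auto simp: I split: prod.split)
  qed
  then show ?thesis
    unfolding has_improper_integral_def using i by (simp cong: conj_cong add: tendsto_cong)
qed

lemma has_integral_inf_minus_cong:
  assumes "\<And>t. t > 0 \<Longrightarrow> F t = G t"
  shows "has_integral_inf_minus F L \<longleftrightarrow> has_integral_inf_minus G L"
proof -
  have "set_integrable lborel {0<..<T} F \<longleftrightarrow> set_integrable lborel {0<..<T} G"
    and "(LBINT t:{0<..<T}. F t) = (LBINT t:{0<..<T}. G t)" for T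
    by (intro set_integrable_cong set_lebesgue_integral_cong refl; use assms in auto)+
  then show ?thesis unfolding has_integral_inf_minus_def by simp
qed

lemma zero_inf_neq_bot [simp]: "zero_inf \<noteq> bot"
  by (simp add: prod_filter_eq_bot)

section \<open>Moments, phases and the atom at zero\<close>

text \<open>\<open>powr\<close> is 0 at 0 for every exponent and thus never exceeds
  \<open>abs_pow\<close>. For a negative order the latter is infinite at 0, so a finite moment rules
  out an atom there.\<close>

lemma abs_moment_finite:
  assumes "prob_space M" and X [measurable]: "X \<in> borel_measurable M" and fin: "abs_moment M X s < \<infinity>"
  shows "integrable (distr M borel X) (\<lambda>x. \<bar>x\<bar> powr s)"
    and "s < 0 \<Longrightarrow> AE x in distr M borel X. x \<noteq> 0"
proof -
  have [measurable]: "(\<lambda>x. abs_pow x s) \<in> borel_measurable borel"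
    unfolding abs_pow_def by measurable
  have fin': "(\<integral>\<^sup>+x. abs_pow x s \<partial>distr M borel X) < \<infinity>"
    using fin by (simp add: abs_moment_def nn_integral_distr)
  have le: "ennreal (norm (\<bar>x\<bar> powr s)) \<le> abs_pow x s" for x
    by (auto simp: abs_pow_def)
  show "integrable (distr M borel X) (\<lambda>x. \<bar>x\<bar> powr s)"
    using le_less_trans[OF nn_integral_mono[OF le] fin'] by (intro integrableI_bounded) auto
  assume "s < 0"
  have "AE x in distr M borel X. abs_pow x s \<noteq> \<infinity>"
    using fin' by (intro nn_integral_noteq_infinite) auto
  then show "AE x in distr M borel X. x \<noteq> 0"
    by eventually_elim (use \<open>s < 0\<close> in \<open>auto simp: abs_pow_def\<close>)
qed

text \<open>The angles on the left are \<open>- pi * s / 2\<close> and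
  \<open>pi * (r + s) / 2 * sgn x\<close>. For \<open>x > 0\<close> they add up to
  \<open>pi * r / 2\<close>; for \<open>x < 0\<close> the same angle remains together with
  \<open>- pi * r\<close> and \<open>- pi * s\<close>. The last one is the conjugated phase of a
  negative base, which explains the conjugate in \<open>g\<close>; the other is the factor in front
  of \<open>c_minus\<close>.\<close>

lemma fractional_phase_identity:
  fixes t x r s :: real
  assumes "t > 0"
  shows "(- \<i> * of_real t) powr of_real s * (\<i> * of_real x) powr of_real (r + s) =
     \<i> powr of_real r * (if x < 0 then exp (- \<i> * of_real (pi * r)) else 1) * of_real (\<bar>x\<bar> powr r)
       * cnj (of_real (t * x) powr of_real s)"
proof -
  have t: "(- \<i> * of_real t) powr of_real s = of_real (t powr s) * cis (- (pi / 2 * s))"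
    using powr_ii_times[of "- t" s] assms by simp
  have ii: "\<i> powr of_real r = cis (pi / 2 * r)"
    using powr_ii_times[of 1 r] by simp
  have e: "exp (- \<i> * of_real (pi * r)) = cis (- (pi * r))"
    by (simp add: cis_conv_exp)
  consider "x = 0" | "x > 0" | "x < 0" by linarith
  then show ?thesis
  proof cases
    case 2
    have c: "cis (- (pi / 2 * s)) * cis (pi / 2 * (r + s) * sgn x) = cis (pi / 2 * r)"
      using 2 unfolding cis_mult by (intro arg_cong[of _ _ cis]) (simp add: field_simps)
    have "t * x > 0" using 2 assms by simp
    then have "cnj (of_real (t * x) powr of_real s) = of_real (t powr s * \<bar>x\<bar> powr s)"
      unfolding powr_of_real_eq using assms by (simp add: powr_mult abs_mult)
    then show ?thesis
      unfolding t ii e powr_ii_times using 2 c by (simp add: powr_add)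
  next
    case 3
    have c: "cis (- (pi / 2 * s)) * cis (pi / 2 * (r + s) * sgn x) = cis (pi / 2 * r) * cis (- (pi * r)) * cis (- (pi * s))"
      using 3 unfolding cis_mult by (intro arg_cong[of _ _ cis]) (simp add: field_simps)
    have "t * x < 0" using 3 assms by (simp add: mult_pos_neg)
    then have "cnj (of_real (t * x) powr of_real s) = of_real (t powr s * \<bar>x\<bar> powr s) * cis (- (pi * s))"
      unfolding powr_of_real_eq using assms by (simp add: powr_mult abs_mult cis_cnj)
    then show ?thesis
      unfolding t ii e powr_ii_times using 3 c by (simp add: powr_add)
  qed simp
qed

text \<open>After division by \<open>s powr m\<close>, terms with \<open>q j = m\<close> tend to
  their coefficients because the exponentials tend to 1, and all others vanish. The whole sum is
  \<open>O(s powr (q0 - m))\<close>, hence also tends to 0.\<close>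

lemma sum_leading_coefficients_eq_0:
  fixes a :: "'j \<Rightarrow> complex" and q v :: "'j \<Rightarrow> real" and q0 m C d :: real
  assumes fin: "finite J" and m: "\<And>j. j \<in> J \<Longrightarrow> q j \<ge> m" and q0: "q0 > m" and d: "d > 0"
    and small: "\<And>s. 0 < s \<Longrightarrow> s < d \<Longrightarrow>
      norm (\<Sum>j\<in>J. a j * of_real (s powr q j) * iexp (v j * s)) \<le> C * s powr q0"
  shows "(\<Sum>j\<in>J. if q j = m then a j else 0) = 0"
proof -
  have "((\<lambda>s. \<Sum>j\<in>J. a j * of_real (s powr (q j - m)) * iexp (v j * s)) \<longlongrightarrow>
      (\<Sum>j\<in>J. if q j = m then a j else 0)) (at_right 0)"
  proof (rule tendsto_sum)
    fix j assume "j \<in> J"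
    have e: "((\<lambda>s. iexp (v j * s)) \<longlongrightarrow> iexp (v j * 0)) (at_right 0)"
      by (intro tendsto_intros)
    show "((\<lambda>s. a j * of_real (s powr (q j - m)) * iexp (v j * s)) \<longlongrightarrow> (if q j = m then a j else 0)) (at_right 0)"
    proof (cases "q j = m")
      case True
      have "((\<lambda>s. a j * 1 * iexp (v j * s)) \<longlongrightarrow> a j * 1 * iexp (v j * 0)) (at_right 0)"
        by (intro tendsto_mult tendsto_const e)
      moreover have "\<forall>\<^sub>F s in at_right 0. a j * 1 * iexp (v j * s) = a j * of_real (s powr (q j - m)) * iexp (v j * s)"
        using eventually_at_right_less[of 0] by eventually_elim (simp add: True)
      ultimately show ?thesis using True by (simp add: Lim_transform_eventually)
    next
      case False
      then have "q j - m > 0" using m[OF \<open>j \<in> J\<close>] by simp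
      then have "((\<lambda>s. s powr (q j - m)) \<longlongrightarrow> 0) (at_right 0)" by real_asymp
      then have "((\<lambda>s. a j * of_real (s powr (q j - m)) * iexp (v j * s)) \<longlongrightarrow> a j * of_real 0 * iexp (v j * 0)) (at_right 0)"
        by (intro tendsto_mult tendsto_of_real tendsto_const e)
      then show ?thesis using False by simp
    qed
  qed
  moreover have "((\<lambda>s. \<Sum>j\<in>J. a j * of_real (s powr (q j - m)) * iexp (v j * s)) \<longlongrightarrow> 0) (at_right 0)"
  proof (rule Lim_null_comparison)
    show "\<forall>\<^sub>F s in at_right 0. norm (\<Sum>j\<in>J. a j * of_real (s powr (q j - m)) * iexp (v j * s)) \<le> C * s powr (q0 - m)"
      using eventually_at_right_real[OF d]
    proof eventually_elim
      case (elim s)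
      then have s: "0 < s" "s < d" by auto
      have "(\<Sum>j\<in>J. a j * of_real (s powr (q j - m)) * iexp (v j * s)) =
          of_real (s powr (- m)) * (\<Sum>j\<in>J. a j * of_real (s powr q j) * iexp (v j * s))"
        unfolding sum_distrib_left
        by (intro sum.cong refl) (simp add: powr_diff powr_minus divide_inverse mult_ac)
      also have "norm \<dots> \<le> s powr (- m) * (C * s powr q0)"
        using small[OF s] by (simp add: norm_mult mult_left_mono)
      also have "\<dots> = C * s powr (q0 - m)"
        by (simp add: powr_diff powr_minus divide_inverse mult_ac)
      finally show ?case .
    qed
    have "q0 - m > 0" using q0 by simp
    then have "((\<lambda>s. s powr (q0 - m)) \<longlongrightarrow> 0) (at_right 0)" by real_asymp
    then show "((\<lambda>s. C * s powr (q0 - m)) \<longlongrightarrow> 0) (at_right 0)"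
      by (rule tendsto_mult_right_zero)
  qed
  ultimately show ?thesis
    by (rule tendsto_unique[rotated]) simp
qed

lemma (in real_distribution) lhs_integrand_char_eq:
  fixes a :: "'j \<Rightarrow> complex" and q v :: "'j \<Rightarrow> real" and p r u t :: real
  assumes fin: "finite J" and t: "t > 0"
    and moment: "\<And>j. j \<in> J \<Longrightarrow> integrable M (\<lambda>x. \<bar>x\<bar> powr (r + q j))"
    and nz: "\<And>j. j \<in> J \<Longrightarrow> r + q j < 0 \<Longrightarrow> AE x in M. x \<noteq> 0"
    and atom: "measure M {0} \<noteq> 0 \<Longrightarrow> (\<Sum>j\<in>J. if q j = - r then a j else 0) = 0"
  shows "lhs_integrand J a q v p r u (char M) t =
    t powr (- p - 1) *\<^sub>R (\<integral>x. \<i> powr of_real r * (if x < 0 then exp (- \<i> * of_real (pi * r)) else 1)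
        * of_real (\<bar>x\<bar> powr r) * iexp (u * x)
        * (\<Sum>j\<in>J. a j * cnj (of_real (t * x) powr of_real (q j)) * iexp (v j * (t * x))) \<partial>M)"
proof -
  let ?T = "\<lambda>j. (- \<i> * of_real t) powr of_real (q j)"
  let ?I = "\<lambda>j x. (\<i> * of_real x) powr of_real (r + q j) * iexp ((u + v j * t) * x)"
  have i: "integrable M (?I j)" if "j \<in> J" for j
  proof (rule Bochner_Integration.integrable_bound[OF moment[OF that]])
    show "?I j \<in> borel_measurable M" by measurable
    show "AE x in M. norm (?I j x) \<le> norm (\<bar>x\<bar> powr (r + q j))"
      unfolding norm_mult norm_exp_i_times norm_powr_ii_times by simp
  qed
  \<comment> \<open>All terms affected by the atom share the exponent \<open>q j = - r\<close>,
    hence the same power of \<open>t\<close>; their coefficients can be summed separately.\<close>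
  have "(\<Sum>j\<in>J. a j * ?T j * (if r + q j = 0 then of_real (measure M {0}) else 0)) =
      (\<Sum>j\<in>J. if q j = - r then a j else 0) * ((- \<i> * of_real t) powr of_real (- r) * of_real (measure M {0}))"
    unfolding sum_distrib_right by (intro sum.cong refl) (auto simp: add_eq_0_iff)
  also have "\<dots> = 0" using atom by auto
  finally have 0: "(\<Sum>j\<in>J. a j * ?T j * (if r + q j = 0 then of_real (measure M {0}) else 0)) = 0" .
  have "(\<Sum>j\<in>J. a j * ?T j * frac_deriv (r + q j) (char M) (u + v j * t)) =
     (\<Sum>j\<in>J. a j * ?T j * (\<integral>x. ?I j x \<partial>M) + a j * ?T j * (if r + q j = 0 then of_real (measure M {0}) else 0))"
    by (intro sum.cong refl) (simp only: frac_deriv_char[OF moment nz] distrib_left)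
  also have "\<dots> = (\<Sum>j\<in>J. a j * ?T j * (\<integral>x. ?I j x \<partial>M))"
    unfolding sum.distrib 0 by simp
  also have "\<dots> = (\<Sum>j\<in>J. (\<integral>x. a j * ?T j * ?I j x \<partial>M))"
    by simp
  also have "\<dots> = (\<integral>x. (\<Sum>j\<in>J. a j * ?T j * ?I j x) \<partial>M)"
    by (intro Bochner_Integration.integral_sum[symmetric] integrable_mult_right i)
  also have "\<dots> = (\<integral>x. \<i> powr of_real r * (if x < 0 then exp (- \<i> * of_real (pi * r)) else 1)
        * of_real (\<bar>x\<bar> powr r) * iexp (u * x)
        * (\<Sum>j\<in>J. a j * cnj (of_real (t * x) powr of_real (q j)) * iexp (v j * (t * x))) \<partial>M)"
  proof (intro Bochner_Integration.integral_cong refl)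
    fix x
    let ?P = "\<i> powr of_real r * (if x < 0 then exp (- \<i> * of_real (pi * r)) else 1) * of_real (\<bar>x\<bar> powr r)"
    have e: "iexp ((u + v j * t) * x) = iexp (u * x) * iexp (v j * (t * x))" for j
      by (simp add: exp_add[symmetric] algebra_simps)
    have "a j * ?T j * ?I j x = ?P * iexp (u * x) * (a j * cnj (of_real (t * x) powr of_real (q j)) * iexp (v j * (t * x)))" for j
    proof -
      have "a j * ?T j * ?I j x = a j * (?T j * (\<i> * of_real x) powr of_real (r + q j)) * iexp ((u + v j * t) * x)"
        by (simp only: mult_ac)
      then show ?thesis
        unfolding fractional_phase_identity[OF t] e by (simp only: mult_ac)
    qed
    then show "(\<Sum>j\<in>J. a j * ?T j * ?I j x) = ?P * iexp (u * x)
        * (\<Sum>j\<in>J. a j * cnj (of_real (t * x) powr of_real (q j)) * iexp (v j * (t * x)))"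
      by (simp only: sum_distrib_left)
  qed
  finally have "(\<Sum>j\<in>J. a j * ?T j * frac_deriv (r + q j) (char M) (u + v j * t)) = \<dots>" .
  moreover have "z / of_real (t powr (p + 1)) = t powr (- p - 1) *\<^sub>R z" for z :: complex
    using powr_minus[of t "p + 1"] by (simp add: scaleR_conv_of_real divide_inverse mult.commute)
  ultimately show ?thesis by (simp only: lhs_integrand_def)
qed

theorem theorem2p5:
  fixes M :: "'a measure" and X :: "'a \<Rightarrow> real"
    and f g :: "real \<Rightarrow> complex"
    and p r u :: real
    and J :: "'j set" and a :: "'j \<Rightarrow> complex" and q v :: "'j \<Rightarrow> real"
  assumes "prob_space M" and "X \<in> borel_measurable M"
    and "f = char (distr M borel X)"
    and "finite J"
    and "\<forall>j\<in>J. a j \<noteq> 0" and "\<forall>j\<in>J. q j \<ge> 0"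
    and "\<forall>t. g t = (\<Sum>j\<in>J. a j * cnj (complex_of_real t powr of_real (q j)) * iexp (v j * t))"
    and "\<forall>j\<in>J. (v j \<noteq> 0 \<longrightarrow> p > q j - 1) \<and> (v j = 0 \<longrightarrow> p > q j)"
    and "\<exists>q0 > max 0 p. (\<lambda>t. norm (g t)) \<in> O[nhds 0](\<lambda>t. \<bar>t\<bar> powr q0)"
    and "\<forall>j\<in>J. abs_moment M X (r + p) + abs_moment M X (r + q j) < \<infinity>"
  shows "\<exists>L.
    has_improper_integral (lhs_integrand J a q v p r u f) L \<and>
    ((\<forall>j\<in>J. q j < p) \<or> (\<exists>j\<in>J. q j > p) \<longrightarrow>
       has_integral_inf_minus (lhs_integrand J a q v p r u f) L) \<and>
    ((\<forall>j\<in>J. q j < p) \<longrightarrow>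
       set_integrable lborel {0<..} (lhs_integrand J a q v p r u f) \<and>
       (LBINT t:{0<..}. lhs_integrand J a q v p r u f t) = L) \<and>
    1 / (\<i> powr of_real r) * L =
      c_plus p g * (\<integral>\<omega>. of_real (pos_pow (X \<omega>) (r + p)) * iexp (u * X \<omega>) \<partial>M) +
      exp (- \<i> * of_real (pi * r)) * c_minus p g *
        (\<integral>\<omega>. of_real (neg_pow (X \<omega>) (r + p)) * iexp (u * X \<omega>) \<partial>M)"
proof (cases "J = {}")
  \<comment> \<open>For empty \<open>J\<close> the moment condition is vacuous and supplies no
    moment of order \<open>r + p\<close>; but then both sides are 0.\<close>
  case True
  have "lhs_integrand J a q v p r u f = (\<lambda>t. 0)"
    using True by (simp add: fun_eq_iff lhs_integrand_def)
  moreover have "g = (\<lambda>t. 0)"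
    using True assms(7) by (simp add: fun_eq_iff)
  moreover have lim0: "((\<lambda>(\<epsilon>, T). 0 :: complex) \<longlongrightarrow> 0) zero_inf"
    by (simp only: case_prod_unfold tendsto_const)
  have "c_plus p (\<lambda>t. 0) = 0"
    unfolding c_plus_def div_0 set_lebesgue_integral_zero by (rule tendsto_Lim[OF zero_inf_neq_bot lim0])
  moreover have "c_minus p (\<lambda>t. 0) = 0"
    unfolding c_minus_def div_0 set_lebesgue_integral_zero by (rule tendsto_Lim[OF zero_inf_neq_bot lim0])
  moreover have "has_improper_integral (\<lambda>t. 0) 0"
    unfolding has_improper_integral_def set_lebesgue_integral_zero
    by (intro conjI lim0) (simp add: set_integrable_def)
  moreover have "has_integral_inf_minus (\<lambda>t. 0) 0"
    by (simp add: has_integral_inf_minus_def set_integrable_def)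
  ultimately show ?thesis
    by (intro exI[of _ 0]) (simp add: set_integrable_def)
next
  case J: False
  define N where "N = distr M borel X"
  interpret prob_space M by (rule assms(1))
  note [measurable] = assms(2)
  interpret N: real_distribution N
    unfolding N_def using assms(2) by (rule real_distribution_distr)
  have g: "g t = (\<Sum>j\<in>J. a j * cnj (complex_of_real t powr of_real (q j)) * iexp (v j * t))" for t
    using assms(7) by blast
  have q: "q j \<ge> 0" if "j \<in> J" for j using assms(6) that by blast
  have fin: "abs_moment M X (r + p) < \<infinity>" "j \<in> J \<Longrightarrow> abs_moment M X (r + q j) < \<infinity>" for j
    using assms(10) J by (auto simp: less_top[symmetric] ennreal_add_eq_top)
  note moment_p = abs_moment_finite[OF assms(1,2) fin(1), folded N_def]
  note moment_q = abs_moment_finite[OF assms(1,2) fin(2), folded N_def]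
  obtain q0 where q0: "q0 > max 0 p" and bigo: "(\<lambda>t. norm (g t)) \<in> O[nhds 0](\<lambda>t. \<bar>t\<bar> powr q0)"
    using assms(9) by blast
  then obtain C where "\<forall>\<^sub>F t in nhds 0. norm (norm (g t)) \<le> C * norm (\<bar>t\<bar> powr q0)"
    by (elim landau_o.bigE)
  then obtain d where d: "d > 0" and small: "\<And>t. \<bar>t\<bar> < d \<Longrightarrow> norm (g t) \<le> C * \<bar>t\<bar> powr q0"
    by (auto simp: eventually_nhds_metric dist_real_def)
  \<comment> \<open>For a negative argument the conjugated power has the constant phase
    \<open>cnj (cis (pi * q j))\<close>, which is moved into the coefficient.\<close>
  define b where "b = (\<lambda>\<sigma>::real. \<lambda>j. a j * (if \<sigma> < 0 then cnj (cis (pi * q j)) else 1))"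
  have gs: "g (\<sigma> * s) = (\<Sum>j\<in>J. b \<sigma> j * of_real (s powr q j) * iexp ((\<sigma> * v j) * s))"
    if "\<bar>\<sigma>\<bar> = 1" "s > 0" for \<sigma> s
    unfolding g powr_of_real_eq b_def using that
    by (intro sum.cong refl) (auto simp: abs_mult mult_less_0_iff mult_ac)
  have g_meas [measurable]: "g \<in> borel_measurable borel"
  proof -
    have "g = (\<lambda>t. \<Sum>j\<in>J. a j * (of_real (\<bar>t\<bar> powr q j) * (if t < 0 then cnj (cis (pi * q j)) else 1)) * iexp (v j * t))"
      unfolding g powr_of_real_eq fun_eq_iff by (auto intro!: sum.cong)
    then show ?thesis by simp
  qed
  have gs_meas: "(\<lambda>s. g (\<sigma> * s)) \<in> borel_measurable borel" for \<sigma> by measurable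
  have q0p: "q0 > p" using q0 by simp
  have gs_small: "norm (g (\<sigma> * s)) \<le> C * s powr q0" if "\<bar>\<sigma>\<bar> = 1" "0 < s" "s < d" for \<sigma> s
    using small[of "\<sigma> * s"] that by (simp add: abs_mult)
  have K: "oscillatory_kernel J (b \<sigma>) q (\<lambda>j. \<sigma> * v j) p q0 C d (\<lambda>s. g (\<sigma> * s))" if "\<bar>\<sigma>\<bar> = 1" for \<sigma>
    by (rule oscillatory_kernel.intro[OF assms(4) gs[OF that] gs_meas q0p d gs_small[OF that]])
  define c where "c = (\<lambda>\<sigma>. Lim at_top (\<lambda>B. LBINT s:{0<..<B}. s powr (- p - 1) *\<^sub>R g (\<sigma> * s)))"
  have c_lim: "((\<lambda>B. LBINT s:{0<..<B}. s powr (- p - 1) *\<^sub>R g (\<sigma> * s)) \<longlongrightarrow> c \<sigma>) at_top"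
    if \<sigma>: "\<bar>\<sigma>\<bar> = 1" for \<sigma>
  proof -
    have "\<exists>c. ((\<lambda>B. LBINT s:{0<..<B}. s powr (- p - 1) *\<^sub>R g (\<sigma> * s)) \<longlongrightarrow> c) at_top"
    proof (rule oscillatory_kernel.kernel_integral_convergent[OF K[OF \<sigma>]])
      have "\<sigma> \<noteq> 0" using \<sigma> by auto
      then show "q j < p + 1" if "j \<in> J" "\<sigma> * v j \<noteq> 0" for j using assms(8) that by force
      show "q j < p" if "j \<in> J" "\<sigma> * v j = 0" for j using assms(8) that \<open>\<sigma> \<noteq> 0\<close> by simp
    qed
    then obtain c' where c': "((\<lambda>B. LBINT s:{0<..<B}. s powr (- p - 1) *\<^sub>R g (\<sigma> * s)) \<longlongrightarrow> c') at_top" ..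
    moreover have "c \<sigma> = c'"
      unfolding c_def by (rule tendsto_Lim[OF _ c']) simp
    ultimately show ?thesis by simp
  qed
  \<comment> \<open>The two signs have separate constants, and their maximum serves both. The weight
    \<open>e\<close> is 1 for the primitive itself and \<open>1 + B powr (Q - p)\<close> for the
    absolute one.\<close>
  have bounded_pm: "\<exists>D. \<forall>\<sigma>. \<bar>\<sigma>\<bar> = 1 \<longrightarrow> (\<forall>B. h \<sigma> B \<le> D * e B)"
    if h: "\<And>\<sigma>. \<bar>\<sigma>\<bar> = 1 \<Longrightarrow> \<exists>D. \<forall>B. h \<sigma> B \<le> D * e B" and e: "\<And>B. e B \<ge> 0"
    for h :: "real \<Rightarrow> real \<Rightarrow> real" and e :: "real \<Rightarrow> real"
  proof -
    obtain D1 D2 where D: "h 1 B \<le> D1 * e B" "h (-1) B \<le> D2 * e B" for B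
      using h[of 1] h[of "-1"] by auto
    have "D1 * e B \<le> max D1 D2 * e B" "D2 * e B \<le> max D1 D2 * e B" for B
      by (intro mult_right_mono e; simp)+
    then have "h 1 B \<le> max D1 D2 * e B" "h (-1) B \<le> max D1 D2 * e B" for B
      using D[of B] order_trans by blast+
    moreover have "\<sigma> = 1 \<or> \<sigma> = -1" if "\<bar>\<sigma>\<bar> = 1" for \<sigma> :: real using that by linarith
    ultimately show ?thesis by metis
  qed
  have "\<exists>D. \<forall>\<sigma>. \<bar>\<sigma>\<bar> = 1 \<longrightarrow> (\<forall>B. norm (LBINT s:{0<..<B}. s powr (- p - 1) *\<^sub>R g (\<sigma> * s)) \<le> D * 1)"
    by (rule bounded_pm, unfold mult_1_right)
       (rule oscillatory_kernel.kernel_integral_bounded[OF K c_lim], assumption, assumption, simp)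
  then obtain D where
    "\<forall>\<sigma>. \<bar>\<sigma>\<bar> = 1 \<longrightarrow> (\<forall>B. norm (LBINT s:{0<..<B}. s powr (- p - 1) *\<^sub>R g (\<sigma> * s)) \<le> D * 1)" ..
  then have D: "norm (LBINT s:{0<..<B}. s powr (- p - 1) *\<^sub>R g (\<sigma> * s)) \<le> D" if "\<bar>\<sigma>\<bar> = 1" for \<sigma> B
    using that by (simp only: mult_1_right)
  \<comment> \<open>This collects the factors of the phase identity that are independent of
    \<open>j\<close> and \<open>t\<close>, together with the shift by \<open>u\<close>.\<close>
  define W where "W = (\<lambda>x. \<i> powr of_real r * (if x < 0 then exp (- \<i> * of_real (pi * r)) else 1)
        * of_real (\<bar>x\<bar> powr r) * iexp (u * x))"
  have nii: "norm (\<i> powr of_real r) = 1"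
    using norm_powr_ii_times[of 1 r] by simp
  have nexp: "norm (exp (- \<i> * of_real (pi * r))) = 1"
    using norm_exp_i_times[of "- (pi * r)"] by simp
  interpret S: scaled_kernel_average N J "\<lambda>j. norm (a j)" q r p D W g c
  proof unfold_locales
    show "finite J" by (rule assms(4))
    show "W \<in> borel_measurable borel" unfolding W_def by measurable
    show "norm (W x) = \<bar>x\<bar> powr r" for x
      unfolding W_def norm_mult nii norm_exp_i_times using nexp by simp
    show "norm (g x) \<le> (\<Sum>j\<in>J. norm (a j) * \<bar>x\<bar> powr q j)" for x
      unfolding g by (rule sum_norm_le) (simp add: norm_mult powr_of_real_eq)
    show "set_integrable lborel {0<..<B} (\<lambda>s. s powr (- p - 1) *\<^sub>R g (\<sigma> * s))" if "\<bar>\<sigma>\<bar> = 1" for \<sigma> B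
      by (rule oscillatory_kernel.kernel_set_integrable[OF K[OF that]])
    show "((\<lambda>B. LBINT s:{0<..<B}. s powr (- p - 1) *\<^sub>R g (\<sigma> * s)) \<longlongrightarrow> 0) (at_right 0)" if "\<bar>\<sigma>\<bar> = 1" for \<sigma>
      by (rule oscillatory_kernel.kernel_integral_tendsto_0[OF K[OF that]])
  qed (rule q norm_ge_zero c_lim D g_meas moment_p(1) moment_q(1); assumption?)+
  have lhs: "lhs_integrand J a q v p r u f t = S.average t" if t: "t > 0" for t
  proof -
    \<comment> \<open>An atom at 0 forces \<open>r + p\<close> and all \<open>r + q j\<close> to be
      nonnegative. Thus \<open>- r\<close> bounds every \<open>q j\<close> from below and satisfies
      \<open>- r \<le> p < q0\<close>, so the leading-coefficient argument applies with
      \<open>m = - r\<close>.\<close>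
    have atom: "(\<Sum>j\<in>J. if q j = - r then a j else 0) = 0" if "measure N {0} \<noteq> 0"
    proof -
      have nz: "\<not> (AE x in N. x \<noteq> 0)"
        using that N.prob_eq_0[of "{0}"] by auto
      have "\<not> r + p < 0" using moment_p(2) nz by blast
      moreover have "\<not> r + q j < 0" if "j \<in> J" for j using moment_q(2)[OF that] nz by blast
      ultimately show ?thesis
        using q0p d gs_small[of 1] gs[of 1]
        by (intro sum_leading_coefficients_eq_0[of J "- r" q q0 d a v C] assms(4)) (force simp: b_def)+
    qed
    show ?thesis
      unfolding assms(3) N_def[symmetric] S.average_def unfolding W_def g
      using assms(4) t moment_q atom by (intro N.lhs_integrand_char_eq) auto
  qed
  have Iff: "has_improper_integral (lhs_integrand J a q v p r u f) L \<longleftrightarrow> has_improper_integral S.average L"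
    "has_integral_inf_minus (lhs_integrand J a q v p r u f) L \<longleftrightarrow> has_integral_inf_minus S.average L"
    "set_integrable lborel {0<..} (lhs_integrand J a q v p r u f) \<longleftrightarrow> set_integrable lborel {0<..} S.average"
    "(LBINT t:{0<..}. lhs_integrand J a q v p r u f t) = (LBINT t:{0<..}. S.average t)" for L
    by (intro has_improper_integral_cong has_integral_inf_minus_cong set_integrable_cong set_lebesgue_integral_cong refl;
        use lhs in auto)+
  have Ioi: "set_integrable lborel {0<..} S.average" if "\<forall>j\<in>J. q j < p"
    using that by (intro S.average_set_integrable_Ioi oscillatory_kernel.kernel_abs_integrable[OF K]) auto
  have Ioo: "set_integrable lborel {0<..<T} S.average" if h: "(\<forall>j\<in>J. q j < p) \<or> (\<exists>j\<in>J. q j > p)" for T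
  proof (cases "\<forall>j\<in>J. q j < p")
    case True
    show ?thesis by (rule set_integrable_subset[OF Ioi[OF True]]) auto
  next
    case False
    \<comment> \<open>The maximum is attained, so its moment is among those assumed finite. Since
      not all exponents are below \<open>p\<close>, the case assumption provides one above
      \<open>p\<close>, whence \<open>Q > p\<close>.\<close>
    define Q where "Q = Max (q ` J)"
    have "Q \<in> q ` J" unfolding Q_def using J assms(4) by (intro Max_in) auto
    then obtain m where m: "m \<in> J" "Q = q m" by auto
    have Q: "q j \<le> Q" if "j \<in> J" for j unfolding Q_def using that assms(4) by (intro Max_ge) auto
    have Qp: "Q > p" using h False Q by force
    have "\<exists>D. \<forall>\<sigma>. \<bar>\<sigma>\<bar> = 1 \<longrightarrow>
       (\<forall>B. (LBINT s:{0<..<B}. norm (s powr (- p - 1) *\<^sub>R g (\<sigma> * s))) \<le> D * (1 + B powr (Q - p)))"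
    proof (rule bounded_pm)
      show "\<exists>D. \<forall>B. (LBINT s:{0<..<B}. norm (s powr (- p - 1) *\<^sub>R g (\<sigma> * s))) \<le> D * (1 + B powr (Q - p))"
        if "\<bar>\<sigma>\<bar> = 1" for \<sigma>
        using oscillatory_kernel.kernel_abs_integral_le[OF K[OF that] Qp Q] by blast
    qed simp
    then obtain D' where D': "\<forall>\<sigma>. \<bar>\<sigma>\<bar> = 1 \<longrightarrow>
       (\<forall>B. (LBINT s:{0<..<B}. norm (s powr (- p - 1) *\<^sub>R g (\<sigma> * s))) \<le> D' * (1 + B powr (Q - p)))" ..
    show ?thesis
      by (rule S.average_set_integrable_Ioo[OF D'[rule_format]]) (simp_all only: m(2) moment_q(1)[OF m(1)])
  qed
  have Ioi_value: "(LBINT t:{0<..}. S.average t) = S.average_limit" if "\<forall>j\<in>J. q j < p"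
  proof (rule tendsto_unique)
    show "((\<lambda>T. LBINT t:{0<..<T}. S.average t) \<longlongrightarrow> S.average_limit) at_top"
      using S.average_inf_minus[OF Ioo] that by (auto simp: has_integral_inf_minus_def)
  qed (use Ioi[OF that] in \<open>auto intro: tendsto_set_integral_Ioo_at_top\<close>)
  \<comment> \<open>The two-sided limit defining the constants is \<open>c \<sigma>\<close>, because
    the primitive of the kernel starts at 0.\<close>
  have c: "((\<lambda>(\<epsilon>, T). LBINT t:{\<epsilon>..T}. g (\<sigma> * t) / of_real (t powr (p + 1))) \<longlongrightarrow> c \<sigma>) zero_inf"
    if \<sigma>: "\<bar>\<sigma>\<bar> = 1" for \<sigma>
  proof (rule Lim_transform_eventually)
    let ?K = "\<lambda>B. LBINT s:{0<..<B}. s powr (- p - 1) *\<^sub>R g (\<sigma> * s)"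
    have "((\<lambda>z. ?K (snd z) - ?K (fst z)) \<longlongrightarrow> c \<sigma> - 0) zero_inf"
      by (intro tendsto_diff filterlim_compose[OF S.kernel_infinity[OF \<sigma>] filterlim_snd]
          filterlim_compose[OF S.kernel_0[OF \<sigma>] filterlim_fst])
    then show "((\<lambda>z. ?K (snd z) - ?K (fst z)) \<longlongrightarrow> c \<sigma>) zero_inf" by simp
    have "\<forall>\<^sub>F z in zero_inf. fst z \<in> {0<..<1::real} \<and> snd z \<ge> (1::real)"
      by (intro eventually_prodI eventually_at_right_real eventually_ge_at_top) auto
    then show "\<forall>\<^sub>F z in zero_inf. ?K (snd z) - ?K (fst z) =
        (case z of (\<epsilon>, T) \<Rightarrow> LBINT t:{\<epsilon>..T}. g (\<sigma> * t) / of_real (t powr (p + 1)))"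
    proof eventually_elim
      case (elim z)
      have "?K (snd z) - ?K (fst z) = (LBINT t:{fst z..snd z}. t powr (- p - 1) *\<^sub>R g (\<sigma> * t))"
        using elim by (intro set_integral_Ioo_split(1)[symmetric] S.kernel_integrable \<sigma>) auto
      moreover have "t powr (- p - 1) *\<^sub>R w = w / of_real (t powr (p + 1))" for w :: complex and t
        using powr_minus[of t "p + 1"] by (simp add: scaleR_conv_of_real divide_inverse mult.commute)
      ultimately show ?case by (simp add: case_prod_beta)
    qed
  qed
  have cp: "c_plus p g = c 1" and cm: "c_minus p g = c (-1)"
    unfolding c_plus_def c_minus_def using c[of 1] c[of "-1"] by (auto intro!: tendsto_Lim)
  define E1 where "E1 = (\<integral>x. of_real (pos_pow x (r + p)) * iexp (u * x) \<partial>N)"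
  define E2 where "E2 = (\<integral>x. of_real (neg_pow x (r + p)) * iexp (u * x) \<partial>N)"
  have [measurable]: "(\<lambda>x. pos_pow x (r + p)) \<in> borel_measurable borel" "(\<lambda>x. neg_pow x (r + p)) \<in> borel_measurable borel"
    unfolding pos_pow_def neg_pow_def by measurable
  have i1: "integrable N (\<lambda>x. of_real (pos_pow x (r + p)) * iexp (u * x))"
    by (rule Bochner_Integration.integrable_bound[OF moment_p(1)]) (auto simp: norm_mult pos_pow_def)
  have i2: "integrable N (\<lambda>x. of_real (neg_pow x (r + p)) * iexp (u * x))"
    by (rule Bochner_Integration.integrable_bound[OF moment_p(1)]) (auto simp: norm_mult pos_pow_def neg_pow_def)
  \<comment> \<open>The positive and negative parts of \<open>x\<close> have disjoint supports, so a
    single sum encodes the case distinction on the sign; at 0 every factor vanishes.\<close>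
  have "S.average_limit = (\<integral>x. \<i> powr of_real r * c 1 * (of_real (pos_pow x (r + p)) * iexp (u * x)) +
      \<i> powr of_real r * exp (- \<i> * of_real (pi * r)) * c (-1) * (of_real (neg_pow x (r + p)) * iexp (u * x)) \<partial>N)"
    unfolding S.average_limit_def unfolding W_def
    by (intro Bochner_Integration.integral_cong refl)
       (auto simp: pos_pow_def neg_pow_def sgn_if powr_add)
  also have "\<dots> = \<i> powr of_real r * c 1 * E1 + \<i> powr of_real r * exp (- \<i> * of_real (pi * r)) * c (-1) * E2"
    unfolding E1_def E2_def integral_mult_right_zero[symmetric]
    by (intro Bochner_Integration.integral_add integrable_mult_right i1 i2)
  finally have "1 / (\<i> powr of_real r) * S.average_limit = c 1 * E1 + exp (- \<i> * of_real (pi * r)) * c (-1) * E2"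
    by (simp add: distrib_left)
  moreover have "E1 = (\<integral>\<omega>. of_real (pos_pow (X \<omega>) (r + p)) * iexp (u * X \<omega>) \<partial>M)"
    "E2 = (\<integral>\<omega>. of_real (neg_pow (X \<omega>) (r + p)) * iexp (u * X \<omega>) \<partial>M)"
    unfolding E1_def E2_def N_def by (rule integral_distr; measurable)+
  ultimately show ?thesis
    unfolding Iff cp cm using S.average_improper_integral S.average_inf_minus[OF Ioo] Ioi Ioi_value
    by (intro exI[of _ S.average_limit]) auto
qed

end
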